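(* Let $T>0$, $0<\rho<2$, $A\in\mathbb C^{N\times N}$, $B\in\mathbb C^{N\times\ell}$. For every $f\in H^2(0,T;\mathbb C^\ell)$ with $f(0)=f'(0)=0$ and every $(u^0,u^1)\in\mathcal X^3\times\mathcal X^1$, the problem $$v_{tt}+L^2v+\rho Lv_t+Av=-h(Bf''+ABf),\qquad (v(0),v_t(0))=(u^0,u^1)$$ (with homogeneous hinged boundary conditions) has a unique solution such that $$v\in C([0,T];\mathcal X^3)\cap C^1([0,T];\mathcal X^1)\cap H^2(0,T;\mathcal X^{-1}),$$ and $$\|v\|_{C([0,T];\mathcal X^3)}+\|v_t\|_{C([0,T];\mathcal X^1)}+\|v_{tt}\|_{L^2(0,T;\mathcal X^{-1})}\le C_T\left(\|u^0\|_{\mathcal X^3}+\|u^1\|_{\mathcal X^1}+\|f\|_{H^2(0,T;\mathbb C^\ell)}\right).$$ Moreover, for every $0<\eta<\rho$ and each fixed $j,k,s$ (with $1\le j\le p_0$, $1\le k\le g_j$, $1\le s\le r_{j,k}$), $$\sum_{m\ge1}e^{\eta m^2T}\left(m^6|b_{j,k,s,m}(T)|^2+m^2|b'_{j,k,s,m}(T)|^2\right)\le C_{\eta,T}\,\mathcal E_0^2,\qquad \mathcal E_0=\|u^0\|_{\mathcal X^3}+\|u^1\|_{\mathcal X^1}.$$ The constants $C_T$, $C_{\eta,T}$ do not depend on $f,u^0,u^1$.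
   Context: $L=-\partial_{xx}$ is the Dirichlet Laplacian in $L^2(0,\pi)$, with eigenfunctions $\varphi_m(x)=\sqrt{2/\pi}\,\sin(mx)$, $L\varphi_m=m^2\varphi_m$, $m\ge1$. For $s\in\mathbb R$, $X^s=\{y=\sum_{m\ge1}y_m\varphi_m:\ \|y\|_{X^s}^2:=\sum_m m^{2s}|y_m|^2<\infty\}$ (for $s<0$ the spectral completion), and $\mathcal X^s:=(X^s)^N$. $h(x)=x/\pi$, whose Fourier coefficients are $x_m=(-1)^{m+1}\sqrt{2/\pi}\,m^{-1}$. The equation for $v$ is understood with $L$ acting spectrally, i.e. the Fourier coefficients $v_m(t)\in\mathbb C^N$ satisfy $v_m''+\rho m^2v_m'+m^4v_m+Av_m=-x_m(Bf''+ABf)$. $\sigma(A)=\{\gamma_1,\dots,\gamma_{p_0}\}$ are the distinct eigenvalues of $A$, $g_j$ is the geometric multiplicity of $\gamma_j$ and $r_{j,1},\dots,r_{j,g_j}$ its Jordan-block sizes. Fix a basis $\{\psi_{j,k,s}\}_{1\le j\le p_0,\,1\le k\le g_j,\,1\le s\le r_{j,k}}$ of $\mathbb C^N$ consisting of adjoint Jordan chains: $A^*\psi_{j,k,s}=\overline{\gamma_j}\psi_{j,k,s}+\psi_{j,k,s-1}$, $\psi_{j,k,0}=0$. The Hermitian product is linear in the first argument. Let $v^b$ be the free part of $v$, i.e. the solution of the same problem with $f=0$ and initial data $(u^0,u^1)$, and let $b_{j,k,s,m}(t)=\int_0^\pi\langle v^b(x,t),\psi_{j,k,s}\rangle_{\mathbb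 C^N}\varphi_m(x)\,dx$. Equivalently, with $\mathcal P_{j,m}=\partial_t^2+\rho m^2\partial_t+m^4+\gamma_j$: $\mathcal P_{j,m}b_{j,k,s,m}=-b_{j,k,s-1,m}$, $b_{j,k,0,m}=0$, with $b_{j,k,s,m}(0)$, $b'_{j,k,s,m}(0)$ the corresponding coefficients of $u^0,u^1$. *)

theory Defs
  imports "HOL-Analysis.Analysis"
begin

definition hprod :: "complex^'n \<Rightarrow> complex^'n \<Rightarrow> complex" where
  "hprod x y = (\<Sum>i\<in>UNIV. x $ i * cnj (y $ i))"

definition adjoint_mat :: "complex^'n^'m \<Rightarrow> complex^'m^'n" where
  "adjoint_mat A = (\<chi> i j. cnj (A $ j $ i))"

definition spectrum :: "complex^'n^'n \<Rightarrow> complex set" where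
  "spectrum A = {c. \<exists>x. x \<noteq> 0 \<and> A *v x = c *s x}"

definition jordan_index :: "nat \<Rightarrow> (nat \<Rightarrow> nat) \<Rightarrow> (nat \<Rightarrow> nat \<Rightarrow> nat) \<Rightarrow> (nat \<times> nat \<times> nat) set" where
  "jordan_index p g r = {(j, k, s). j \<in> {1..p} \<and> k \<in> {1..g j} \<and> s \<in> {1..r j k}}"

definition jordan_chain_basis ::
  "complex^'n^'n \<Rightarrow> nat \<Rightarrow> (nat \<Rightarrow> complex) \<Rightarrow> (nat \<Rightarrow> nat) \<Rightarrow> (nat \<Rightarrow> nat \<Rightarrow> nat)
    \<Rightarrow> (nat \<Rightarrow> nat \<Rightarrow> nat \<Rightarrow> complex^'n) \<Rightarrow> bool" where
  "jordan_chain_basis A p \<gamma> g r e \<longleftrightarrow>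
     (let I = jordan_index p g r; e' = (\<lambda>(j, k, s). e j k s) in
       inj_on e' I \<and> vec.independent (e' ` I) \<and> vec.span (e' ` I) = UNIV \<and>
       (\<forall>j\<in>{1..p}. \<forall>k\<in>{1..g j}. e j k 0 = 0) \<and>
       (\<forall>(j, k, s)\<in>I. A *v e j k s = \<gamma> j *s e j k s + e j k (s - 1)))"

text \<open>\<open>\<gamma> 1, \<dots>, \<gamma> p\<close> are the distinct eigenvalues of \<open>A\<close>, \<open>g j\<close> is the geometric multiplicity
  of \<open>\<gamma> j\<close>, and \<open>r j 1, \<dots>, r j (g j)\<close> are the sizes of its Jordan blocks; a Jordan form with
  these blocks is expressed by a basis of Jordan chains.\<close>

definition jordan_data ::
  "complex^'n^'n \<Rightarrow> nat \<Rightarrow> (nat \<Rightarrow> complex) \<Rightarrow> (nat \<Rightarrow> nat) \<Rightarrow> (nat \<Rightarrow> nat \<Rightarrow> nat) \<Rightarrow> bool" where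
  "jordan_data A p \<gamma> g r \<longleftrightarrow>
     inj_on \<gamma> {1..p} \<and> \<gamma> ` {1..p} = spectrum A \<and>
     (\<forall>j\<in>{1..p}. g j = vec.dim {x. A *v x = \<gamma> j *s x}) \<and>
     (\<forall>j\<in>{1..p}. \<forall>k\<in>{1..g j}. 1 \<le> r j k) \<and>
     (\<exists>e. jordan_chain_basis A p \<gamma> g r e)"


definition phi :: "nat \<Rightarrow> real \<Rightarrow> real" where
  "phi m x = sqrt (2 / pi) * sin (real m * x)"

text \<open>An element \<open>y = (\<Sum>m\<ge>1. y\<^sub>m \<phi>\<^sub>m)\<close> of \<open>(X\<^sup>s)\<^sup>N\<close> is represented by its sequence of
  coefficients \<open>y\<^sub>m \<in> \<complex>\<^sup>N\<close>; for negative \<open>s\<close> this is the spectral completion.  The unused entry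
  \<open>y 0\<close> is normalised to \<open>0\<close>, so that equality of elements is equality of sequences.\<close>

definition Xspace :: "real \<Rightarrow> (nat \<Rightarrow> complex^'n) set" where
  "Xspace s = {y. y 0 = 0 \<and> (\<lambda>m. real m powr (2 * s) * (norm (y m))\<^sup>2) summable_on {1..}}"

definition Xnorm :: "real \<Rightarrow> (nat \<Rightarrow> complex^'n) \<Rightarrow> real" where
  "Xnorm s y = sqrt (\<Sum>\<^sub>\<infinity>m\<in>{1..}. real m powr (2 * s) * (norm (y m))\<^sup>2)"

text \<open>The function on \<open>(0,\<pi>)\<close> represented by \<open>y\<close>.  For \<open>y \<in> (X\<^sup>s)\<^sup>N\<close> with \<open>s > 1/2\<close> the series
  converges absolutely and uniformly, and this is the continuous representative.\<close>

definition fun_of :: "(nat \<Rightarrow> complex^'n) \<Rightarrow> real \<Rightarrow> complex^'n" where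
  "fun_of y x = (\<Sum>\<^sub>\<infinity>m\<in>{1..}. phi m x *\<^sub>R y m)"

definition Lop :: "(nat \<Rightarrow> complex^'n) \<Rightarrow> nat \<Rightarrow> complex^'n" where
  "Lop y m = (real m)\<^sup>2 *\<^sub>R y m"

definition hcoef :: "nat \<Rightarrow> real" where
  "hcoef m = (LINT x:{0<..<pi}|lborel. x / pi * phi m x)"


definition test_fun :: "real \<Rightarrow> (real \<Rightarrow> real) \<Rightarrow> (real \<Rightarrow> real) \<Rightarrow> bool" where
  "test_fun T \<theta> \<theta>' \<longleftrightarrow>
     (\<forall>t. (\<theta> has_real_derivative \<theta>' t) (at t)) \<and> continuous_on UNIV \<theta>' \<and>
     (\<exists>a b. 0 < a \<and> b < T \<and> (\<forall>t. t \<notin> {a..b} \<longrightarrow> \<theta> t = 0))"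

definition L2 :: "real \<Rightarrow> (real \<Rightarrow> complex^'d) \<Rightarrow> bool" where
  "L2 T f \<longleftrightarrow> set_borel_measurable lborel {0<..<T} f \<and>
     set_integrable lborel {0<..<T} (\<lambda>t. (norm (f t))\<^sup>2)"

text \<open>Weak derivative, tested against \<open>C\<^sup>1\<close> functions with compact support in \<open>(0,T)\<close>.\<close>

definition weak_deriv :: "real \<Rightarrow> (real \<Rightarrow> complex^'d) \<Rightarrow> (real \<Rightarrow> complex^'d) \<Rightarrow> bool" where
  "weak_deriv T f f' \<longleftrightarrow>
     (\<forall>\<theta> \<theta>'. test_fun T \<theta> \<theta>' \<longrightarrow>
       (LINT t:{0<..<T}|lborel. \<theta>' t *\<^sub>R f t) = - (LINT t:{0<..<T}|lborel. \<theta> t *\<^sub>R f' t))"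

text \<open>\<open>f \<in> H\<^sup>2(0,T)\<close>, with weak derivatives \<open>f'\<close> and \<open>f''\<close>.\<close>

definition H2 :: "real \<Rightarrow> (real \<Rightarrow> complex^'d) \<Rightarrow> (real \<Rightarrow> complex^'d) \<Rightarrow> (real \<Rightarrow> complex^'d) \<Rightarrow> bool" where
  "H2 T f f' f'' \<longleftrightarrow> L2 T f \<and> L2 T f' \<and> L2 T f'' \<and> weak_deriv T f f' \<and> weak_deriv T f' f''"

definition H2norm :: "real \<Rightarrow> (real \<Rightarrow> complex^'d) \<Rightarrow> (real \<Rightarrow> complex^'d) \<Rightarrow> (real \<Rightarrow> complex^'d) \<Rightarrow> real" where
  "H2norm T f f' f'' =
     sqrt ((LINT t:{0<..<T}|lborel. (norm (f t))\<^sup>2) + (LINT t:{0<..<T}|lborel. (norm (f' t))\<^sup>2)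
         + (LINT t:{0<..<T}|lborel. (norm (f'' t))\<^sup>2))"

text \<open>The value at \<open>0\<close> of the continuous representative.\<close>

definition initial_value :: "real \<Rightarrow> (real \<Rightarrow> complex^'d) \<Rightarrow> complex^'d \<Rightarrow> bool" where
  "initial_value T f a \<longleftrightarrow>
     (\<exists>g. continuous_on {0..T} g \<and> (AE t in lborel. t \<in> {0<..<T} \<longrightarrow> g t = f t) \<and> g 0 = a)"


definition C0X :: "real \<Rightarrow> real \<Rightarrow> (real \<Rightarrow> nat \<Rightarrow> complex^'n) \<Rightarrow> bool" where
  "C0X T s v \<longleftrightarrow>
     (\<forall>t\<in>{0..T}. v t \<in> Xspace s \<and>
        ((\<lambda>\<tau>. Xnorm s (\<lambda>m. v \<tau> m - v t m)) \<longlongrightarrow> 0) (at t within {0..T}))"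

text \<open>\<open>v \<in> C\<^sup>1([0,T]; X\<^sup>s)\<close> with derivative \<open>v'\<close>.\<close>

definition C1X :: "real \<Rightarrow> real \<Rightarrow> (real \<Rightarrow> nat \<Rightarrow> complex^'n) \<Rightarrow> (real \<Rightarrow> nat \<Rightarrow> complex^'n) \<Rightarrow> bool" where
  "C1X T s v v' \<longleftrightarrow> C0X T s v \<and> C0X T s v' \<and>
     (\<forall>t\<in>{0..T}.
        ((\<lambda>\<tau>. Xnorm s (\<lambda>m. (1 / (\<tau> - t)) *\<^sub>R (v \<tau> m - v t m) - v' t m)) \<longlongrightarrow> 0)
          (at t within {0..T}))"

definition C0norm :: "real \<Rightarrow> real \<Rightarrow> (real \<Rightarrow> nat \<Rightarrow> complex^'n) \<Rightarrow> real" where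
  "C0norm T s v = (SUP t\<in>{0..T}. Xnorm s (v t))"

text \<open>Since the \<open>X\<^sup>s\<close> are separable Hilbert spaces, strong measurability is measurability of all
  coefficients (Pettis), and Bochner integrals, hence weak derivatives, are computed
  coefficientwise.\<close>

definition L2X :: "real \<Rightarrow> real \<Rightarrow> (real \<Rightarrow> nat \<Rightarrow> complex^'n) \<Rightarrow> bool" where
  "L2X T s w \<longleftrightarrow>
     (AE t in lborel. t \<in> {0<..<T} \<longrightarrow> w t \<in> Xspace s) \<and>
     (\<forall>m\<ge>1. set_borel_measurable lborel {0<..<T} (\<lambda>t. w t m)) \<and>
     set_integrable lborel {0<..<T} (\<lambda>t. (Xnorm s (w t))\<^sup>2)"

definition L2Xnorm :: "real \<Rightarrow> real \<Rightarrow> (real \<Rightarrow> nat \<Rightarrow> complex^'n) \<Rightarrow> real" where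
  "L2Xnorm T s w = sqrt (LINT t:{0<..<T}|lborel. (Xnorm s (w t))\<^sup>2)"

definition weak_derivX :: "real \<Rightarrow> (real \<Rightarrow> nat \<Rightarrow> complex^'n) \<Rightarrow> (real \<Rightarrow> nat \<Rightarrow> complex^'n) \<Rightarrow> bool" where
  "weak_derivX T w w' \<longleftrightarrow> (\<forall>m\<ge>1. weak_deriv T (\<lambda>t. w t m) (\<lambda>t. w' t m))"

definition H2X ::
  "real \<Rightarrow> real \<Rightarrow> (real \<Rightarrow> nat \<Rightarrow> complex^'n) \<Rightarrow> (real \<Rightarrow> nat \<Rightarrow> complex^'n)
    \<Rightarrow> (real \<Rightarrow> nat \<Rightarrow> complex^'n) \<Rightarrow> bool" where
  "H2X T s v v' v'' \<longleftrightarrow>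
     L2X T s v \<and> L2X T s v' \<and> L2X T s v'' \<and> weak_derivX T v v' \<and> weak_derivX T v' v''"


text \<open>\<open>v\<close> solves the problem in \<open>C([0,T]; X\<^sup>3) \<inter> C\<^sup>1([0,T]; X\<^sup>1) \<inter> H\<^sup>2(0,T; X\<^sup>-\<^sup>1)\<close>, with
  \<open>v\<^sub>t = v'\<close> and \<open>v\<^sub>t\<^sub>t = v''\<close>.  The hinged boundary conditions are part of \<open>v t \<in> X\<^sup>3\<close>, and the
  equation is an equation in \<open>X\<^sup>-\<^sup>1\<close>, for almost every \<open>t\<close>.\<close>

definition solution ::
  "real \<Rightarrow> real \<Rightarrow> complex^'n^'n \<Rightarrow> complex^'l^'n \<Rightarrow> (real \<Rightarrow> complex^'l) \<Rightarrow> (real \<Rightarrow> complex^'l)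
    \<Rightarrow> (nat \<Rightarrow> complex^'n) \<Rightarrow> (nat \<Rightarrow> complex^'n)
    \<Rightarrow> (real \<Rightarrow> nat \<Rightarrow> complex^'n) \<Rightarrow> (real \<Rightarrow> nat \<Rightarrow> complex^'n) \<Rightarrow> (real \<Rightarrow> nat \<Rightarrow> complex^'n) \<Rightarrow> bool" where
  "solution T \<rho> A B f f'' u0 u1 v v' v'' \<longleftrightarrow>
     C0X T 3 v \<and> C1X T 1 v v' \<and> H2X T (-1) v v' v'' \<and>
     (AE t in lborel. t \<in> {0<..<T} \<longrightarrow>
        (\<forall>m\<ge>1. v'' t m + Lop (Lop (v t)) m + \<rho> *\<^sub>R Lop (v' t) m + A *v v t m
           = - (hcoef m *\<^sub>R (B *v f'' t + (A ** B) *v f t)))) \<and>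
     v 0 = u0 \<and> v' 0 = u1"

definition bcoef :: "(real \<Rightarrow> nat \<Rightarrow> complex^'n) \<Rightarrow> complex^'n \<Rightarrow> nat \<Rightarrow> real \<Rightarrow> complex" where
  "bcoef v \<psi> m t =
     (LINT x:{0<..<pi}|lborel. hprod (fun_of (v t) x) \<psi> * complex_of_real (phi m x))"

end

theory Submission
  imports Defs
begin

text \<open>
The sine functions diagonalise \<open>L\<close>, so the problem splits into the oscillators
\<open>v\<^sub>m'' + \<rho> q v\<^sub>m' + q\<^sup>2 v\<^sub>m + A v\<^sub>m = - x\<^sub>m F\<close> in \<open>\<complex>\<^sup>N\<close>, with \<open>q = m\<^sup>2\<close> and \<open>F = B f'' + A B f\<close>. The whole
proof is one energy estimate for these oscillators, with constants that do not depend on \<open>m\<close>.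

The energy \<open>\<parallel>v' + (\<rho> q / 2) v\<parallel>\<^sup>2 + (1 - \<rho>\<^sup>2 / 4) q\<^sup>2 \<parallel>v\<parallel>\<^sup>2\<close> is equivalent to \<open>\<parallel>v'\<parallel>\<^sup>2 + q\<^sup>2 \<parallel>v\<parallel>\<^sup>2\<close> because
\<open>0 < \<rho> < 2\<close>. Its derivative consists of \<open>- \<rho> q\<close> times the energy, of a coupling term, which is at most
a fixed multiple \<open>c\<close> of the energy since \<open>A\<close> is bounded and \<open>q \<ge> 1\<close>, and of the power of the force
(\<open>mode_energy_identity\<close>). Two consequences are drawn.

First, the damping absorbs the force at the price of \<open>\<parallel>x\<^sub>m F\<parallel>\<^sup>2 / (\<rho> q)\<close> (\<open>damped_mode_energy_bound\<close>).
Multiplied by \<open>q\<close>, the energy of a mode becomes its contribution to the squared norms of \<open>X\<^sup>3\<close> and \<open>X\<^sup>1\<close>,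
and the force contributes \<open>x\<^sub>m\<^sup>2 \<parallel>F\<parallel>\<^sup>2 / \<rho>\<close>. As \<open>x\<^sub>m\<^sup>2\<close> is summable, all modes together have a summable
majorant that is uniform in time. It gives the estimates, and through dominated convergence the
continuity and differentiability of the series (\<open>forced_solution_exists\<close>).

Second, without force the energy decays like \<open>exp (- (\<rho> q - c) t)\<close>, which beats the weight \<open>exp (\<eta> q T)\<close>
for \<open>\<eta> < \<rho>\<close> (\<open>damped_mode_weighted_decay\<close>). The coefficient \<open>b\<^sub>m\<close> is the component of \<open>v\<^sub>m\<close> along \<open>\<psi>\<close>, by
orthonormality of the sines, and inherits this decay (\<open>free_solution_coefficient_decay\<close>).

Since \<open>F\<close> is only square integrable, \<open>v\<^sub>m'\<close> is a primitive of an integrable function and no more. The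
equation of a mode is therefore used in integrated form, and two facts about primitives carry the
argument: a product rule, proved with Fubini's theorem (\<open>indefinite_integral_product_rule\<close>), and the
lemma of du Bois-Reymond, which shows that every weak solution satisfies the integrated equations
(\<open>solution_damped_mode\<close>) and so makes uniqueness a case of the energy decay.
\<close>

section \<open>Linear Volterra equations\<close>

text \<open>The integral operator is a contraction for the sup norm weighted by \<open>exp (- 2 K t)\<close>, where \<open>K\<close>
bounds \<open>M\<close>: the weight turns \<open>K \<integral> exp (2 K s) ds\<close> into a factor at most \<open>1/2\<close>, for every
\<open>T\<close>. The inhomogeneity \<open>h\<close> is only continuous, which lets it
contain the primitive of a force that is merely integrable.\<close>

lemma linear_volterra_solution:
  fixes M :: "'a::euclidean_space \<Rightarrow> 'a" and h :: "real \<Rightarrow> 'a"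
  assumes M: "bounded_linear M" and h: "continuous_on {0..T} h"
  obtains y where "continuous_on {0..T} y"
    and "\<And>t. t \<in> {0..T} \<Longrightarrow> y t = h t + integral {0..t} (\<lambda>s. M (y s))"
proof -
  interpret M: bounded_linear M by fact
  obtain K where K: "0 < K" "\<And>x. norm (M x) \<le> norm x * K" using M.pos_bounded by blast
  \<comment> \<open>The fixed point is sought for \<open>x t = exp (- 2 K t) y t\<close>, extended to a bounded continuous
    function on the line by clamping the time to \<open>[0, T]\<close>.\<close>
  define op where "op x t = exp (- 2 * K * t) *\<^sub>R (h t + integral {0..t} (\<lambda>s. M (exp (2 * K * s) *\<^sub>R apply_bcontfun x s)))"
    for x :: "real \<Rightarrow>\<^sub>C 'a" and t
  have cM: "continuous_on S (\<lambda>s. M (exp (2 * K * s) *\<^sub>R apply_bcontfun x s))" for S x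
    by (intro M.continuous_on continuous_intros continuous_on_apply_bcontfun)
  have "continuous_on (cbox 0 T) (op x)" for x
    unfolding op_def cbox_interval
    by (intro continuous_intros h indefinite_integral_continuous_1 integrable_continuous_real cM)
  then have "\<exists>g :: real \<Rightarrow>\<^sub>C 'a. \<forall>t. g t = op x (clamp 0 T t)" for x
    by (rule continuous_on_cbox_bcontfunE) blast
  then obtain \<Phi> :: "(real \<Rightarrow>\<^sub>C 'a) \<Rightarrow> (real \<Rightarrow>\<^sub>C 'a)"
    where \<Phi>: "\<And>x t. \<Phi> x t = op x (clamp 0 T t)" by metis
  have op_contr: "dist (op x t) (op y t) \<le> 1/2 * dist x y" if "0 \<le> t" for x y t
  proof -
    let ?m = "\<lambda>x s. M (exp (2 * K * s) *\<^sub>R apply_bcontfun x s)"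
    have i: "?m x integrable_on {0..t}" for x by (intro integrable_continuous_real cM)
    have I: "((\<lambda>s. K * exp (2 * K * s) * dist x y) has_integral
        (exp (2 * K * t) / 2 * dist x y - exp (2 * K * 0) / 2 * dist x y)) {0..t}"
      using that K(1) by (intro fundamental_theorem_of_calculus)
        (auto intro!: derivative_eq_intros simp: has_real_derivative_iff_has_vector_derivative[symmetric])
    have "op x t - op y t = exp (- 2 * K * t) *\<^sub>R integral {0..t} (\<lambda>s. ?m x s - ?m y s)"
      unfolding op_def by (simp add: Henstock_Kurzweil_Integration.integral_diff[OF i i] scaleR_right_diff_distrib scaleR_right_distrib)
    moreover have "norm (integral {0..t} (\<lambda>s. ?m x s - ?m y s)) \<le> exp (2 * K * t) / 2 * dist x y - exp (2 * K * 0) / 2 * dist x y"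
    proof -
      have "norm (?m x s - ?m y s) \<le> K * exp (2 * K * s) * dist x y" for s
      proof -
        have "?m x s - ?m y s = M (exp (2 * K * s) *\<^sub>R (x s - y s))"
          by (simp add: M.diff[symmetric] scaleR_right_diff_distrib)
        also have "norm \<dots> \<le> exp (2 * K * s) * norm (x s - y s) * K"
          using K(2)[of "exp (2 * K * s) *\<^sub>R (x s - y s)"] by simp
        also have "\<dots> \<le> exp (2 * K * s) * dist x y * K"
          using K(1) dist_bounded[of x s y] by (intro mult_right_mono mult_left_mono) (auto simp: dist_norm)
        finally show ?thesis by (simp add: mult_ac)
      qed
      then have "norm (integral {0..t} (\<lambda>s. ?m x s - ?m y s)) \<le> integral {0..t} (\<lambda>s. K * exp (2 * K * s) * dist x y)"
        using I i by (intro Henstock_Kurzweil_Integration.integral_norm_bound_integral Henstock_Kurzweil_Integration.integrable_diff) auto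
      then show ?thesis using integral_unique[OF I] by simp
    qed
    ultimately have "dist (op x t) (op y t) \<le> exp (- 2 * K * t) * (exp (2 * K * t) / 2 * dist x y - exp (2 * K * 0) / 2 * dist x y)"
      by (simp add: dist_norm)
    also have "\<dots> = 1/2 * dist x y - exp (- 2 * K * t) * (1/2 * dist x y)"
      by (simp add: right_diff_distrib exp_minus field_simps)
    also have "\<dots> \<le> 1/2 * dist x y" by simp
    finally show ?thesis .
  qed
  have "\<exists>!x. \<Phi> x = x"
  proof (rule banach_fix_type[of "1/2"])
    show "\<forall>x y. dist (\<Phi> x) (\<Phi> y) \<le> 1 / 2 * dist x y"
    proof (intro allI dist_bound)
      fix x y t
      show "dist (\<Phi> x t) (\<Phi> y t) \<le> 1 / 2 * dist x y"
      proof (cases "0 \<le> T")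
        case True
        then have "clamp 0 T t \<in> cbox 0 T" by (intro clamp_in_interval) auto
        then show ?thesis unfolding \<Phi> by (intro op_contr) (simp add: cbox_interval)
      next
        case False
        then have "clamp 0 T t = 0" by (simp add: clamp_def)
        then show ?thesis unfolding \<Phi> using op_contr[of 0 x y] by simp
      qed
    qed
  qed auto
  then obtain x where x: "\<Phi> x = x" by blast
  show thesis
  proof
    show "continuous_on {0..T} (\<lambda>t. exp (2 * K * t) *\<^sub>R x t)" by (intro continuous_intros continuous_on_apply_bcontfun)
    fix t assume t: "t \<in> {0..T}"
    have "x t = op x t" using \<Phi>[of x t] t x by (simp add: cbox_interval)
    then show "exp (2 * K * t) *\<^sub>R x t = h t + integral {0..t} (\<lambda>s. M (exp (2 * K * s) *\<^sub>R x s))"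
      unfolding op_def by (simp flip: exp_add)
  qed
qed

section \<open>Product rule for primitives of integrable functions\<close>

text \<open>Fubini on the plane, cut along the diagonal: the double integral of \<open>prod (f s) (g r)\<close> factorises,
and its two triangular halves are single integrals against a primitive.\<close>

lemma bilinear_integral_triangle_split:
  fixes f :: "real \<Rightarrow> 'a::euclidean_space" and g :: "real \<Rightarrow> 'b::euclidean_space"
    and prod :: "'a \<Rightarrow> 'b \<Rightarrow> 'c::euclidean_space"
  assumes bil: "bounded_bilinear prod" and f: "integrable lborel f" and g: "integrable lborel g"
  shows "integrable lborel (\<lambda>s. prod (f s) (LINT r|lborel. indicator {..s} r *\<^sub>R g r))"
    and "integrable lborel (\<lambda>r. prod (LINT s|lborel. indicator {..<r} s *\<^sub>R f s) (g r))"
    and "prod (integral\<^sup>L lborel f) (integral\<^sup>L lborel g)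
      = (LINT s|lborel. prod (f s) (LINT r|lborel. indicator {..s} r *\<^sub>R g r))
      + (LINT r|lborel. prod (LINT s|lborel. indicator {..<r} s *\<^sub>R f s) (g r))"
proof -
  interpret prod: bounded_bilinear prod by fact
  obtain K where K: "\<And>x y. norm (prod x y) \<le> norm x * norm y * K" and K0: "0 \<le> K"
    using prod.nonneg_bounded by blast
  have fm[measurable]: "f \<in> borel_measurable borel" and gm[measurable]: "g \<in> borel_measurable borel"
    using f g by auto
  have pm[measurable]: "(\<lambda>x. prod (u x) (w x)) \<in> borel_measurable M"
    if "u \<in> borel_measurable M" "w \<in> borel_measurable M" for u w and M :: "'m measure"
    by (rule borel_measurable_continuous_Pair[OF that])
      (intro prod.continuous_on continuous_intros)
  let ?P = "lborel \<Otimes>\<^sub>M lborel :: (real \<times> real) measure"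
  define k where "k = (\<lambda>z. prod (f (fst z)) (g (snd z)))"
  have k[measurable]: "k \<in> borel_measurable ?P" unfolding k_def by measurable
  have pf: "bounded_linear (prod x)" for x by (rule prod.bounded_linear_right)
  have pg: "bounded_linear (\<lambda>x. prod x y)" for y by (rule prod.bounded_linear_left)
  have iP: "integrable ?P k"
  proof (rule lborel_pair.Fubini_integrable)
    show "integrable lborel (\<lambda>x. LINT y|lborel. norm (k (x, y)))"
    proof (rule Bochner_Integration.integrable_bound)
      show "integrable lborel (\<lambda>x. norm (f x) * (LINT y|lborel. norm (g y) * K))"
        using f by (intro integrable_mult_left integrable_norm)
      show "AE x in lborel. norm (LINT y|lborel. norm (k (x, y)))
          \<le> norm (norm (f x) * (LINT y|lborel. norm (g y) * K))"
      proof (rule AE_I2)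
        fix x
        have "norm (LINT y|lborel. norm (k (x, y))) = (LINT y|lborel. norm (k (x, y)))" by simp
        also have "\<dots> \<le> (LINT y|lborel. norm (f x) * (norm (g y) * K))"
          by (rule integral_mono)
             (use K f g pf in \<open>auto simp: k_def mult_ac intro!: integrable_norm integrable_mult_right
                integrable_bounded_linear[OF pf]\<close>)
        also have "\<dots> = norm (f x) * (LINT y|lborel. norm (g y) * K)" by simp
        finally show "norm (LINT y|lborel. norm (k (x, y)))
          \<le> norm (norm (f x) * (LINT y|lborel. norm (g y) * K))" by simp
      qed
    qed simp
    show "AE x in lborel. integrable lborel (\<lambda>y. k (x, y))"
      unfolding k_def by (auto intro!: integrable_bounded_linear[OF pf] g)
  qed simp
  let ?A = "{z::real\<times>real. snd z \<le> fst z}"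
  have "closed ?A" by (intro closed_Collect_le continuous_intros)
  then have A[measurable]: "?A \<in> sets ?P"
    using borel_closed[of ?A] by (simp only: lborel_prod sets_lborel)
  define k1 where "k1 = (\<lambda>z. indicator ?A z *\<^sub>R k z)"
  define k2 where "k2 = (\<lambda>z. indicator (- ?A) z *\<^sub>R k z)"
  have "- ?A \<in> sets ?P" using sets.compl_sets[OF A] by (simp add: Compl_eq_Diff_UNIV space_pair_measure del: sets_lborel)
  then have i1: "integrable ?P k1" and i2: "integrable ?P k2"
    unfolding k1_def k2_def using iP A
    by (auto intro: integrable_mult_indicator)
  have e1: "(LINT y|lborel. k1 (s, y)) = prod (f s) (LINT r|lborel. indicator {..s} r *\<^sub>R g r)" for s
  proof -
    have "(LINT y|lborel. k1 (s, y)) = (LINT y|lborel. prod (f s) (indicator {..s} y *\<^sub>R g y))"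
      by (auto simp: k1_def k_def prod.scaleR_right indicator_def intro!: Bochner_Integration.integral_cong)
    also have "\<dots> = prod (f s) (LINT r|lborel. indicator {..s} r *\<^sub>R g r)"
      by (rule integral_bounded_linear[OF pf]) (auto intro!: integrable_mult_indicator g)
    finally show ?thesis .
  qed
  have e2: "(LINT s|lborel. k2 (s, r)) = prod (LINT s|lborel. indicator {..<r} s *\<^sub>R f s) (g r)" for r
  proof -
    have "(LINT s|lborel. k2 (s, r)) = (LINT s|lborel. prod (indicator {..<r} s *\<^sub>R f s) (g r))"
      by (auto simp: k2_def k_def prod.scaleR_left indicator_def intro!: Bochner_Integration.integral_cong)
    also have "\<dots> = prod (LINT s|lborel. indicator {..<r} s *\<^sub>R f s) (g r)"
      by (rule integral_bounded_linear[OF pg]) (auto intro!: integrable_mult_indicator f)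
    finally show ?thesis .
  qed
  show "integrable lborel (\<lambda>s. prod (f s) (LINT r|lborel. indicator {..s} r *\<^sub>R g r))"
    using lborel_pair.integrable_fst'[OF i1] by (simp add: e1)
  show "integrable lborel (\<lambda>r. prod (LINT s|lborel. indicator {..<r} s *\<^sub>R f s) (g r))"
    using lborel_pair.integrable_snd[of "\<lambda>x y. k2 (x,y)"] i2 by (simp add: e2)
  have "integral\<^sup>L ?P k = (LINT s|lborel. LINT r|lborel. k (s, r))"
    using lborel_pair.integral_fst'[OF iP] by simp
  also have "\<dots> = (LINT s|lborel. prod (f s) (integral\<^sup>L lborel g))"
    by (simp add: k_def integral_bounded_linear[OF pf g])
  also have "\<dots> = prod (integral\<^sup>L lborel f) (integral\<^sup>L lborel g)"
    by (rule integral_bounded_linear[OF pg f])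
  finally have "prod (integral\<^sup>L lborel f) (integral\<^sup>L lborel g) = integral\<^sup>L ?P k" by simp
  also have "\<dots> = integral\<^sup>L ?P (\<lambda>z. k1 z + k2 z)"
    by (rule Bochner_Integration.integral_cong) (auto simp: k1_def k2_def indicator_def)
  also have "\<dots> = integral\<^sup>L ?P k1 + integral\<^sup>L ?P k2" by (rule Bochner_Integration.integral_add[OF i1 i2])
  also have "integral\<^sup>L ?P k1 = (LINT s|lborel. prod (f s) (LINT r|lborel. indicator {..s} r *\<^sub>R g r))"
    using lborel_pair.integral_fst'[OF i1] by (simp add: e1)
  also have "integral\<^sup>L ?P k2 = (LINT r|lborel. prod (LINT s|lborel. indicator {..<r} s *\<^sub>R f s) (g r))"
    using lborel_pair.integral_snd[of "\<lambda>x y. k2 (x,y)"] i2 by (simp add: e2)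
  finally show "prod (integral\<^sup>L lborel f) (integral\<^sup>L lborel g)
      = (LINT s|lborel. prod (f s) (LINT r|lborel. indicator {..s} r *\<^sub>R g r))
      + (LINT r|lborel. prod (LINT s|lborel. indicator {..<r} s *\<^sub>R f s) (g r))" .
qed

text \<open>Integration by parts for primitives of integrable functions. Such primitives are in general not
differentiable everywhere, so the fundamental theorem of calculus does not apply to the product.\<close>

lemma indefinite_integral_product_rule:
  fixes f :: "real \<Rightarrow> 'a::euclidean_space" and g :: "real \<Rightarrow> 'b::euclidean_space"
    and prod :: "'a \<Rightarrow> 'b \<Rightarrow> 'c::euclidean_space"
  assumes bil: "bounded_bilinear prod"
    and f: "set_integrable lborel {0..T} f" and g: "set_integrable lborel {0..T} g"
    and F: "\<And>t. t \<in> {0..T} \<Longrightarrow> F t = a + integral {0..t} f"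
    and G: "\<And>t. t \<in> {0..T} \<Longrightarrow> G t = b + integral {0..t} g"
    and t: "t \<in> {0..T}"
  shows "set_integrable lborel {0..t} (\<lambda>s. prod (f s) (G s) + prod (F s) (g s))"
    and "prod (F t) (G t) = prod a b + integral {0..t} (\<lambda>s. prod (f s) (G s) + prod (F s) (g s))"
proof -
  interpret prod: bounded_bilinear prod by fact
  have sub: "set_integrable lborel {0..s} h" if "set_integrable lborel {0..T} h" "s \<in> {0..T}"
    for h :: "real \<Rightarrow> 'd::euclidean_space" and s
    using that by (auto intro: set_integrable_subset)
  have ie: "(LINT r|lborel. indicator {0..s} r *\<^sub>R h r) = integral {0..s} h"
    if "set_integrable lborel {0..T} h" "s \<in> {0..T}" for h :: "real \<Rightarrow> 'd::euclidean_space" and s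
    using set_borel_integral_eq_integral(2)[OF sub[OF that]] by (simp add: set_lebesgue_integral_def)
  define f1 where "f1 = (\<lambda>s. indicator {0..t} s *\<^sub>R f s)"
  define g1 where "g1 = (\<lambda>s. indicator {0..t} s *\<^sub>R g s)"
  have f1: "integrable lborel f1" and g1: "integrable lborel g1"
    using sub[OF f t] sub[OF g t] unfolding f1_def g1_def set_integrable_def by auto
  have pf: "bounded_linear (prod x)" for x by (rule prod.bounded_linear_right)
  have pg: "bounded_linear (\<lambda>x. prod x y)" for y by (rule prod.bounded_linear_left)
  note split = bilinear_integral_triangle_split[OF bil f1 g1]
  have gs: "prod (f1 s) (LINT r|lborel. indicator {..s} r *\<^sub>R g1 r) = prod (f1 s) (G s - b)" for s
  proof (cases "s \<in> {0..t}")
    case True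
    have "(LINT r|lborel. indicator {..s} r *\<^sub>R g1 r) = (LINT r|lborel. indicator {0..s} r *\<^sub>R g r)"
      using True by (intro Bochner_Integration.integral_cong) (auto simp: g1_def indicator_def)
    then show ?thesis using True t ie[OF g, of s] G[of s] by simp
  qed (simp add: f1_def prod.zero_left)
  have fs: "prod (LINT s|lborel. indicator {..<r} s *\<^sub>R f1 s) (g1 r) = prod (F r - a) (g1 r)" for r
  proof (cases "r \<in> {0..t}")
    case True
    have "AE s in lborel. indicator {..<r} s *\<^sub>R f1 s = indicator {0..r} s *\<^sub>R f s"
      using AE_lborel_singleton[of r] by eventually_elim
        (use True in \<open>auto simp: f1_def indicator_def\<close>)
    then have "(LINT s|lborel. indicator {..<r} s *\<^sub>R f1 s) = (LINT s|lborel. indicator {0..r} s *\<^sub>R f s)"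
      using f1 sub[OF f, of r] True t
      by (intro integral_cong_AE) (auto simp: set_integrable_def)
    then show ?thesis using True t ie[OF f, of r] F[of r] by simp
  qed (simp add: g1_def prod.zero_right)
  have i1: "integrable lborel (\<lambda>s. prod (f1 s) (G s - b))"
    using split(1) unfolding gs .
  have i2: "integrable lborel (\<lambda>s. prod (F s - a) (g1 s))"
    using split(2) unfolding fs .
  have i3: "integrable lborel (\<lambda>s. prod (f1 s) b)" and i4: "integrable lborel (\<lambda>s. prod a (g1 s))"
    using f1 g1 by (auto intro: integrable_bounded_linear[OF pf] integrable_bounded_linear[OF pg])
  have eq: "indicator {0..t} s *\<^sub>R (prod (f s) (G s) + prod (F s) (g s))
     = (prod (f1 s) (G s - b) + prod (F s - a) (g1 s)) + (prod (f1 s) b + prod a (g1 s))" for s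
    by (simp add: f1_def g1_def prod.scaleR_left prod.scaleR_right prod.diff_left prod.diff_right algebra_simps)
  show I: "set_integrable lborel {0..t} (\<lambda>s. prod (f s) (G s) + prod (F s) (g s))"
    unfolding set_integrable_def eq using i1 i2 i3 i4 by simp
  have "integral {0..t} (\<lambda>s. prod (f s) (G s) + prod (F s) (g s))
     = (LINT s|lborel. indicator {0..t} s *\<^sub>R (prod (f s) (G s) + prod (F s) (g s)))"
    using set_borel_integral_eq_integral(2)[OF I] by (simp add: set_lebesgue_integral_def)
  also have "\<dots> = (LINT s|lborel. prod (f1 s) (G s - b)) + (LINT s|lborel. prod (F s - a) (g1 s))
     + (prod (LINT s|lborel. f1 s) b + prod a (LINT s|lborel. g1 s))"
    unfolding eq using i1 i2 i3 i4 
    by (simp add: integral_bounded_linear[OF pf g1] integral_bounded_linear[OF pg f1])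
  also have "\<dots> = prod (LINT s|lborel. f1 s) (LINT s|lborel. g1 s)
     + (prod (LINT s|lborel. f1 s) b + prod a (LINT s|lborel. g1 s))"
    using split(3) unfolding gs fs by simp
  also have "(LINT s|lborel. f1 s) = F t - a" unfolding f1_def using ie[OF f t] F[OF t] by simp
  also have "(LINT s|lborel. g1 s) = G t - b" unfolding g1_def using ie[OF g t] G[OF t] by simp
  finally show "prod (F t) (G t) = prod a b + integral {0..t} (\<lambda>s. prod (f s) (G s) + prod (F s) (g s))"
    by (simp add: prod.diff_left prod.diff_right)
qed

section \<open>Weak derivatives of continuous functions\<close>

lemma set_integral_open_eq_integral:
  fixes f :: "real \<Rightarrow> 'a::euclidean_space"
  assumes "set_integrable lborel {0..T} f"
  shows "set_integrable lborel {0<..<T} f" "(LINT t:{0<..<T}|lborel. f t) = integral {0..T} f"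
proof -
  show i: "set_integrable lborel {0<..<T} f" by (rule set_integrable_subset[OF assms]) auto
  show "(LINT t:{0<..<T}|lborel. f t) = integral {0..T} f"
    using set_borel_integral_eq_integral(2)[OF i] by (simp add: integral_open_interval_real)
qed

lemma set_integrable_continuous_scaleR:
  fixes g :: "real \<Rightarrow> 'a::euclidean_space"
  assumes \<theta>: "continuous_on {0..T} \<theta>" and g: "set_integrable lborel {0..T} g"
  shows "set_integrable lborel {0..T} (\<lambda>t. \<theta> t *\<^sub>R g t)"
proof -
  obtain C where C: "\<And>t. t \<in> {0..T} \<Longrightarrow> norm (\<theta> t) \<le> C"
    using compact_imp_bounded[OF compact_continuous_image[OF \<theta>]] by (fastforce simp: bounded_iff)
  have gm: "(\<lambda>t. indicator {0..T} t *\<^sub>R g t) \<in> borel_measurable lborel"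
    using g by (auto simp: set_integrable_def)
  have tm: "(\<lambda>t. indicator {0..T} t *\<^sub>R \<theta> t) \<in> borel_measurable lborel"
    using borel_measurable_continuous_on_indicator[OF _ \<theta>] by simp
  have "(\<lambda>t. (indicator {0..T} t *\<^sub>R \<theta> t) *\<^sub>R (indicator {0..T} t *\<^sub>R g t)) \<in> borel_measurable lborel"
    by (rule borel_measurable_scaleR[OF tm gm])
  moreover have "(\<lambda>t. (indicator {0..T} t *\<^sub>R \<theta> t) *\<^sub>R (indicator {0..T} t *\<^sub>R g t))
      = (\<lambda>t. indicator {0..T} t *\<^sub>R \<theta> t *\<^sub>R g t)"
    by (auto simp: indicator_def)
  ultimately have m: "(\<lambda>t. indicator {0..T} t *\<^sub>R \<theta> t *\<^sub>R g t) \<in> borel_measurable lborel" by simp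
  show ?thesis unfolding set_integrable_def
  proof (rule Bochner_Integration.integrable_bound[OF _ m])
    show "integrable lborel (\<lambda>t. C * norm (indicator {0..T} t *\<^sub>R g t))"
      using g by (intro integrable_mult_right integrable_norm) (simp add: set_integrable_def)
    show "AE t in lborel. norm (indicator {0..T} t *\<^sub>R \<theta> t *\<^sub>R g t) \<le> norm (C * norm (indicator {0..T} t *\<^sub>R g t))"
      by (intro AE_I2) (use C in \<open>force simp: indicator_def intro!: mult_right_mono\<close>)
  qed
qed

lemma indefinite_integral_continuous:
  fixes g :: "real \<Rightarrow> 'a::euclidean_space"
  assumes "set_integrable lborel {0..T} g" and "\<And>t. t \<in> {0..T} \<Longrightarrow> h t = a + integral {0..t} g"
  shows "continuous_on {0..T} h"
proof -
  have "continuous_on {0..T} (\<lambda>t. a + integral {0..t} g)"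
    by (intro continuous_intros indefinite_integral_continuous_1 set_borel_integral_eq_integral(1) assms(1))
  then show ?thesis by (rule continuous_on_eq) (simp add: assms(2))
qed

text \<open>The product rule for \<open>\<theta> t *\<^sub>R h t\<close>; the boundary terms vanish with the test function.\<close>

lemma weak_deriv_indefinite_integral:
  fixes g :: "real \<Rightarrow> complex^'d"
  assumes T: "0 < T" and g: "set_integrable lborel {0..T} g"
    and h: "\<And>t. t \<in> {0..T} \<Longrightarrow> h t = a + integral {0..t} g"
  shows "weak_deriv T h g"
  unfolding weak_deriv_def
proof (intro allI impI)
  fix \<theta> \<theta>' assume "test_fun T \<theta> \<theta>'"
  then obtain \<alpha> \<beta> where d: "\<And>t. (\<theta> has_real_derivative \<theta>' t) (at t)" and c: "continuous_on UNIV \<theta>'"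
    and ab: "0 < \<alpha>" "\<beta> < T" "\<And>t. t \<notin> {\<alpha>..\<beta>} \<Longrightarrow> \<theta> t = 0" unfolding test_fun_def by blast
  have c': "continuous_on {0..T} \<theta>'" using c continuous_on_subset by blast
  have c\<theta>: "continuous_on {0..T} \<theta>" using d by (meson DERIV_isCont continuous_at_imp_continuous_on)
  have ch: "continuous_on {0..T} h" by (rule indefinite_integral_continuous[OF g h])
  have i': "set_integrable lborel {0..T} \<theta>'" using borel_integrable_atLeastAtMost' c' by blast
  have F: "\<theta> t = 0 + integral {0..t} \<theta>'" if "t \<in> {0..T}" for t
  proof -
    have "(\<theta>' has_integral \<theta> t - \<theta> 0) {0..t}"
      using that d by (intro fundamental_theorem_of_calculus)
        (auto simp: has_real_derivative_iff_has_vector_derivative[symmetric] intro: DERIV_subset)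
    moreover have "\<theta> 0 = 0" using ab(1) ab(3)[of 0] by simp
    ultimately show ?thesis by (simp add: integral_unique)
  qed
  have Ttheta: "\<theta> T = 0" using ab(2) ab(3)[of T] by simp
  have i1: "set_integrable lborel {0..T} (\<lambda>t. \<theta>' t *\<^sub>R h t)"
    using borel_integrable_atLeastAtMost' ch c' by (intro set_integrable_continuous_scaleR) blast+
  have i2: "set_integrable lborel {0..T} (\<lambda>t. \<theta> t *\<^sub>R g t)"
    by (rule set_integrable_continuous_scaleR[OF c\<theta> g])
  have "\<theta> T *\<^sub>R h T = 0 *\<^sub>R a + integral {0..T} (\<lambda>s. \<theta>' s *\<^sub>R h s + \<theta> s *\<^sub>R g s)"
    using indefinite_integral_product_rule(2)[OF bounded_bilinear_scaleR i' g F h, of T] T by simp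
  also have "integral {0..T} (\<lambda>s. \<theta>' s *\<^sub>R h s + \<theta> s *\<^sub>R g s)
      = integral {0..T} (\<lambda>s. \<theta>' s *\<^sub>R h s) + integral {0..T} (\<lambda>s. \<theta> s *\<^sub>R g s)"
    using i1 i2 by (intro Henstock_Kurzweil_Integration.integral_add set_borel_integral_eq_integral(1))
  finally show "(LINT t:{0<..<T}|lborel. \<theta>' t *\<^sub>R h t) = - (LINT t:{0<..<T}|lborel. \<theta> t *\<^sub>R g t)"
    unfolding set_integral_open_eq_integral(2)[OF i1] set_integral_open_eq_integral(2)[OF i2]
    using Ttheta by (simp add: eq_neg_iff_add_eq_0)
qed

text \<open>For a component \<open>\<delta>\<close> of \<open>d\<close>, a nonnegative bump \<open>\<kappa>\<close> and the \<open>\<kappa>\<close>-average \<open>c\<close> of \<open>\<delta>\<close>, the function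
\<open>\<kappa> (\<delta> - c)\<close> has mean zero and is therefore the derivative of an admissible test function. Testing
with it gives \<open>\<integral> \<kappa> (\<delta> - c)\<^sup>2 = 0\<close>, hence \<open>\<delta> = c\<close> wherever \<open>\<kappa> > 0\<close>.\<close>

lemma du_Bois_Reymond:
  fixes d :: "real \<Rightarrow> complex^'d"
  assumes d: "continuous_on {0..T} d"
    and orth: "\<And>\<theta> \<theta>'. test_fun T \<theta> \<theta>' \<Longrightarrow> integral {0..T} (\<lambda>t. \<theta>' t *\<^sub>R d t) = 0"
    and t: "t \<in> {0..T}"
  shows "d t = d 0"
proof (cases "0 < T")
  case T: True
  have comp: "d r \<bullet> b = d s \<bullet> b" if rs: "0 < r" "r \<le> s" "s < T" for r s b
  proof -
    define \<alpha> \<beta> where "\<alpha> = r / 2" and "\<beta> = (s + T) / 2"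
    have ab: "0 < \<alpha>" "\<alpha> < r" "s < \<beta>" "\<beta> < T" "\<alpha> < \<beta>" using rs by (auto simp: \<alpha>_def \<beta>_def)
    define \<kappa> where "\<kappa> t = max 0 ((t - \<alpha>) * (\<beta> - t))" for t :: real
    define \<delta> where "\<delta> t = d (clamp 0 T t) \<bullet> b" for t
    have c\<delta>: "continuous_on S \<delta>" for S
    proof -
      have "continuous_on (cbox 0 T) d" using d by (simp add: cbox_interval)
      then have "continuous_on S (\<lambda>t. d (clamp 0 T t))"
        using continuous_on_ext_cont[of 0 T d S] unfolding ext_cont_def by simp
      then show ?thesis unfolding \<delta>_def by (intro continuous_intros)
    qed
    have \<delta>: "\<delta> t = d t \<bullet> b" if "t \<in> {0..T}" for t using that by (simp add: \<delta>_def cbox_interval)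
    have c\<kappa>: "continuous_on S \<kappa>" for S unfolding \<kappa>_def by (intro continuous_intros)
    have \<kappa>0: "\<kappa> t = 0" if "t \<notin> {\<alpha><..<\<beta>}" for t
      using that ab by (auto simp: \<kappa>_def mult_nonneg_nonpos mult_nonpos_nonneg max_def zero_le_mult_iff not_less)
    have \<kappa>pos: "\<kappa> t > 0" if "t \<in> {\<alpha><..<\<beta>}" for t
      using that by (auto simp: \<kappa>_def less_max_iff_disj)
    have \<kappa>nn: "\<kappa> t \<ge> 0" for t by (simp add: \<kappa>_def)
    define c where "c = integral {0..T} (\<lambda>t. \<kappa> t * \<delta> t) / integral {0..T} \<kappa>"
    define \<theta>' where "\<theta>' t = \<kappa> t * (\<delta> t - c)" for t
    define \<theta> where "\<theta> t = (LBINT y=ereal 0..ereal t. \<theta>' y)" for t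
    have c\<theta>: "continuous_on S \<theta>'" for S unfolding \<theta>'_def by (intro continuous_intros c\<kappa> c\<delta>)
    have "integral {0..T} \<kappa> \<noteq> 0"
      using integral_eq_0_iff[of 0 T \<kappa>] T c\<kappa> \<kappa>nn \<kappa>pos[of r] rs ab by auto
    then have int0: "integral {0..T} \<theta>' = 0"
      unfolding \<theta>'_def right_diff_distrib c_def
      by (subst Henstock_Kurzweil_Integration.integral_diff)
        (auto intro!: integrable_continuous_real continuous_intros c\<kappa> c\<delta>)
    have \<theta>zero: "\<theta> t = 0" if "t \<notin> {\<alpha>..\<beta>}" for t
    proof (cases "t < \<alpha>")
      case True
      have "\<theta>' y = 0" if "y \<in> {min 0 t..max 0 t}" for y
        using that True ab by (auto simp: \<theta>'_def intro!: \<kappa>0)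
      then have "\<theta> t = (LBINT y=ereal 0..ereal t. 0)" unfolding \<theta>_def
        by (intro interval_integral_cong) (auto simp: einterval_def min_def max_def split: if_splits)
      then show ?thesis by simp
    next
      case False
      then have t: "t > \<beta>" using that by auto
      have z: "integral {\<beta>..u} \<theta>' = 0" for u
      proof -
        have "integral {\<beta>..u} \<theta>' = integral {\<beta>..u} (\<lambda>_. 0)"
          by (rule Henstock_Kurzweil_Integration.integral_cong) (auto simp: \<theta>'_def intro!: \<kappa>0)
        then show ?thesis by simp
      qed
      have "\<theta> t = integral {0..t} \<theta>'" unfolding \<theta>_def using t ab
        by (intro interval_integral_eq_integral borel_integrable_atLeastAtMost' c\<theta>) auto
      also have "\<dots> = integral {0..\<beta>} \<theta>' + integral {\<beta>..t} \<theta>'" using t ab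
        by (intro Henstock_Kurzweil_Integration.integral_combine[symmetric] integrable_continuous_real c\<theta>) auto
      also have "\<dots> = integral {0..\<beta>} \<theta>' + integral {\<beta>..T} \<theta>'" by (simp add: z)
      also have "\<dots> = integral {0..T} \<theta>'" using t ab
        by (intro Henstock_Kurzweil_Integration.integral_combine integrable_continuous_real c\<theta>) auto
      finally show ?thesis using int0 by simp
    qed
    have "test_fun T \<theta> \<theta>'" unfolding test_fun_def
    proof (intro conjI allI exI)
      fix t
      have "((\<lambda>u. LBINT y=ereal 0..ereal u. \<theta>' y) has_vector_derivative \<theta>' t) (at t within {min 0 t - 1..max 0 t + 1})"
        by (rule interval_integral_FTC2) (auto intro!: c\<theta>)
      then show "(\<theta> has_real_derivative \<theta>' t) (at t)"
        unfolding \<theta>_def has_real_derivative_iff_has_vector_derivative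
        by (subst (asm) at_within_interior) (auto simp: interior_atLeastAtMost_real)
    qed (use ab \<theta>zero c\<theta> in auto)
    then have "integral {0..T} (\<lambda>t. \<theta>' t *\<^sub>R d t) = 0" by (rule orth)
    moreover have "(\<lambda>t. \<theta>' t *\<^sub>R d t) integrable_on {0..T}"
      by (intro integrable_continuous_real continuous_intros c\<theta> d)
    ultimately have "integral {0..T} (\<lambda>t. (\<theta>' t *\<^sub>R d t) \<bullet> b) = 0"
      using integral_linear[OF _ bounded_linear_inner_left[of b], of "\<lambda>t. \<theta>' t *\<^sub>R d t" "{0..T}"] by (simp add: o_def)
    then have o: "integral {0..T} (\<lambda>t. \<theta>' t * \<delta> t) = 0"
      by (rule trans[rotated]) (auto simp: \<delta> intro!: Henstock_Kurzweil_Integration.integral_cong)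
    have "integral {0..T} (\<lambda>t. \<kappa> t * (\<delta> t - c)\<^sup>2) = integral {0..T} (\<lambda>t. \<theta>' t * \<delta> t - c * \<theta>' t)"
      by (rule Henstock_Kurzweil_Integration.integral_cong) (simp add: \<theta>'_def power2_eq_square algebra_simps)
    also have "\<dots> = integral {0..T} (\<lambda>t. \<theta>' t * \<delta> t) - integral {0..T} (\<lambda>t. c * \<theta>' t)"
      by (intro Henstock_Kurzweil_Integration.integral_diff integrable_continuous_real continuous_intros c\<theta> c\<delta>)
    also have "\<dots> = 0" using o int0 by simp
    finally have i0: "integral {0..T} (\<lambda>t. \<kappa> t * (\<delta> t - c)\<^sup>2) = 0" .
    have "continuous_on {0..T} (\<lambda>t. \<kappa> t * (\<delta> t - c)\<^sup>2)"
      by (intro continuous_intros c\<kappa> c\<delta>)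
    then have "\<forall>t\<in>{0..T}. \<kappa> t * (\<delta> t - c)\<^sup>2 = 0"
      using integral_eq_0_iff[of 0 T "\<lambda>t. \<kappa> t * (\<delta> t - c)\<^sup>2"] T \<kappa>nn i0
      by auto
    then have "\<delta> t = c" if "t \<in> {\<alpha><..<\<beta>}" for t using \<kappa>pos[OF that] that ab by force
    then show ?thesis using \<delta>[of r] \<delta>[of s] rs ab by simp
  qed
  have *: "d r = d s" if "0 < r" "r \<le> s" "s < T" for r s
    by (rule euclidean_eqI) (use comp[OF that] in auto)
  have const: "d r = d (T/2)" if "r \<in> {0<..<T}" for r
  proof (cases "r \<le> T/2")
    case True
    then show ?thesis using that T by (intro *) auto
  next
    case False
    then show ?thesis using that T by (intro *[symmetric]) auto
  qed
  have all: "d r = d (T/2)" if "r \<in> {0..T}" for r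
  proof (rule continuous_constant_on_closure[of "{0<..<T}" d])
    show "continuous_on (closure {0<..<T}) d" "r \<in> closure {0<..<T}" using T d that by simp_all
  qed (rule const)
  have "0 \<in> {0..T}" using T by simp
  from all[OF t] all[OF this] show ?thesis by (rule trans[OF _ sym])
next
  case False
  then have "t = 0" using t by auto
  then show ?thesis by simp
qed

lemma weak_deriv_cong_AE:
  fixes h g g' :: "real \<Rightarrow> complex^'d"
  assumes w: "weak_deriv T h g"
    and g: "set_borel_measurable lborel {0<..<T} g" and g': "set_borel_measurable lborel {0<..<T} g'"
    and eq: "AE t in lborel. t \<in> {0<..<T} \<longrightarrow> g t = g' t"
  shows "weak_deriv T h g'"
  unfolding weak_deriv_def
proof (intro allI impI)
  fix \<theta> \<theta>' assume t: "test_fun T \<theta> \<theta>'"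
  then have "continuous_on UNIV \<theta>"
    unfolding test_fun_def by (auto intro: DERIV_isCont continuous_at_imp_continuous_on)
  then have \<theta>: "\<theta> \<in> borel_measurable lborel" by (simp add: borel_measurable_continuous_onI)
  have m: "(\<lambda>t. indicator {0<..<T} t *\<^sub>R (\<theta> t *\<^sub>R k t)) \<in> borel_measurable lborel"
    if "set_borel_measurable lborel {0<..<T} k" for k :: "real \<Rightarrow> complex^'d"
    using borel_measurable_scaleR[OF \<theta> that[unfolded set_borel_measurable_def]] by (simp add: mult.commute)
  have "(LINT t:{0<..<T}|lborel. \<theta> t *\<^sub>R g t) = (LINT t:{0<..<T}|lborel. \<theta> t *\<^sub>R g' t)"
    unfolding set_lebesgue_integral_def
    by (rule integral_cong_AE[OF m[OF g] m[OF g']]) (use eq in \<open>eventually_elim, auto simp: indicator_def\<close>)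
  then show "(LINT t:{0<..<T}|lborel. \<theta>' t *\<^sub>R h t) = - (LINT t:{0<..<T}|lborel. \<theta> t *\<^sub>R g' t)"
    using w t unfolding weak_deriv_def by auto
qed

text \<open>A continuous function is the primitive of its integrable weak derivative, because subtracting that
primitive leaves a continuous function with weak derivative zero.\<close>

lemma weak_deriv_imp_indefinite_integral:
  fixes g h :: "real \<Rightarrow> complex^'d"
  assumes T: "0 < T" and h: "continuous_on {0..T} h" and g: "set_integrable lborel {0..T} g"
    and w: "weak_deriv T h g" and t: "t \<in> {0..T}"
  shows "h t = h 0 + integral {0..t} g"
proof -
  define H where "H t = integral {0..t} g" for t
  have H: "continuous_on {0..T} H"
    by (rule indefinite_integral_continuous[OF g, of _ 0]) (simp add: H_def)
  have wH: "weak_deriv T H g" by (rule weak_deriv_indefinite_integral[OF T g, of _ 0]) (simp add: H_def)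
  have "h t - H t = h 0 - H 0"
  proof (rule du_Bois_Reymond[OF _ _ t])
    show "continuous_on {0..T} (\<lambda>t. h t - H t)" by (intro continuous_intros h H)
    fix \<theta> \<theta>' assume t: "test_fun T \<theta> \<theta>'"
    then have c: "continuous_on {0..T} \<theta>'" unfolding test_fun_def using continuous_on_subset by blast
    have i: "set_integrable lborel {0..T} (\<lambda>t. \<theta>' t *\<^sub>R k t)" if "continuous_on {0..T} k" for k :: "real \<Rightarrow> complex^'d"
      using that by (intro borel_integrable_atLeastAtMost' continuous_intros c)
    have "integral {0..T} (\<lambda>t. \<theta>' t *\<^sub>R (h t - H t)) = integral {0..T} (\<lambda>t. \<theta>' t *\<^sub>R h t) - integral {0..T} (\<lambda>t. \<theta>' t *\<^sub>R H t)"
      unfolding scaleR_right_diff_distrib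
      by (intro Henstock_Kurzweil_Integration.integral_diff set_borel_integral_eq_integral(1)[OF i] h H)
    also have "\<dots> = 0"
      using w wH t unfolding weak_deriv_def set_integral_open_eq_integral(2)[OF i[OF h], symmetric]
        set_integral_open_eq_integral(2)[OF i[OF H], symmetric] by auto
    finally show "integral {0..T} (\<lambda>t. \<theta>' t *\<^sub>R (h t - H t)) = 0" .
  qed
  then show ?thesis by (simp add: H_def algebra_simps)
qed

section \<open>Energy of a damped oscillator\<close>

text \<open>One Fourier mode of the problem: \<open>v' = w\<close>, \<open>w' = G - \<rho> q w - q\<^sup>2 v - A v\<close>, where \<open>q\<close> stands for
\<open>m\<^sup>2\<close>. The equations are integrated because \<open>G\<close> is only integrable in time.\<close>

definition damped_mode ::
  "real \<Rightarrow> real \<Rightarrow> real \<Rightarrow> ('a \<Rightarrow> 'a) \<Rightarrow> (real \<Rightarrow> 'a) \<Rightarrow> (real \<Rightarrow> 'a) \<Rightarrow> (real \<Rightarrow> 'a::euclidean_space) \<Rightarrow> bool" where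
  "damped_mode T \<rho> q A G v w \<longleftrightarrow>
     continuous_on {0..T} v \<and> continuous_on {0..T} w \<and>
     (\<forall>t\<in>{0..T}. v t = v 0 + integral {0..t} w) \<and>
     (\<forall>t\<in>{0..T}. w t = w 0 + integral {0..t} (\<lambda>s. G s - (\<rho> * q) *\<^sub>R w s - q\<^sup>2 *\<^sub>R v s - A (v s)))"

lemma damped_mode_rhs_integrable:
  fixes v w G :: "real \<Rightarrow> 'a::euclidean_space"
  assumes A: "bounded_linear A" and G: "set_integrable lborel {0..T} G"
    and v: "continuous_on {0..T} v" and w: "continuous_on {0..T} w"
  shows "set_integrable lborel {0..T} (\<lambda>s. G s - (\<rho> * q) *\<^sub>R w s - q\<^sup>2 *\<^sub>R v s - A (v s))"
proof -
  have "continuous_on {0..T} (\<lambda>s. (\<rho> * q) *\<^sub>R w s + q\<^sup>2 *\<^sub>R v s + A (v s))"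
    by (intro continuous_intros v w bounded_linear.continuous_on[OF A])
  from set_integral_diff(1)[OF G borel_integrable_atLeastAtMost'[OF this]]
  show ?thesis by (simp add: algebra_simps)
qed

lemma damped_mode_exists:
  fixes A :: "'a::euclidean_space \<Rightarrow> 'a"
  assumes A: "bounded_linear A" and T: "0 \<le> T" and G: "set_integrable lborel {0..T} G"
  obtains v w where "damped_mode T \<rho> q A G v w" "v 0 = v0" "w 0 = w0"
proof -
  define h where "h t = (v0, w0 + integral {0..t} G)" for t
  define M where "M z = (snd z, - ((\<rho> * q) *\<^sub>R snd z) - q\<^sup>2 *\<^sub>R fst z - A (fst z))" for z :: "'a \<times> 'a"
  have "bounded_linear M" unfolding M_def
    by (intro bounded_linear_Pair bounded_linear_sub bounded_linear_minus bounded_linear_const_scaleR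
        bounded_linear_snd bounded_linear_fst bounded_linear_compose[OF A])
  moreover have "continuous_on {0..T} h" unfolding h_def
    by (intro continuous_intros indefinite_integral_continuous_1 set_borel_integral_eq_integral(1)[OF G])
  ultimately obtain y where y: "continuous_on {0..T} y"
    and eq: "\<And>t. t \<in> {0..T} \<Longrightarrow> y t = h t + integral {0..t} (\<lambda>s. M (y s))"
    using linear_volterra_solution by blast
  have cM: "continuous_on {0..T} (\<lambda>s. M (y s))"
    by (rule bounded_linear.continuous_on[OF \<open>bounded_linear M\<close> y])
  have i: "(\<lambda>s. M (y s)) integrable_on {0..t}" if "t \<in> {0..T}" for t
    by (rule integrable_continuous_real, rule continuous_on_subset[OF cM]) (use that in auto)
  have cv: "continuous_on {0..T} (\<lambda>t. fst (y t))" and cw: "continuous_on {0..T} (\<lambda>t. snd (y t))"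
    by (intro continuous_intros y)+
  have v: "fst (y t) = v0 + integral {0..t} (\<lambda>s. snd (y s))" if "t \<in> {0..T}" for t
    using integral_linear[OF i[OF that] bounded_linear_fst] eq[OF that]
    by (simp add: h_def M_def o_def)
  have w: "snd (y t) = w0 + integral {0..t} (\<lambda>s. G s - (\<rho> * q) *\<^sub>R snd (y s) - q\<^sup>2 *\<^sub>R fst (y s) - A (fst (y s)))"
    if "t \<in> {0..T}" for t
  proof -
    have "(\<lambda>s. G s - (\<rho> * q) *\<^sub>R snd (y s) - q\<^sup>2 *\<^sub>R fst (y s) - A (fst (y s))) = (\<lambda>s. G s + snd (M (y s)))"
      by (auto simp: M_def)
    moreover have "integral {0..t} (\<lambda>s. G s + snd (M (y s))) = integral {0..t} G + integral {0..t} (\<lambda>s. snd (M (y s)))"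
    proof (rule Henstock_Kurzweil_Integration.integral_add)
      show "G integrable_on {0..t}"
        by (rule set_borel_integral_eq_integral(1), rule set_integrable_subset[OF G]) (use that in auto)
      show "(\<lambda>s. snd (M (y s))) integrable_on {0..t}"
        using integrable_linear[OF i[OF that] bounded_linear_snd] by (simp add: o_def)
    qed
    ultimately show ?thesis
      using integral_linear[OF i[OF that] bounded_linear_snd] eq[OF that]
      by (simp add: h_def o_def)
  qed
  have v0: "fst (y 0) = v0" and w0: "snd (y 0) = w0" using v[of 0] w[of 0] T by auto
  show thesis
    by (rule that[of "\<lambda>t. fst (y t)" "\<lambda>t. snd (y t)"])
      (use v w v0 w0 cv cw in \<open>auto simp: damped_mode_def\<close>)
qed

lemma damped_mode_derivative:
  assumes "damped_mode T \<rho> q A G v w" "t \<in> {0..T}"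
  shows "(v has_vector_derivative w t) (at t within {0..T})"
proof -
  have w: "continuous_on {0..T} w" and v: "\<And>t. t \<in> {0..T} \<Longrightarrow> v t = v 0 + integral {0..t} w"
    using assms(1) unfolding damped_mode_def by blast+
  have "((\<lambda>u. v 0 + integral {0..u} w) has_vector_derivative w t) (at t within {0..T})"
    using has_vector_derivative_add[OF has_vector_derivative_const integral_has_vector_derivative[OF w assms(2)], of "v 0"]
    by simp
  then show ?thesis
    by (rule has_vector_derivative_transform[OF assms(2), rotated]) (rule v)
qed

text \<open>The usual energy \<open>\<parallel>w\<parallel>\<^sup>2 + q\<^sup>2 \<parallel>v\<parallel>\<^sup>2\<close> with the square completed: the roots of \<open>z\<^sup>2 + \<rho> q z + q\<^sup>2\<close> have
real part \<open>- \<rho> q / 2\<close> and imaginary part \<open>\<plusminus> sqrt (1 - \<rho>\<^sup>2 / 4) q\<close>, and in these coordinates the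
uncoupled oscillator contracts at the exact rate \<open>\<rho> q\<close>. For \<open>0 < \<rho> < 2\<close> it is equivalent to the usual
energy with constants that do not depend on \<open>q\<close>.\<close>

definition mode_energy :: "real \<Rightarrow> real \<Rightarrow> 'a::euclidean_space \<Rightarrow> 'a \<Rightarrow> real" where
  "mode_energy \<rho> q v w = (norm (w + (\<rho> * q / 2) *\<^sub>R v))\<^sup>2 + (1 - \<rho>\<^sup>2 / 4) * q\<^sup>2 * (norm v)\<^sup>2"

lemma norm_add_sq_le: "(norm (x + y :: 'a::real_inner))\<^sup>2 \<le> 2 * (norm x)\<^sup>2 + 2 * (norm y)\<^sup>2"
proof -
  have "0 \<le> (norm (x - y))\<^sup>2" by simp
  then show ?thesis by (simp add: power2_norm_eq_inner algebra_simps inner_commute)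
qed

lemma mode_energy_le:
  assumes "0 < \<rho>" "\<rho> < 2" 
  shows "mode_energy \<rho> q v w \<le> 3 * ((norm w)\<^sup>2 + q\<^sup>2 * (norm v)\<^sup>2)"
proof -
  have r: "\<rho>\<^sup>2 \<le> 4" using power_mono[of \<rho> 2 2] assms by simp
  have "mode_energy \<rho> q v w \<le> 2 * (norm w)\<^sup>2 + 2 * (norm ((\<rho> * q / 2) *\<^sub>R v))\<^sup>2 + (1 - \<rho>\<^sup>2 / 4) * q\<^sup>2 * (norm v)\<^sup>2"
    unfolding mode_energy_def using norm_add_sq_le[of w "(\<rho> * q / 2) *\<^sub>R v"] by simp
  also have "\<dots> = 2 * (norm w)\<^sup>2 + (1 + \<rho>\<^sup>2 / 4) * (q\<^sup>2 * (norm v)\<^sup>2)"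
    by (simp add: power_mult_distrib power_divide field_simps)
  also have "\<dots> \<le> 3 * (norm w)\<^sup>2 + 3 * (q\<^sup>2 * (norm v)\<^sup>2)"
    using r by (intro add_mono mult_right_mono) auto
  finally show ?thesis by simp
qed

lemma mode_energy_ge:
  assumes "0 < \<rho>" "\<rho> < 2"
  shows "(norm w)\<^sup>2 + q\<^sup>2 * (norm v)\<^sup>2 \<le> (2 + 3 / (1 - \<rho>\<^sup>2 / 4)) * mode_energy \<rho> q v w"
proof -
  have r: "\<rho>\<^sup>2 < 4" using power_strict_mono[of \<rho> 2 2] assms by simp
  let ?w = "w + (\<rho> * q / 2) *\<^sub>R v" and ?k = "1 - \<rho>\<^sup>2 / 4" and ?V = "q\<^sup>2 * (norm v)\<^sup>2"
  have k: "0 < ?k" using r by simp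
  have "(norm w)\<^sup>2 \<le> 2 * (norm ?w)\<^sup>2 + 2 * (norm (- ((\<rho> * q / 2) *\<^sub>R v)))\<^sup>2"
    using norm_add_sq_le[of ?w "- ((\<rho> * q / 2) *\<^sub>R v)"] by simp
  also have "\<dots> = 2 * (norm ?w)\<^sup>2 + \<rho>\<^sup>2 / 2 * ?V" by (simp add: power_mult_distrib power_divide)
  finally have "(norm w)\<^sup>2 + ?V \<le> 2 * (norm ?w)\<^sup>2 + (\<rho>\<^sup>2 / 2 + 1) * ?V" by (simp add: algebra_simps)
  also have "\<dots> \<le> 2 * (norm ?w)\<^sup>2 + 3 * ?V"
    using r by (intro add_mono mult_right_mono) auto
  also have "3 * ?V = 3 / ?k * (?k * ?V)" using k by simp
  also have "2 * (norm ?w)\<^sup>2 + 3 / ?k * (?k * ?V) \<le> (2 + 3 / ?k) * (norm ?w)\<^sup>2 + (2 + 3 / ?k) * (?k * ?V)"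
    using k by (intro add_mono mult_right_mono) auto
  finally show ?thesis by (simp add: mode_energy_def algebra_simps)
qed

text \<open>The coupling shifts the decay rate by a bounded amount only: the energy controls \<open>q \<parallel>v\<parallel>\<close>, and
\<open>q \<ge> 1\<close>, so the constant is uniform over all modes.\<close>

lemma mode_energy_coupling_le:
  assumes "0 < \<rho>" "\<rho> < 2" "1 \<le> q" "0 \<le> a" and A: "\<And>x. norm (A x) \<le> a * norm x"
  shows "- 2 * (A v \<bullet> (w + (\<rho> * q / 2) *\<^sub>R v)) \<le> a / sqrt (1 - \<rho>\<^sup>2 / 4) * mode_energy \<rho> q v w"
proof -
  have r: "\<rho>\<^sup>2 < 4" using power_strict_mono[of \<rho> 2 2] assms by simp
  let ?w = "w + (\<rho> * q / 2) *\<^sub>R v" and ?k = "1 - \<rho>\<^sup>2 / 4"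
  have k: "0 < ?k" using r by simp
  define z where "z = ?w"
  have "- (A v \<bullet> z) \<le> norm (A v) * norm z" using norm_cauchy_schwarz[of "- A v" z] by simp
  also have "\<dots> \<le> a * norm v * norm z" using A by (intro mult_right_mono) auto
  also have "\<dots> \<le> a * (q * norm v) * norm z"
    using assms(3,4) mult_right_mono[OF assms(3), of "norm v"] by (intro mult_right_mono mult_left_mono) auto
  also have "\<dots> = a / sqrt ?k * ((sqrt ?k * q * norm v) * norm z)" using k by simp
  finally have "2 * (- (A v \<bullet> z)) \<le> 2 * (a / sqrt ?k * ((sqrt ?k * q * norm v) * norm z))"
    by (rule mult_left_mono) simp
  also have "\<dots> = a / sqrt ?k * (2 * (sqrt ?k * q * norm v) * norm z)" by (simp only: mult_ac)
  also have "\<dots> \<le> a / sqrt ?k * ((sqrt ?k * q * norm v)\<^sup>2 + (norm z)\<^sup>2)"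
    using k assms(4) by (intro mult_left_mono sum_squares_bound) auto
  also have "(sqrt ?k * q * norm v)\<^sup>2 + (norm z)\<^sup>2 = mode_energy \<rho> q v w"
    using k by (simp add: mode_energy_def power_mult_distrib z_def)
  finally show ?thesis by (simp add: z_def)
qed

text \<open>With \<open>z = w + (\<rho> q / 2) v\<close> the system reads \<open>v' = z - (\<rho> q / 2) v\<close>,
\<open>z' = G - (\<rho> q / 2) z - (1 - \<rho>\<^sup>2 / 4) q\<^sup>2 v - A v\<close>, and the mixed terms cancel in the derivative of the
energy. The product rule is applied to \<open>z \<bullet> z\<close> and to \<open>v \<bullet> v\<close>, since \<open>z\<close> is only a primitive.\<close>

lemma mode_energy_identity:
  assumes A: "bounded_linear A" and G: "set_integrable lborel {0..T} G"
    and m: "damped_mode T \<rho> q A G v w" and t: "t \<in> {0..T}"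
  defines "R \<equiv> \<lambda>s. - (\<rho> * q) * mode_energy \<rho> q (v s) (w s)
      + 2 * (G s \<bullet> (w s + (\<rho> * q / 2) *\<^sub>R v s)) - 2 * (A (v s) \<bullet> (w s + (\<rho> * q / 2) *\<^sub>R v s))"
  shows "set_integrable lborel {0..t} R"
    and "mode_energy \<rho> q (v t) (w t) = mode_energy \<rho> q (v 0) (w 0) + integral {0..t} R"
proof -
  have cv: "continuous_on {0..T} v" and cw: "continuous_on {0..T} w"
    and v: "\<And>t. t \<in> {0..T} \<Longrightarrow> v t = v 0 + integral {0..t} w"
    and w: "\<And>t. t \<in> {0..T} \<Longrightarrow> w t = w 0 + integral {0..t} (\<lambda>s. G s - (\<rho> * q) *\<^sub>R w s - q\<^sup>2 *\<^sub>R v s - A (v s))"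
    using m unfolding damped_mode_def by blast+
  let ?c = "\<rho> * q / 2" and ?r = "\<lambda>s. G s - (\<rho> * q) *\<^sub>R w s - q\<^sup>2 *\<^sub>R v s - A (v s)"
  let ?z = "\<lambda>s. w s + ?c *\<^sub>R v s" and ?k = "(1 - \<rho>\<^sup>2 / 4) * q\<^sup>2"
  let ?r' = "\<lambda>s. ?r s + ?c *\<^sub>R w s"
  have ir: "set_integrable lborel {0..T} ?r" by (rule damped_mode_rhs_integrable[OF A G cv cw])
  have iw: "set_integrable lborel {0..T} w" by (rule borel_integrable_atLeastAtMost'[OF cw])
  have icw: "set_integrable lborel {0..T} (\<lambda>s. ?c *\<^sub>R w s)"
    by (rule borel_integrable_atLeastAtMost') (intro continuous_intros cw)
  have iz: "set_integrable lborel {0..T} ?r'" by (rule set_integral_add(1)[OF ir icw])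
  have z: "?z t = ?z 0 + integral {0..t} ?r'" if t: "t \<in> {0..T}" for t
  proof -
    have sub: "f integrable_on {0..t}" if "set_integrable lborel {0..T} f" for f :: "real \<Rightarrow> 'a"
      by (rule set_borel_integral_eq_integral(1), rule set_integrable_subset[OF that]) (use t in auto)
    have "integral {0..t} ?r' = integral {0..t} ?r + ?c *\<^sub>R integral {0..t} w"
      using sub[OF ir] sub[OF icw] by (subst Henstock_Kurzweil_Integration.integral_add) auto
    then show ?thesis using v[OF t] w[OF t] by (simp add: algebra_simps)
  qed
  note pz = indefinite_integral_product_rule[OF bounded_bilinear_inner iz iz z z t]
  note pv = indefinite_integral_product_rule[OF bounded_bilinear_inner iw iw v v t]
  have pz1: "set_integrable lborel {0..t} (\<lambda>s. ?r' s \<bullet> ?z s + ?z s \<bullet> ?r' s)" by (rule pz(1))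
  have pv1: "set_integrable lborel {0..t} (\<lambda>s. w s \<bullet> v s + v s \<bullet> w s)" by (rule pv(1))
  have pz2: "?z t \<bullet> ?z t = ?z 0 \<bullet> ?z 0 + integral {0..t} (\<lambda>s. ?r' s \<bullet> ?z s + ?z s \<bullet> ?r' s)" by (rule pz(2))
  have pv2: "v t \<bullet> v t = v 0 \<bullet> v 0 + integral {0..t} (\<lambda>s. w s \<bullet> v s + v s \<bullet> w s)" by (rule pv(2))
  have Req: "(?r' s \<bullet> ?z s + ?z s \<bullet> ?r' s) + ?k * (w s \<bullet> v s + v s \<bullet> w s) = R s" for s
    unfolding R_def mode_energy_def power2_norm_eq_inner
    by (simp add: inner_commute algebra_simps power2_eq_square field_simps)
  have ipv: "set_integrable lborel {0..t} (\<lambda>s. ?k * (w s \<bullet> v s + v s \<bullet> w s))"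
    using set_integrable_mult_right[OF pv1] by simp
  have alg: "(x + y) + k * (x' + y') = x + k * x' + (y + k * y')" for x y k x' y' :: real
    by (simp add: algebra_simps)
  have im: "integral {0..t} (\<lambda>s. ?k * (w s \<bullet> v s + v s \<bullet> w s)) = ?k * integral {0..t} (\<lambda>s. w s \<bullet> v s + v s \<bullet> w s)"
    by (rule Henstock_Kurzweil_Integration.integral_mult_right)
  show "set_integrable lborel {0..t} R"
    using set_integral_add(1)[OF pz1 ipv] unfolding Req .
  have "mode_energy \<rho> q (v t) (w t) = ?z t \<bullet> ?z t + ?k * (v t \<bullet> v t)"
    by (simp add: mode_energy_def power2_norm_eq_inner)
  also have "\<dots> = ?z 0 \<bullet> ?z 0 + ?k * (v 0 \<bullet> v 0) + (integral {0..t} (\<lambda>s. ?r' s \<bullet> ?z s + ?z s \<bullet> ?r' s)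
      + integral {0..t} (\<lambda>s. ?k * (w s \<bullet> v s + v s \<bullet> w s)))"
    unfolding im pz2 pv2 by (rule alg)
  also have "integral {0..t} (\<lambda>s. ?r' s \<bullet> ?z s + ?z s \<bullet> ?r' s) + integral {0..t} (\<lambda>s. ?k * (w s \<bullet> v s + v s \<bullet> w s))
      = integral {0..t} R"
    unfolding Req[symmetric]
    by (rule Henstock_Kurzweil_Integration.integral_add[symmetric])
      (rule set_borel_integral_eq_integral(1)[OF pz1], rule set_borel_integral_eq_integral(1)[OF ipv])
  finally show "mode_energy \<rho> q (v t) (w t) = mode_energy \<rho> q (v 0) (w 0) + integral {0..t} R"
    by (simp add: mode_energy_def power2_norm_eq_inner)
qed

lemma gronwall_differential:
  fixes E :: "real \<Rightarrow> real"
  assumes d: "\<And>t. t \<in> {0..T} \<Longrightarrow> (E has_real_derivative k t) (at t within {0..T})"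
    and k: "\<And>t. t \<in> {0..T} \<Longrightarrow> k t \<le> c * E t" and t: "t \<in> {0..T}"
  shows "E t \<le> exp (c * t) * E 0"
proof -
  let ?F = "\<lambda>s. exp (- c * s) * E s"
  have "?F t \<le> ?F 0"
  proof (rule DERIV_nonpos_imp_decreasing_open[of 0 t])
    show "0 \<le> t" using t by simp
    have "continuous_on {0..T} E" using d by (meson DERIV_continuous_on)
    then show "continuous_on {0..t} ?F"
      using t by (intro continuous_intros) (auto intro: continuous_on_subset)
    fix s assume s: "0 < s" "s < t"
    have "(E has_real_derivative k s) (at s)"
      using d[of s] s t at_within_Icc_at[of 0 s T] by auto
    then have "(?F has_real_derivative exp (- c * s) * (k s - c * E s)) (at s)"
      by (auto intro!: derivative_eq_intros simp: algebra_simps)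
    moreover have "exp (- c * s) * (k s - c * E s) \<le> 0"
      using k[of s] s t by (intro mult_nonneg_nonpos) auto
    ultimately show "\<exists>y. (?F has_real_derivative y) (at s) \<and> y \<le> 0" by blast
  qed
  then have "exp (c * t) * ?F t \<le> exp (c * t) * ?F 0" by (intro mult_left_mono) auto
  then show ?thesis by (simp add: mult.assoc[symmetric] flip: exp_add)
qed

lemma gronwall_integral:
  fixes E :: "real \<Rightarrow> real"
  assumes E: "continuous_on {0..T} E" and c: "0 \<le> c"
    and le: "\<And>t. t \<in> {0..T} \<Longrightarrow> E t \<le> K + c * integral {0..t} E" and t: "t \<in> {0..T}"
  shows "E t \<le> exp (c * t) * K"
proof -
  let ?J = "\<lambda>t. K + c * integral {0..t} E"
  have "?J t \<le> exp (c * t) * ?J 0"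
  proof (rule gronwall_differential[OF _ _ t])
    fix s assume s: "s \<in> {0..T}"
    show "(?J has_real_derivative c * E s) (at s within {0..T})"
      using integral_has_vector_derivative[OF E s]
      by (auto intro!: derivative_eq_intros simp: has_real_derivative_iff_has_vector_derivative[symmetric])
    show "c * E s \<le> c * ?J s" using le[OF s] c by (intro mult_left_mono)
  qed
  then show ?thesis using le[OF t] by simp
qed

text \<open>The damping absorbs the force, at the price of the factor \<open>1 / (\<rho> q)\<close>; this gain of \<open>1 / q\<close> is what
makes the response to the lifted boundary force summable over the modes. Gronwall's inequality
handles the coupling.\<close>

lemma damped_mode_energy_bound:
  assumes \<rho>: "0 < \<rho>" "\<rho> < 2" and q: "1 \<le> q" and A: "bounded_linear A" and a: "0 \<le> a" "\<And>x. norm (A x) \<le> a * norm x"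
    and G: "set_integrable lborel {0..T} G" and G2: "set_integrable lborel {0..T} (\<lambda>t. (norm (G t))\<^sup>2)"
    and m: "damped_mode T \<rho> q A G v w" and t: "t \<in> {0..T}"
  defines "c \<equiv> a / sqrt (1 - \<rho>\<^sup>2 / 4)"
  shows "mode_energy \<rho> q (v t) (w t)
    \<le> exp (c * T) * (mode_energy \<rho> q (v 0) (w 0) + integral {0..T} (\<lambda>t. (norm (G t))\<^sup>2) / (\<rho> * q))"
proof -
  let ?E = "\<lambda>t. mode_energy \<rho> q (v t) (w t)" and ?z = "\<lambda>s. w s + (\<rho> * q / 2) *\<^sub>R v s"
  let ?g = "\<lambda>s. (norm (G s))\<^sup>2"
  let ?K = "?E 0 + integral {0..T} ?g / (\<rho> * q)"
  have r: "\<rho>\<^sup>2 < 4" using power_strict_mono[of \<rho> 2 2] \<rho> by simp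
  have c: "0 \<le> c" using a r by (simp add: c_def)
  have cv: "continuous_on {0..T} v" and cw: "continuous_on {0..T} w" using m unfolding damped_mode_def by blast+
  have cE: "continuous_on {0..T} ?E" unfolding mode_energy_def by (intro continuous_intros cv cw)
  have pq: "0 < \<rho> * q" using \<rho> q by simp
  have Enn: "0 \<le> ?E t" for t using r by (simp add: mode_energy_def)
  have ig: "?g integrable_on {0..t}" if "t \<in> {0..T}" for t
    by (rule set_borel_integral_eq_integral(1), rule set_integrable_subset[OF G2]) (use that in auto)
  have gnn: "0 \<le> integral {0..T} ?g"
    using set_borel_integral_eq_integral(1)[OF G2] by (intro Henstock_Kurzweil_Integration.integral_nonneg) auto
  have "?E t \<le> exp (c * t) * ?K"
  proof (rule gronwall_integral[OF cE c _ t])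
    fix t assume t: "t \<in> {0..T}"
    let ?R = "\<lambda>s. - (\<rho> * q) * ?E s + 2 * (G s \<bullet> ?z s) - 2 * (A (v s) \<bullet> ?z s)"
    note id = mode_energy_identity[OF A G m t]
    have iE: "?E integrable_on {0..t}"
      by (rule integrable_continuous_real, rule continuous_on_subset[OF cE]) (use t in auto)
    have "integral {0..t} ?R \<le> integral {0..t} (\<lambda>s. c * ?E s + ?g s / (\<rho> * q))"
    proof (rule integral_le)
      show "?R integrable_on {0..t}" by (rule set_borel_integral_eq_integral(1)[OF id(1)])
      show "(\<lambda>s. c * ?E s + ?g s / (\<rho> * q)) integrable_on {0..t}"
        using iE ig[OF t] by (intro Henstock_Kurzweil_Integration.integrable_add integrable_on_mult_right integrable_on_divide)
      fix s assume "s \<in> {0..t}"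
      \<comment> \<open>Young's inequality with weight \<open>\<rho> q\<close>, the rate at which the energy identity dissipates.\<close>
      have "2 * (G s \<bullet> ?z s) \<le> ?g s / (\<rho> * q) + (\<rho> * q) * (norm (?z s))\<^sup>2"
      proof -
        define r where "r = sqrt (\<rho> * q)"
        have r: "0 < r" "r\<^sup>2 = \<rho> * q" using pq by (auto simp: r_def)
        have "2 * (G s \<bullet> ?z s) \<le> 2 * (norm (G s) * norm (?z s))" using norm_cauchy_schwarz by simp
        also have "\<dots> = 2 * (norm (G s) / r) * (r * norm (?z s))" using r(1) by simp
        also have "\<dots> \<le> (norm (G s) / r)\<^sup>2 + (r * norm (?z s))\<^sup>2" by (rule sum_squares_bound)
        finally show ?thesis by (simp add: power_divide power_mult_distrib r(2))
      qed
      moreover have "(\<rho> * q) * (norm (?z s))\<^sup>2 \<le> (\<rho> * q) * ?E s"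
        using pq r by (intro mult_left_mono) (auto simp: mode_energy_def)
      moreover have "- 2 * (A (v s) \<bullet> ?z s) \<le> c * ?E s"
        unfolding c_def by (rule mode_energy_coupling_le[OF \<rho> q a])
      ultimately show "?R s \<le> c * ?E s + ?g s / (\<rho> * q)" by simp
    qed
    also have "\<dots> = c * integral {0..t} ?E + integral {0..t} ?g / (\<rho> * q)"
      using iE ig[OF t] by (subst Henstock_Kurzweil_Integration.integral_add)
        (auto intro: integrable_on_mult_right integrable_on_divide)
    also have "integral {0..t} ?g \<le> integral {0..T} ?g"
      using t by (intro integral_subset_le ig) auto
    finally have "integral {0..t} ?R \<le> c * integral {0..t} ?E + integral {0..T} ?g / (\<rho> * q)"
      using pq by (simp add: divide_right_mono)
    then show "?E t \<le> ?K + c * integral {0..t} ?E" using id(2) by simp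
  qed
  also have "\<dots> \<le> exp (c * T) * ?K"
    using t c Enn gnn pq by (intro mult_right_mono) (auto intro: mult_left_mono)
  finally show ?thesis .
qed

text \<open>Without force the integrand of the energy identity is continuous, so the energy is differentiable
and Gronwall's inequality can be used with a negative rate.\<close>

lemma damped_mode_energy_decay:
  assumes \<rho>: "0 < \<rho>" "\<rho> < 2" and q: "1 \<le> q" and A: "bounded_linear A" and a: "0 \<le> a" "\<And>x. norm (A x) \<le> a * norm x"
    and m: "damped_mode T \<rho> q A (\<lambda>_. 0) v w" and t: "t \<in> {0..T}"
  defines "c \<equiv> a / sqrt (1 - \<rho>\<^sup>2 / 4)"
  shows "mode_energy \<rho> q (v t) (w t) \<le> exp ((c - \<rho> * q) * t) * mode_energy \<rho> q (v 0) (w 0)"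
proof -
  let ?E = "\<lambda>t. mode_energy \<rho> q (v t) (w t)" and ?z = "\<lambda>s. w s + (\<rho> * q / 2) *\<^sub>R v s"
  let ?R = "\<lambda>s. - (\<rho> * q) * ?E s - 2 * (A (v s) \<bullet> ?z s)"
  have cv: "continuous_on {0..T} v" and cw: "continuous_on {0..T} w" using m unfolding damped_mode_def by blast+
  have cR: "continuous_on {0..T} ?R" unfolding mode_energy_def
    by (intro continuous_intros cv cw bounded_linear.continuous_on[OF A])
  have id: "?E t = ?E 0 + integral {0..t} ?R" if "t \<in> {0..T}" for t
    using mode_energy_identity(2)[OF A _ m that] by (simp add: set_integrable_def)
  show ?thesis
  proof (rule gronwall_differential[OF _ _ t])
    fix s assume s: "s \<in> {0..T}"
    have "((\<lambda>t. ?E 0 + integral {0..t} ?R) has_real_derivative ?R s) (at s within {0..T})"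
      using integral_has_vector_derivative[OF cR s]
      by (auto intro!: derivative_eq_intros simp: has_real_derivative_iff_has_vector_derivative[symmetric])
    then show "(?E has_real_derivative ?R s) (at s within {0..T})"
      by (rule has_field_derivative_transform_within[OF _ zero_less_one s]) (rule id[symmetric])
    show "?R s \<le> (c - \<rho> * q) * ?E s"
      using mode_energy_coupling_le[OF \<rho> q a, where v="v s" and w="w s"]
      by (simp add: c_def left_diff_distrib)
  qed
qed

section \<open>Series spaces under a summable majorant\<close>

lemma summable_on_positive_nat_iff:
  fixes f :: "nat \<Rightarrow> real"
  assumes "\<And>m. 0 \<le> f m" "f 0 = 0"
  shows "f summable_on {1..} \<longleftrightarrow> summable f" and "f summable_on {1..} \<Longrightarrow> infsum f {1..} = suminf f"
proof -
  have "f m = 0" if "m \<in> UNIV - {1..}" for m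
    using that assms(2) by (cases m) auto
  then have e: "f summable_on {1..} \<longleftrightarrow> f summable_on UNIV" "infsum f {1..} = infsum f UNIV"
    by (rule summable_on_cong_neutral infsum_cong_neutral; auto)+
  show "f summable_on {1..} \<longleftrightarrow> summable f"
    using e(1) summable_on_UNIV_nonneg_real_iff[of f] assms(1) by simp
  then show "infsum f {1..} = suminf f" if "f summable_on {1..}"
    using that e(2) norm_summable_imp_has_sum[of f "suminf f"] assms(1)
    by (auto simp: infsumI summable_sums)
qed

lemma Xspace_0: "y \<in> Xspace s \<Longrightarrow> y 0 = 0" by (simp add: Xspace_def)

text \<open>The norms of \<open>X\<^sup>s\<close> are estimated mode by mode, against a summable majorant.\<close>

lemma Xspace_dominated:
  assumes "y 0 = 0" "\<And>m. 1 \<le> m \<Longrightarrow> real m powr (2 * s) * (norm (y m))\<^sup>2 \<le> D m" "D summable_on {1..}"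
  shows "y \<in> Xspace s" and "(Xnorm s y)\<^sup>2 \<le> infsum D {1..}"
proof -
  have s: "(\<lambda>m. real m powr (2 * s) * (norm (y m))\<^sup>2) summable_on {1..}"
    by (rule summable_on_comparison_test[OF assms(3)]) (use assms(2) in auto)
  then show "y \<in> Xspace s" using assms(1) by (simp add: Xspace_def)
  have "(Xnorm s y)\<^sup>2 = (\<Sum>\<^sub>\<infinity>m\<in>{1..}. real m powr (2 * s) * (norm (y m))\<^sup>2)"
    unfolding Xnorm_def by (simp add: infsum_nonneg)
  also have "\<dots> \<le> infsum D {1..}" by (rule infsum_mono[OF s assms(3)]) (use assms(2) in auto)
  finally show "(Xnorm s y)\<^sup>2 \<le> infsum D {1..}" .
qed

lemma Xnorm_nonneg: "0 \<le> Xnorm s y"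
  by (simp add: Xnorm_def infsum_nonneg)

lemma Xspace_summable:
  assumes "y \<in> Xspace s"
  shows "(\<lambda>m. real m powr (2 * s) * (norm (y m))\<^sup>2) summable_on {1..}"
    and "infsum (\<lambda>m. real m powr (2 * s) * (norm (y m))\<^sup>2) {1..} = (Xnorm s y)\<^sup>2"
  using assms by (auto simp: Xspace_def Xnorm_def infsum_nonneg)

lemma norm_diff_sq_le: "(norm (x - y :: 'a::real_inner))\<^sup>2 \<le> 2 * (norm x)\<^sup>2 + 2 * (norm y)\<^sup>2"
  using norm_add_sq_le[of x "- y"] by simp

lemma Xspace_diff:
  assumes "y \<in> Xspace s" "z \<in> Xspace s"
  shows "(\<lambda>m. y m - z m) \<in> Xspace s"
proof (rule Xspace_dominated(1))
  let ?p = "\<lambda>m. real m powr (2 * s)"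
  show "(\<lambda>m. 2 * (?p m * (norm (y m))\<^sup>2) + 2 * (?p m * (norm (z m))\<^sup>2)) summable_on {1..}"
    by (intro summable_on_add summable_on_cmult_right Xspace_summable assms)
  fix m :: nat
  show "?p m * (norm (y m - z m))\<^sup>2 \<le> 2 * (?p m * (norm (y m))\<^sup>2) + 2 * (?p m * (norm (z m))\<^sup>2)"
    using mult_left_mono[OF norm_diff_sq_le[of "y m" "z m"], of "?p m"] by (simp add: algebra_simps)
qed (simp add: Xspace_0[OF assms(1)] Xspace_0[OF assms(2)])

lemma Xspace_scaleR:
  assumes "y \<in> Xspace s"
  shows "(\<lambda>m. c *\<^sub>R y m) \<in> Xspace s"
proof (rule Xspace_dominated(1))
  show "(\<lambda>m. c\<^sup>2 * (real m powr (2 * s) * (norm (y m))\<^sup>2)) summable_on {1..}"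
    by (intro summable_on_cmult_right Xspace_summable assms)
qed (use assms Xspace_0 in \<open>auto simp: power_mult_distrib\<close>)

lemma norm_le_Xnorm:
  assumes "y \<in> Xspace s" "1 \<le> m"
  shows "real m powr s * norm (y m) \<le> Xnorm s y"
proof -
  let ?f = "\<lambda>m. real m powr (2 * s) * (norm (y m))\<^sup>2"
  have "(real m powr s * norm (y m))\<^sup>2 = infsum ?f {m}"
    by (simp add: power_mult_distrib power2_eq_square mult_ac flip: powr_add)
  also have "\<dots> \<le> infsum ?f {1..}"
    by (rule infsum_mono2[OF _ Xspace_summable(1)[OF assms(1)]]) (use assms(2) in auto)
  also have "\<dots> = (Xnorm s y)\<^sup>2" by (rule Xspace_summable(2)[OF assms(1)])
  finally show ?thesis by (rule power2_le_imp_le) (rule Xnorm_nonneg)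
qed

text \<open>Membership in \<open>Xspace s\<close> must be required here: \<open>Xnorm\<close> is an infinite sum, which has the value \<open>0\<close>
when it diverges.\<close>

lemma coordinate_tendsto_0:
  assumes "\<forall>\<^sub>F \<tau> in F. y \<tau> \<in> Xspace s" "((\<lambda>\<tau>. Xnorm s (y \<tau>)) \<longlongrightarrow> 0) F" "1 \<le> m"
  shows "((\<lambda>\<tau>. y \<tau> m) \<longlongrightarrow> 0) F"
proof (rule tendsto_norm_zero_cancel, rule tendsto_sandwich[where f="\<lambda>_. 0"])
  show "((\<lambda>\<tau>. Xnorm s (y \<tau>) / real m powr s) \<longlongrightarrow> 0) F"
    using tendsto_divide[OF assms(2) tendsto_const[of "real m powr s"]] assms(3) by simp
  show "\<forall>\<^sub>F \<tau> in F. norm (y \<tau> m) \<le> Xnorm s (y \<tau>) / real m powr s"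
    using assms(1) by eventually_elim (use norm_le_Xnorm assms(3) in \<open>auto simp: field_simps\<close>)
qed auto

text \<open>Dominated convergence for series (Tannery).\<close>

lemma Xnorm_tendsto_0_dominated:
  fixes y :: "'b \<Rightarrow> nat \<Rightarrow> complex^'n"
  assumes "\<And>m. 1 \<le> m \<Longrightarrow> ((\<lambda>\<tau>. y \<tau> m) \<longlongrightarrow> 0) F"
    and "\<forall>\<^sub>F \<tau> in F. \<forall>m\<ge>1. real m powr (2 * s) * (norm (y \<tau> m))\<^sup>2 \<le> D m"
    and D: "D summable_on {1..}"
  shows "((\<lambda>\<tau>. Xnorm s (y \<tau>)) \<longlongrightarrow> 0) F"
proof (cases "F = bot")
  case False
  \<comment> \<open>Tannery's theorem sums over all of \<open>\<nat>\<close>; the entry \<open>0\<close> adds nothing.\<close>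
  define M where "M m = (if m = 0 then 0 else \<bar>D m\<bar>)" for m
  have "M summable_on {1..} \<longleftrightarrow> (\<lambda>m. \<bar>D m\<bar>) summable_on {1..}"
    by (rule summable_on_cong) (auto simp: M_def)
  also have "\<dots>" using D summable_on_iff_abs_summable_on_real by auto
  finally have "M summable_on {1..}" .
  moreover have "0 \<le> M m" "M 0 = 0" for m by (simp_all add: M_def)
  ultimately have "summable M" using summable_on_positive_nat_iff(1)[of M] by blast
  let ?a = "\<lambda>m \<tau>. real m powr (2 * s) * (norm (y \<tau> m))\<^sup>2"
  have b: "\<forall>\<^sub>F \<tau> in F. \<forall>m. norm (?a m \<tau>) \<le> M m"
    using assms(2)
  proof eventually_elim
    case (elim \<tau>)
    show ?case
    proof
      fix m show "norm (?a m \<tau>) \<le> M m" using elim[rule_format, of m] by (cases "m = 0") (auto simp: M_def)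
    qed
  qed
  have "((\<lambda>\<tau>. suminf (\<lambda>m. ?a m \<tau>)) \<longlongrightarrow> suminf (\<lambda>m. 0)) F"
  proof (intro tannerys_theorem[THEN conjunct2, THEN conjunct2])
    show "((\<lambda>\<tau>. ?a m \<tau>) \<longlongrightarrow> 0) F" for m
    proof (cases "m = 0")
      case False
      then have "((\<lambda>\<tau>. ?a m \<tau>) \<longlongrightarrow> real m powr (2 * s) * (norm (0::complex^'n))\<^sup>2) F"
        using assms(1) by (intro tendsto_intros) auto
      then show ?thesis by simp
    qed simp
    show "\<forall>\<^sub>F (m, \<tau>) in sequentially \<times>\<^sub>F F. norm (?a m \<tau>) \<le> M m"
      unfolding eventually_prod_filter
      by (rule exI[of _ "\<lambda>_. True"], rule exI[of _ "\<lambda>\<tau>. \<forall>m. norm (?a m \<tau>) \<le> M m"]) (use b in auto)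
    show "summable M" "F \<noteq> bot" by fact+
  qed
  then have "((\<lambda>\<tau>. sqrt (suminf (\<lambda>m. ?a m \<tau>))) \<longlongrightarrow> 0) F"
    using tendsto_real_sqrt[of _ 0] by simp
  moreover have "\<forall>\<^sub>F \<tau> in F. sqrt (suminf (\<lambda>m. ?a m \<tau>)) = Xnorm s (y \<tau>)"
    using b
  proof eventually_elim
    case (elim \<tau>)
    have "summable (\<lambda>m. ?a m \<tau>)"
      by (rule summable_comparison_test'[OF \<open>summable M\<close>, of 0]) (use elim in auto)
    then show ?case
      using summable_on_positive_nat_iff[of "\<lambda>m. ?a m \<tau>"] by (simp add: Xnorm_def)
  qed
  ultimately show ?thesis by (rule Lim_transform_eventually)
qed simp

lemma C0X_dominated:
  assumes "\<And>t. t \<in> {0..T} \<Longrightarrow> v t 0 = 0"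
    and b: "\<And>t m. t \<in> {0..T} \<Longrightarrow> 1 \<le> m \<Longrightarrow> real m powr (2 * s) * (norm (v t m))\<^sup>2 \<le> D m"
    and D: "D summable_on {1..}"
    and c: "\<And>m. 1 \<le> m \<Longrightarrow> continuous_on {0..T} (\<lambda>t. v t m)"
  shows "C0X T s v"
  unfolding C0X_def
proof (intro ballI conjI)
  fix t assume t: "t \<in> {0..T}"
  show "v t \<in> Xspace s" by (rule Xspace_dominated(1)[OF _ _ D]) (use assms t in auto)
  show "((\<lambda>\<tau>. Xnorm s (\<lambda>m. v \<tau> m - v t m)) \<longlongrightarrow> 0) (at t within {0..T})"
  proof (rule Xnorm_tendsto_0_dominated)
    fix m :: nat assume "1 \<le> m"
    then have "((\<lambda>\<tau>. v \<tau> m) \<longlongrightarrow> v t m) (at t within {0..T})"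
      using c t by (simp add: continuous_on)
    then show "((\<lambda>\<tau>. v \<tau> m - v t m) \<longlongrightarrow> 0) (at t within {0..T})" by (simp add: LIM_zero)
  next
    show "(\<lambda>m. 4 * D m) summable_on {1..}" by (rule summable_on_cmult_right[OF D])
    have "real m powr (2 * s) * (norm (v \<tau> m - v t m))\<^sup>2 \<le> 4 * D m" if "\<tau> \<in> {0..T}" "1 \<le> m" for \<tau> m
    proof -
      have "real m powr (2 * s) * (norm (v \<tau> m - v t m))\<^sup>2
          \<le> real m powr (2 * s) * (2 * (norm (v \<tau> m))\<^sup>2 + 2 * (norm (v t m))\<^sup>2)"
        by (intro mult_left_mono norm_diff_sq_le) auto
      also have "\<dots> \<le> 4 * D m" using b[OF that] b[OF t that(2)] by (simp add: algebra_simps)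
      finally show ?thesis .
    qed
    then show "\<forall>\<^sub>F \<tau> in at t within {0..T}. \<forall>m\<ge>1. real m powr (2 * s) * (norm (v \<tau> m - v t m))\<^sup>2 \<le> 4 * D m"
      by (auto simp: eventually_at_filter)
  qed
qed

lemma has_vector_derivative_iff_difference_quotient:
  fixes f :: "real \<Rightarrow> 'a::real_normed_vector"
  shows "(f has_vector_derivative D) (at t within S) \<longleftrightarrow>
    ((\<lambda>\<tau>. (1 / (\<tau> - t)) *\<^sub>R (f \<tau> - f t) - D) \<longlongrightarrow> 0) (at t within S)"
proof -
  let ?g = "\<lambda>\<tau>. (1 / norm (\<tau> - t)) *\<^sub>R (f \<tau> - (f t + (\<tau> - t) *\<^sub>R D))"
  let ?q = "\<lambda>\<tau>. (1 / (\<tau> - t)) *\<^sub>R (f \<tau> - f t) - D"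
  have "norm (?g \<tau>) = norm (?q \<tau>)" if "\<tau> \<noteq> t" for \<tau>
  proof -
    have "f \<tau> - (f t + (\<tau> - t) *\<^sub>R D) = (\<tau> - t) *\<^sub>R ?q \<tau>"
      using that by (simp add: scaleR_right_diff_distrib)
    then show ?thesis using that by simp
  qed
  then have ev: "\<forall>\<^sub>F \<tau> in at t within S. norm (?g \<tau>) = norm (?q \<tau>)"
    by (auto simp: eventually_at_filter)
  have "(f has_vector_derivative D) (at t within S) \<longleftrightarrow> (?g \<longlongrightarrow> 0) (at t within S)"
    by (simp add: has_vector_derivative_def has_derivative_within bounded_linear_scaleR_left)
  also have "\<dots> \<longleftrightarrow> ((\<lambda>\<tau>. norm (?g \<tau>)) \<longlongrightarrow> 0) (at t within S)" by (rule tendsto_norm_zero_iff[symmetric])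
  also have "\<dots> \<longleftrightarrow> ((\<lambda>\<tau>. norm (?q \<tau>)) \<longlongrightarrow> 0) (at t within S)" by (rule tendsto_cong[OF ev])
  also have "\<dots> \<longleftrightarrow> (?q \<longlongrightarrow> 0) (at t within S)" by (rule tendsto_norm_zero_iff)
  finally show ?thesis .
qed

text \<open>By the mean value inequality the difference quotients of a mode are bounded by the supremum of its
derivative, so the majorant of \<open>v'\<close> also dominates them.\<close>

lemma C1X_dominated:
  assumes v: "C0X T s v" and z: "\<And>t. t \<in> {0..T} \<Longrightarrow> v' t 0 = 0"
    and b: "\<And>t m. t \<in> {0..T} \<Longrightarrow> 1 \<le> m \<Longrightarrow> real m powr (2 * s) * (norm (v' t m))\<^sup>2 \<le> D m"
    and D: "D summable_on {1..}"
    and c: "\<And>m. 1 \<le> m \<Longrightarrow> continuous_on {0..T} (\<lambda>t. v' t m)"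
    and d: "\<And>t m. t \<in> {0..T} \<Longrightarrow> 1 \<le> m \<Longrightarrow> ((\<lambda>t. v t m) has_vector_derivative v' t m) (at t within {0..T})"
  shows "C1X T s v v'"
  unfolding C1X_def
proof (intro conjI ballI)
  show "C0X T s v'" by (rule C0X_dominated[OF z b D c])
  fix t assume t: "t \<in> {0..T}"
  let ?q = "\<lambda>\<tau> m. (1 / (\<tau> - t)) *\<^sub>R (v \<tau> m - v t m) - v' t m"
  show "((\<lambda>\<tau>. Xnorm s (?q \<tau>)) \<longlongrightarrow> 0) (at t within {0..T})"
  proof (rule Xnorm_tendsto_0_dominated)
    fix m :: nat assume m: "1 \<le> m"
    show "((\<lambda>\<tau>. ?q \<tau> m) \<longlongrightarrow> 0) (at t within {0..T})"
      using d[OF t m] unfolding has_vector_derivative_iff_difference_quotient .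
  next
    show "(\<lambda>m. 4 * D m) summable_on {1..}" by (rule summable_on_cmult_right[OF D])
    have "real m powr (2 * s) * (norm (?q \<tau> m))\<^sup>2 \<le> 4 * D m" if \<tau>: "\<tau> \<in> {0..T}" "\<tau> \<noteq> t" and m: "1 \<le> m" for \<tau> m
    proof -
      let ?p = "real m powr (2 * s)"
      have p: "0 < ?p" using m by simp
      have D0: "0 \<le> D m" using order_trans[OF _ b[OF t m]] by simp
      have bn: "norm (v' r m) \<le> sqrt (D m / ?p)" if "r \<in> {0..T}" for r
        using b[OF that m] p by (intro real_le_rsqrt) (simp add: field_simps)
      have "norm (v \<tau> m - v t m) \<le> sqrt (D m / ?p) * norm (\<tau> - t)"
      proof (rule differentiable_bound[of "{0..T}"])
        fix r assume r: "r \<in> {0..T}"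
        show "((\<lambda>t. v t m) has_derivative (\<lambda>h. h *\<^sub>R v' r m)) (at r within {0..T})"
          using d[OF r m] by (simp add: has_vector_derivative_def)
        show "onorm (\<lambda>h. h *\<^sub>R v' r m) \<le> sqrt (D m / ?p)"
          using bn[OF r] by (intro onorm_le) (simp add: mult.commute mult_left_mono)
      qed (use \<tau> t in auto)
      then have 1: "norm ((1 / (\<tau> - t)) *\<^sub>R (v \<tau> m - v t m)) \<le> sqrt (D m / ?p)"
        unfolding norm_scaleR using \<tau> by (simp add: pos_divide_le_eq)
      have "(norm (?q \<tau> m))\<^sup>2 \<le> 2 * (norm ((1 / (\<tau> - t)) *\<^sub>R (v \<tau> m - v t m)))\<^sup>2 + 2 * (norm (v' t m))\<^sup>2"
        by (rule norm_diff_sq_le)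
      also have "\<dots> \<le> 2 * (sqrt (D m / ?p))\<^sup>2 + 2 * (sqrt (D m / ?p))\<^sup>2"
        by (intro add_mono mult_left_mono power_mono 1 bn t) auto
      also have "\<dots> = 4 * D m / ?p" using D0 p by simp
      finally show ?thesis using p by (simp add: field_simps)
    qed
    then show "\<forall>\<^sub>F \<tau> in at t within {0..T}. \<forall>m\<ge>1. real m powr (2 * s) * (norm (?q \<tau> m))\<^sup>2 \<le> 4 * D m"
      by (auto simp: eventually_at_filter)
  qed
qed (rule v)

text \<open>The squared norm is a countable sum of measurable functions, hence measurable.\<close>

lemma L2X_dominated:
  assumes x: "\<And>t. t \<in> {0<..<T} \<Longrightarrow> w t \<in> Xspace s"
    and m: "\<And>m. 1 \<le> m \<Longrightarrow> set_borel_measurable lborel {0<..<T} (\<lambda>t. w t m)"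
    and b: "\<And>t. t \<in> {0<..<T} \<Longrightarrow> (Xnorm s (w t))\<^sup>2 \<le> \<phi> t"
    and \<phi>: "set_integrable lborel {0<..<T} \<phi>"
  shows "L2X T s w" and "(L2Xnorm T s w)\<^sup>2 \<le> (LINT t:{0<..<T}|lborel. \<phi> t)"
proof -
  let ?a = "\<lambda>t m. real m powr (2 * s) * (norm (indicator {0<..<T} t *\<^sub>R w t m))\<^sup>2"
  have eq: "indicator {0<..<T} t *\<^sub>R (Xnorm s (w t))\<^sup>2 = suminf (?a t)" for t
  proof (cases "t \<in> {0<..<T}")
    case True
    then show ?thesis
      using summable_on_positive_nat_iff(2)[OF _ _ Xspace_summable(1)[OF x[OF True]]]
        Xspace_summable(2)[OF x[OF True]] by simp
  qed simp
  have am: "(\<lambda>t. ?a t m) \<in> borel_measurable lborel" for m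
  proof (cases "m = 0")
    case False
    then have "(\<lambda>t. indicator {0<..<T} t *\<^sub>R w t m) \<in> borel_measurable lborel"
      using m[of m] by (simp add: set_borel_measurable_def)
    from measurable_compose[OF this borel_measurable_norm] show ?thesis
      by (intro borel_measurable_times borel_measurable_power borel_measurable_const)
  qed simp
  have meas: "(\<lambda>t. indicator {0<..<T} t *\<^sub>R (Xnorm s (w t))\<^sup>2) \<in> borel_measurable lborel"
    unfolding eq by (rule borel_measurable_suminf[OF am])
  have int: "set_integrable lborel {0<..<T} (\<lambda>t. (Xnorm s (w t))\<^sup>2)"
    unfolding set_integrable_def
  proof (rule Bochner_Integration.integrable_bound[OF _ meas])
    show "integrable lborel (\<lambda>t. indicator {0<..<T} t *\<^sub>R \<phi> t)" using \<phi> by (simp add: set_integrable_def)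
    show "AE t in lborel. norm (indicator {0<..<T} t *\<^sub>R (Xnorm s (w t))\<^sup>2) \<le> norm (indicator {0<..<T} t *\<^sub>R \<phi> t)"
      by (intro AE_I2) (use b in \<open>fastforce simp: indicator_def\<close>)
  qed
  then show "L2X T s w" using x m by (auto simp: L2X_def)
  have "(L2Xnorm T s w)\<^sup>2 = (LINT t:{0<..<T}|lborel. (Xnorm s (w t))\<^sup>2)"
    unfolding L2Xnorm_def set_lebesgue_integral_def by (simp add: integral_nonneg_AE)
  also have "\<dots> \<le> (LINT t:{0<..<T}|lborel. \<phi> t)"
    by (rule set_integral_mono[OF int \<phi>]) (rule b)
  finally show "(L2Xnorm T s w)\<^sup>2 \<le> (LINT t:{0<..<T}|lborel. \<phi> t)" .
qed

section \<open>The sine basis\<close>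

lemma continuous_on_phi: "continuous_on S (phi m)"
  unfolding phi_def by (intro continuous_intros)

lemma hcoef_eq:
  assumes "1 \<le> m"
  shows "hcoef m = (-1) ^ (m + 1) * sqrt (2 / pi) / real m"
proof -
  have i: "((\<lambda>x. x / pi * phi m x) has_integral
      sqrt (2 / pi) / pi * (sin (real m * pi) / (real m)\<^sup>2 - pi * cos (real m * pi) / real m)
      - sqrt (2 / pi) / pi * (sin (real m * 0) / (real m)\<^sup>2 - 0 * cos (real m * 0) / real m)) {0..pi}"
    using assms unfolding phi_def
    by (intro fundamental_theorem_of_calculus)
      (auto intro!: derivative_eq_intros simp: has_real_derivative_iff_has_vector_derivative[symmetric]
        field_simps power2_eq_square)
  have "set_integrable lborel {0..pi} (\<lambda>x. x / pi * phi m x)"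
    by (intro borel_integrable_atLeastAtMost' continuous_intros continuous_on_phi) auto
  then have "hcoef m = integral {0..pi} (\<lambda>x. x / pi * phi m x)"
    unfolding hcoef_def by (rule set_integral_open_eq_integral(2))
  then show ?thesis using integral_unique[OF i] by (simp add: sin_npi cos_npi)
qed

lemma hcoef_sq: "1 \<le> m \<Longrightarrow> (hcoef m)\<^sup>2 = 2 / pi * inverse ((real m)\<^sup>2)"
  by (simp add: hcoef_eq power_mult_distrib power_divide field_simps flip: power_mult)

lemma hcoef_sq_summable: "(\<lambda>m. (hcoef m)\<^sup>2) summable_on {1..}"
proof -
  have "summable (\<lambda>m. 2 / pi * inverse ((real m)\<^sup>2))"
    using inverse_power_summable[of 2, where 'a=real] by (intro summable_mult) auto
  then have "(\<lambda>m. 2 / pi * inverse ((real m)\<^sup>2)) summable_on UNIV"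
    by (subst summable_on_UNIV_nonneg_real_iff) auto
  then have "(\<lambda>m. 2 / pi * inverse ((real m)\<^sup>2)) summable_on {1..}"
    by (rule summable_on_subset_banach) auto
  then show ?thesis by (rule summable_on_cong[THEN iffD1, rotated]) (simp add: hcoef_sq)
qed

lemma phi_orthonormal:
  assumes "1 \<le> k" "1 \<le> m"
  shows "((\<lambda>x. phi k x * phi m x) has_integral (if k = m then 1 else 0)) {0..pi}"
proof -
  have e: "phi k x * phi m x = (1 / pi) * (cos ((real k - real m) * x) - cos ((real k + real m) * x))" for x
  proof -
    have c: "sqrt (2 / pi) * sqrt (2 / pi) = 2 / pi" by (rule real_sqrt_mult_self[THEN trans]) simp
    have "phi k x * phi m x = (sqrt (2 / pi) * sqrt (2 / pi)) * (sin (real k * x) * sin (real m * x))"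
      unfolding phi_def by (simp only: mult_ac)
    then show ?thesis unfolding c sin_times_sin by (simp add: left_diff_distrib distrib_right divide_simps)
  qed
  have cos0: "((\<lambda>x. cos (a * x)) has_integral 0) {0..pi}" if "a \<noteq> 0" "sin (a * pi) = 0" for a
  proof -
    have "((\<lambda>x. cos (a * x)) has_integral sin (a * pi) / a - sin (a * 0) / a) {0..pi}"
      using that(1) by (intro fundamental_theorem_of_calculus)
        (auto intro!: derivative_eq_intros simp: has_real_derivative_iff_has_vector_derivative[symmetric])
    then show ?thesis using that(2) by simp
  qed
  have plus: "((\<lambda>x. cos ((real k + real m) * x)) has_integral 0) {0..pi}"
    using sin_npi[of "k + m"] assms by (intro cos0) auto
  have minus: "((\<lambda>x. cos ((real k - real m) * x)) has_integral (if k = m then pi else 0)) {0..pi}"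
  proof (cases "k = m")
    case True
    then show ?thesis using has_integral_const_real[of "1::real" 0 pi] by simp
  next
    case False
    have "sin ((real k - real m) * pi) = 0" using sin_npi_int[of "int k - int m"] by (simp add: mult.commute)
    with False show ?thesis using cos0[of "real k - real m"] by simp
  qed
  have "((\<lambda>x. (1 / pi) * (cos ((real k - real m) * x) - cos ((real k + real m) * x)))
      has_integral (1 / pi) * ((if k = m then pi else 0) - 0)) {0..pi}"
    by (intro has_integral_mult_right has_integral_diff plus minus)
  then show ?thesis unfolding e by auto
qed

lemma norm_hprod_le: "norm (hprod x y) \<le> norm x * norm y"
proof -
  have "norm (hprod x y) \<le> (\<Sum>i\<in>UNIV. \<bar>norm (x $ i)\<bar> * \<bar>norm (y $ i)\<bar>)"
    unfolding hprod_def by (rule norm_sum[THEN order_trans]) (simp add: norm_mult)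
  also have "\<dots> \<le> norm x * norm y"
    unfolding norm_vec_def by (rule L2_set_mult_ineq)
  finally show ?thesis .
qed

lemma bounded_linear_hprod_left: "bounded_linear (\<lambda>x. hprod x y)"
proof (rule bounded_linear_intro[where K="norm y"])
  show "hprod (x + x') y = hprod x y + hprod x' y" for x x'
    by (simp add: hprod_def algebra_simps sum.distrib)
  show "hprod (r *\<^sub>R x) y = r *\<^sub>R hprod x y" for r x
    by (simp add: hprod_def scaleR_right.sum)
qed (rule norm_hprod_le)

text \<open>The sine series may be integrated term by term because it converges absolutely and uniformly;
orthonormality then leaves a single term.\<close>

lemma sine_coefficient_of_sum:
  fixes y :: "nat \<Rightarrow> complex^'n"
  assumes y: "summable (\<lambda>k. norm (y k))" and m: "1 \<le> m"
  shows "(LINT x:{0<..<pi}|lborel. hprod (fun_of y x) \<psi> * complex_of_real (phi m x)) = hprod (y m) \<psi>"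
proof -
  have phi0: "phi 0 x = 0" for x by (simp add: phi_def)
  have phi1: "\<bar>phi k x\<bar> \<le> 1" for k x
  proof -
    have "sqrt (2 / pi) \<le> 1" using pi_ge_two by (simp del: real_sqrt_divide)
    then have "sqrt (2 / pi) * \<bar>sin (real k * x)\<bar> \<le> 1 * 1"
      by (intro mult_mono) auto
    then show ?thesis by (simp add: phi_def abs_mult del: real_sqrt_divide)
  qed
  let ?F = "\<lambda>k x. indicator {0<..<pi} x *\<^sub>R ((phi k x * phi m x) *\<^sub>R hprod (y k) \<psi>)"
  have sm: "summable (\<lambda>k. phi k x *\<^sub>R y k)" and sn: "summable (\<lambda>k. norm (phi k x *\<^sub>R y k))" for x
  proof -
    show "summable (\<lambda>k. norm (phi k x *\<^sub>R y k))"
      by (rule summable_comparison_test'[OF y, of 0]) (use phi1 in \<open>auto intro: mult_left_le_one_le\<close>)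
    then show "summable (\<lambda>k. phi k x *\<^sub>R y k)" by (rule summable_norm_cancel)
  qed
  have "fun_of y x = (\<Sum>k. phi k x *\<^sub>R y k)" for x
  proof -
    have "fun_of y x = (\<Sum>\<^sub>\<infinity>k\<in>UNIV. phi k x *\<^sub>R y k)"
      unfolding fun_of_def by (rule infsum_cong_neutral) (auto simp: phi0 not_le)
    then show ?thesis using norm_summable_imp_has_sum[OF sn summable_sums[OF sm]] by (simp add: infsumI)
  qed
  then have eq: "indicator {0<..<pi} x *\<^sub>R (hprod (fun_of y x) \<psi> * complex_of_real (phi m x)) = (\<Sum>k. ?F k x)" for x
  proof -
    let ?L = "\<lambda>z. indicator {0<..<pi} x *\<^sub>R (phi m x *\<^sub>R hprod z \<psi>)"
    have L: "bounded_linear ?L"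
      by (intro bounded_linear_compose[OF bounded_linear_scaleR_right] bounded_linear_hprod_left)
    have "indicator {0<..<pi} x *\<^sub>R (hprod (fun_of y x) \<psi> * complex_of_real (phi m x)) = ?L (\<Sum>k. phi k x *\<^sub>R y k)"
      using \<open>fun_of y x = _\<close> by (simp add: scaleR_conv_of_real mult_ac)
    also have "\<dots> = (\<Sum>k. ?L (phi k x *\<^sub>R y k))" by (rule bounded_linear.suminf[OF L sm])
    also have "\<dots> = (\<Sum>k. ?F k x)"
      by (simp add: linear_cmul[OF bounded_linear.linear[OF bounded_linear_hprod_left]] mult_ac)
    finally show ?thesis .
  qed
  have F: "set_integrable lborel {0..pi} (\<lambda>x. (phi k x * phi m x) *\<^sub>R hprod (y k) \<psi>)" for k
    by (intro borel_integrable_atLeastAtMost' continuous_intros continuous_on_phi)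
  have iF: "integrable lborel (?F k)" for k
    using set_integral_open_eq_integral(1)[OF F] by (simp add: set_integrable_def)
  have nF: "norm (?F k x) \<le> indicator {0<..<pi} x * (norm (y k) * norm \<psi>)" for k x
  proof -
    have "\<bar>phi k x * phi m x\<bar> \<le> 1 * 1" unfolding abs_mult by (intro mult_mono phi1) auto
    then have "\<bar>phi k x * phi m x\<bar> * norm (hprod (y k) \<psi>) \<le> 1 * (norm (y k) * norm \<psi>)"
      by (intro mult_mono norm_hprod_le) auto
    then show ?thesis by (auto simp: indicator_def)
  qed
  have "(LINT x|lborel. norm (?F k x)) \<le> pi * norm \<psi> * norm (y k)" for k
  proof -
    have "(LINT x|lborel. norm (?F k x)) \<le> (LINT x|lborel. indicator {0<..<pi} x * (norm (y k) * norm \<psi>))"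
      by (rule integral_mono[OF integrable_norm[OF iF] _ nF]) auto
    then show ?thesis by (simp add: mult_ac)
  qed
  then have s2: "summable (\<lambda>k. LINT x|lborel. norm (?F k x))"
    by (intro summable_comparison_test'[OF summable_mult[OF y, of "pi * norm \<psi>"], of 0]) auto
  have s1: "summable (\<lambda>k. norm (?F k x))" for x
    by (rule summable_comparison_test'[OF summable_mult[OF y, of "norm \<psi>"], of 0])
      (use nF[where x=x] in \<open>auto simp: indicator_def mult.commute split: if_splits\<close>)
  have int: "(LINT x|lborel. ?F k x) = (if k = m then hprod (y m) \<psi> else 0)" for k
  proof (cases "k = 0")
    case False
    have "(LINT x|lborel. ?F k x) = integral {0..pi} (\<lambda>x. (phi k x * phi m x) *\<^sub>R hprod (y k) \<psi>)"
      using set_integral_open_eq_integral(2)[OF F] by (simp add: set_lebesgue_integral_def)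
    also have "\<dots> = (if k = m then 1 else 0) *\<^sub>R hprod (y k) \<psi>"
      by (rule integral_unique, rule has_integral_scaleR_left, rule phi_orthonormal) (use False m in auto)
    finally show ?thesis by simp
  qed (use m in \<open>simp add: phi0\<close>)
  have "(LINT x:{0<..<pi}|lborel. hprod (fun_of y x) \<psi> * complex_of_real (phi m x)) = (LINT x|lborel. (\<Sum>k. ?F k x))"
    unfolding set_lebesgue_integral_def eq ..
  also have "\<dots> = (\<Sum>k. LINT x|lborel. ?F k x)"
    by (rule integral_suminf[OF iF _ s2]) (intro AE_I2 s1)
  also have "\<dots> = hprod (y m) \<psi>"
    unfolding int using sums_single[of m "\<lambda>_. hprod (y m) \<psi>"] by (simp add: sums_iff eq_commute)
  finally show ?thesis .
qed

section \<open>From solutions to modes; uniqueness\<close>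

text \<open>In terms of \<open>q = m\<^sup>2\<close>, the weights of \<open>X\<^sup>3\<close>, \<open>X\<^sup>1\<close> and \<open>X\<^sup>-\<^sup>1\<close> are \<open>q\<^sup>3\<close>, \<open>q\<close> and \<open>1 / q\<close>.\<close>

lemma sobolev_weight:
  assumes "1 \<le> (m::nat)"
  shows "real m powr (2 * 3) = (real m)\<^sup>2 ^ 3" "real m powr (2 * 1) = (real m)\<^sup>2"
    "real m powr (2 * (-1)) = 1 / (real m)\<^sup>2"
proof -
  have "0 < real m" using assms by simp
  then show "real m powr (2 * 3) = (real m)\<^sup>2 ^ 3" "real m powr (2 * 1) = (real m)\<^sup>2"
    "real m powr (2 * (-1)) = 1 / (real m)\<^sup>2"
    by (simp_all add: powr_minus divide_inverse flip: power_mult)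
qed

lemma norm_sq_le_onorm:
  assumes "bounded_linear L"
  shows "(norm (L x))\<^sup>2 \<le> (onorm L)\<^sup>2 * (norm x)\<^sup>2"
  using power_mono[OF onorm[OF assms, of x], of 2] by (simp add: power_mult_distrib)

text \<open>The force is cut off outside \<open>(0, T)\<close>, where \<open>f\<close> and its weak derivatives carry no information.\<close>

lemma boundary_force_L2:
  fixes A :: "complex^'n^'n" and B :: "complex^'l^'n"
  assumes f: "L2 T f" and f'': "L2 T f''"
  defines "F \<equiv> \<lambda>t. indicator {0<..<T} t *\<^sub>R (B *v f'' t + (A ** B) *v f t)"
  shows "set_integrable lborel {0..T} F" and "set_integrable lborel {0..T} (\<lambda>t. (norm (F t))\<^sup>2)"
    and "integral {0..T} (\<lambda>t. (norm (F t))\<^sup>2) \<le> 2 * ((onorm ((*v) B))\<^sup>2 + (onorm ((*v) (A ** B)))\<^sup>2) *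
      ((LINT t:{0<..<T}|lborel. (norm (f t))\<^sup>2) + (LINT t:{0<..<T}|lborel. (norm (f'' t))\<^sup>2))"
proof -
  let ?b = "(onorm ((*v) B))\<^sup>2" and ?c = "(onorm ((*v) (A ** B)))\<^sup>2"
  have LB: "bounded_linear ((*v) B)" and LC: "bounded_linear ((*v) (A ** B))" by simp_all
  have m: "(\<lambda>t. indicator {0<..<T} t *\<^sub>R L (h t)) \<in> borel_measurable lborel"
    if "bounded_linear L" "L2 T h" for L :: "complex^'l \<Rightarrow> complex^'n" and h
  proof -
    interpret L: bounded_linear L by fact
    have "L \<in> borel_measurable borel"
      by (intro borel_measurable_continuous_onI L.continuous_on continuous_on_id)
    moreover have "(\<lambda>t. indicator {0<..<T} t *\<^sub>R h t) \<in> borel_measurable lborel"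
      using that(2) by (simp add: L2_def set_borel_measurable_def)
    ultimately have "(\<lambda>t. L (indicator {0<..<T} t *\<^sub>R h t)) \<in> borel_measurable lborel"
      by (rule measurable_compose[rotated])
    then show ?thesis by (simp add: L.scaleR)
  qed
  have F: "F \<in> borel_measurable lborel"
    using borel_measurable_add[OF m[OF LB f''] m[OF LC f]] by (simp add: F_def scaleR_right_distrib)
  have ind: "(\<lambda>t. indicator {0..T} t *\<^sub>R F t) = F" by (auto simp: F_def indicator_def)
  have ind2: "(\<lambda>t. indicator {0..T} t *\<^sub>R (norm (F t))\<^sup>2) = (\<lambda>t. (norm (F t))\<^sup>2)" by (auto simp: F_def indicator_def)
  let ?g = "\<lambda>t. indicator {0<..<T} t *\<^sub>R (2 * ?c * (norm (f t))\<^sup>2 + 2 * ?b * (norm (f'' t))\<^sup>2)"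
  have bound: "(norm (F t))\<^sup>2 \<le> ?g t" for t
  proof (cases "t \<in> {0<..<T}")
    case True
    then have "(norm (F t))\<^sup>2 \<le> 2 * (norm (B *v f'' t))\<^sup>2 + 2 * (norm ((A ** B) *v f t))\<^sup>2"
      using norm_add_sq_le by (simp add: F_def)
    also have "\<dots> \<le> 2 * (?b * (norm (f'' t))\<^sup>2) + 2 * (?c * (norm (f t))\<^sup>2)"
      by (intro add_mono mult_left_mono norm_sq_le_onorm LB LC) auto
    finally show ?thesis using True by simp
  qed (simp add: F_def)
  have si: "set_integrable lborel {0<..<T} (\<lambda>t. 2 * ?c * (norm (f t))\<^sup>2)"
     "set_integrable lborel {0<..<T} (\<lambda>t. 2 * ?b * (norm (f'' t))\<^sup>2)"
    using f f'' by (auto simp: L2_def)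
  then have g: "integrable lborel ?g" using set_integral_add(1)[OF si] by (simp add: set_integrable_def)
  have F2: "integrable lborel (\<lambda>t. (norm (F t))\<^sup>2)"
  proof (rule Bochner_Integration.integrable_bound[OF g])
    show "(\<lambda>t. (norm (F t))\<^sup>2) \<in> borel_measurable lborel"
      by (intro borel_measurable_power measurable_compose[OF F borel_measurable_norm])
    show "AE t in lborel. norm ((norm (F t))\<^sup>2) \<le> norm (?g t)"
    proof (rule AE_I2)
      fix t
      have "norm ((norm (F t))\<^sup>2) = (norm (F t))\<^sup>2" by simp
      also have "\<dots> \<le> ?g t" by (rule bound)
      also have "\<dots> \<le> norm (?g t)" unfolding real_norm_def by (rule abs_ge_self)
      finally show "norm ((norm (F t))\<^sup>2) \<le> norm (?g t)" .
    qed
  qed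
  then show i2: "set_integrable lborel {0..T} (\<lambda>t. (norm (F t))\<^sup>2)" unfolding set_integrable_def ind2 .
  show "set_integrable lborel {0..T} F"
    unfolding set_integrable_def ind
  proof (rule Bochner_Integration.integrable_bound[OF _ F])
    show "integrable lborel (\<lambda>t. indicator {0..T} t + (norm (F t))\<^sup>2)"
      using F2 by (intro Bochner_Integration.integrable_add integrable_real_indicator) (auto simp: emeasure_lborel_Icc_eq)
    show "AE t in lborel. norm (F t) \<le> norm (indicator {0..T} t + (norm (F t))\<^sup>2)"
    proof (rule AE_I2)
      fix t
      have "norm (F t) \<le> 1 + (norm (F t))\<^sup>2"
        using sum_squares_bound[of "norm (F t)" 1] norm_ge_zero[of "F t"] unfolding one_power2 mult_1_right by linarith
      then show "norm (F t) \<le> norm (indicator {0..T} t + (norm (F t))\<^sup>2)"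
        by (auto simp: F_def indicator_def)
    qed
  qed
  have "integral {0..T} (\<lambda>t. (norm (F t))\<^sup>2) = (LINT t|lborel. (norm (F t))\<^sup>2)"
    using set_borel_integral_eq_integral(2)[OF i2] unfolding set_lebesgue_integral_def ind2 by simp
  also have "\<dots> \<le> (LINT t|lborel. ?g t)" by (rule integral_mono[OF F2 g bound])
  also have "\<dots> = (LINT t:{0<..<T}|lborel. 2 * ?c * (norm (f t))\<^sup>2) + (LINT t:{0<..<T}|lborel. 2 * ?b * (norm (f'' t))\<^sup>2)"
    using set_integral_add(2)[OF si] by (simp add: set_lebesgue_integral_def)
  also have "\<dots> = 2 * ?c * (LINT t:{0<..<T}|lborel. (norm (f t))\<^sup>2) + 2 * ?b * (LINT t:{0<..<T}|lborel. (norm (f'' t))\<^sup>2)"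
    by simp
  also have "\<dots> \<le> 2 * (?b + ?c) * (LINT t:{0<..<T}|lborel. (norm (f t))\<^sup>2) + 2 * (?b + ?c) * (LINT t:{0<..<T}|lborel. (norm (f'' t))\<^sup>2)"
    unfolding set_lebesgue_integral_def
    by (intro add_mono mult_right_mono integral_nonneg_AE AE_I2) auto
  finally show "integral {0..T} (\<lambda>t. (norm (F t))\<^sup>2) \<le> 2 * (?b + ?c) *
      ((LINT t:{0<..<T}|lborel. (norm (f t))\<^sup>2) + (LINT t:{0<..<T}|lborel. (norm (f'' t))\<^sup>2))"
    by (simp add: distrib_left)
qed

lemma C0X_continuous_mode:
  assumes v: "C0X T s v" and m: "1 \<le> m"
  shows "continuous_on {0..T} (\<lambda>t. v t m)"
  unfolding continuous_on
proof
  fix t assume t: "t \<in> {0..T}"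
  have "((\<lambda>\<tau>. v \<tau> m - v t m) \<longlongrightarrow> 0) (at t within {0..T})"
  proof (rule coordinate_tendsto_0[OF _ _ m])
    show "\<forall>\<^sub>F \<tau> in at t within {0..T}. (\<lambda>m. v \<tau> m - v t m) \<in> Xspace s"
      unfolding eventually_at_filter using v t by (intro always_eventually) (auto simp: C0X_def intro!: Xspace_diff)
    show "((\<lambda>\<tau>. Xnorm s (\<lambda>m. v \<tau> m - v t m)) \<longlongrightarrow> 0) (at t within {0..T})"
      using v t by (simp add: C0X_def)
  qed
  then show "((\<lambda>\<tau>. v \<tau> m) \<longlongrightarrow> v t m) (at t within {0..T})" by (rule LIM_zero_cancel)
qed

lemma C1X_derivative_mode:
  assumes v: "C1X T s v v'" and m: "1 \<le> m" and t: "t \<in> {0..T}"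
  shows "((\<lambda>t. v t m) has_vector_derivative v' t m) (at t within {0..T})"
  unfolding has_vector_derivative_iff_difference_quotient
proof (rule coordinate_tendsto_0[OF _ _ m])
  show "((\<lambda>\<tau>. Xnorm s (\<lambda>m. (1 / (\<tau> - t)) *\<^sub>R (v \<tau> m - v t m) - v' t m)) \<longlongrightarrow> 0) (at t within {0..T})"
    using v t by (simp add: C1X_def)
  show "\<forall>\<^sub>F \<tau> in at t within {0..T}. (\<lambda>m. (1 / (\<tau> - t)) *\<^sub>R (v \<tau> m - v t m) - v' t m) \<in> Xspace s"
    unfolding eventually_at_filter using v t
    by (intro always_eventually) (auto simp: C1X_def C0X_def intro!: Xspace_diff Xspace_scaleR)
qed

text \<open>Every solution in the sense of the definition solves the integrated equation of each mode: the weak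
second derivative equals the right-hand side of the equation almost everywhere, and the continuous
function \<open>v' t m\<close> is the primitive of it. Uniqueness and decay thus concern arbitrary solutions and
not only a constructed one.\<close>

lemma solution_damped_mode:
  fixes A :: "complex^'n^'n" and B :: "complex^'l^'n"
  assumes T: "0 < T" and sol: "solution T \<rho> A B f f'' u0 u1 v v' v''" and m: "1 \<le> m"
    and F: "set_integrable lborel {0..T} F"
    and Feq: "\<And>t. t \<in> {0<..<T} \<Longrightarrow> F t = B *v f'' t + (A ** B) *v f t"
  shows "damped_mode T \<rho> ((real m)\<^sup>2) ((*v) A) (\<lambda>t. - (hcoef m *\<^sub>R F t)) (\<lambda>t. v t m) (\<lambda>t. v' t m)"
proof -
  let ?R = "\<lambda>t. - (hcoef m *\<^sub>R F t) - (\<rho> * (real m)\<^sup>2) *\<^sub>R v' t m - ((real m)\<^sup>2)\<^sup>2 *\<^sub>R v t m - A *v v t m"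
  have C1: "C1X T 1 v v'" and H: "H2X T (-1) v v' v''"
    and eq: "AE t in lborel. t \<in> {0<..<T} \<longrightarrow> v'' t m = ?R t"
  proof -
    show "C1X T 1 v v'" "H2X T (-1) v v' v''" using sol by (auto simp: solution_def)
    have "AE t in lborel. t \<in> {0<..<T} \<longrightarrow>
        (\<forall>m\<ge>1. v'' t m + Lop (Lop (v t)) m + \<rho> *\<^sub>R Lop (v' t) m + A *v v t m
           = - (hcoef m *\<^sub>R (B *v f'' t + (A ** B) *v f t)))"
      using sol by (simp add: solution_def)
    then show "AE t in lborel. t \<in> {0<..<T} \<longrightarrow> v'' t m = ?R t"
    proof eventually_elim
      case (elim t)
      show ?case
      proof
        assume t: "t \<in> {0<..<T}"
        have "v'' t m + ((real m)\<^sup>2)\<^sup>2 *\<^sub>R v t m + (\<rho> * (real m)\<^sup>2) *\<^sub>R v' t m + A *v v t m = - (hcoef m *\<^sub>R F t)"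
          using elim[rule_format, OF t m] Feq[OF t] by (simp add: Lop_def power2_eq_square)
        then show "v'' t m = ?R t" by (simp add: algebra_simps add_eq_0_iff flip: eq_diff_eq)
      qed
    qed
  qed
  have cv: "continuous_on {0..T} (\<lambda>t. v t m)" and cv': "continuous_on {0..T} (\<lambda>t. v' t m)"
    using C1 C0X_continuous_mode m unfolding C1X_def by blast+
  have G: "set_integrable lborel {0..T} (\<lambda>t. - (hcoef m *\<^sub>R F t))"
    using set_integrable_scaleR_right[of "- hcoef m", OF F] by simp
  have R: "set_integrable lborel {0..T} ?R"
    using damped_mode_rhs_integrable[OF _ G cv cv', of "(*v) A" \<rho> "(real m)\<^sup>2"] by simp
  have "v t m = v 0 m + integral {0..t} (\<lambda>t. v' t m)" if t: "t \<in> {0..T}" for t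
  proof -
    have "((\<lambda>t. v' t m) has_integral v t m - v 0 m) {0..t}"
      using t by (intro fundamental_theorem_of_calculus has_vector_derivative_within_subset[OF C1X_derivative_mode[OF C1 m]]) auto
    then show ?thesis by (simp add: integral_unique)
  qed
  moreover have "v' t m = v' 0 m + integral {0..t} ?R" if t: "t \<in> {0..T}" for t
  proof (rule weak_deriv_imp_indefinite_integral[OF T cv' R _ t])
    show "weak_deriv T (\<lambda>t. v' t m) ?R"
    proof (rule weak_deriv_cong_AE[OF _ _ _ eq])
      show "weak_deriv T (\<lambda>t. v' t m) (\<lambda>t. v'' t m)" "set_borel_measurable lborel {0<..<T} (\<lambda>t. v'' t m)"
        using H m by (auto simp: H2X_def weak_derivX_def L2X_def)
      show "set_borel_measurable lborel {0<..<T} ?R"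
        using set_integral_open_eq_integral(1)[OF R] by (auto simp: set_borel_measurable_def set_integrable_def)
    qed
  qed
  ultimately show ?thesis using cv cv' unfolding damped_mode_def by blast
qed

lemma damped_mode_diff:
  fixes A :: "'a::euclidean_space \<Rightarrow> 'a"
  assumes A: "bounded_linear A" and G: "set_integrable lborel {0..T} G"
    and m1: "damped_mode T \<rho> q A G v w" and m2: "damped_mode T \<rho> q A G x y"
  shows "damped_mode T \<rho> q A (\<lambda>_. 0) (\<lambda>t. v t - x t) (\<lambda>t. w t - y t)"
proof -
  have c: "continuous_on {0..T} v" "continuous_on {0..T} w" "continuous_on {0..T} x" "continuous_on {0..T} y"
    and v: "\<And>t. t \<in> {0..T} \<Longrightarrow> v t = v 0 + integral {0..t} w"
    and w: "\<And>t. t \<in> {0..T} \<Longrightarrow> w t = w 0 + integral {0..t} (\<lambda>s. G s - (\<rho> * q) *\<^sub>R w s - q\<^sup>2 *\<^sub>R v s - A (v s))"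
    and x: "\<And>t. t \<in> {0..T} \<Longrightarrow> x t = x 0 + integral {0..t} y"
    and y: "\<And>t. t \<in> {0..T} \<Longrightarrow> y t = y 0 + integral {0..t} (\<lambda>s. G s - (\<rho> * q) *\<^sub>R y s - q\<^sup>2 *\<^sub>R x s - A (x s))"
    using m1 m2 unfolding damped_mode_def by blast+
  have sub: "f integrable_on {0..t}" if "set_integrable lborel {0..T} f" "t \<in> {0..T}" for f :: "real \<Rightarrow> 'a" and t
    by (rule set_borel_integral_eq_integral(1), rule set_integrable_subset[OF that(1)]) (use that in auto)
  have "v t - x t = (v 0 - x 0) + integral {0..t} (\<lambda>s. w s - y s)" if t: "t \<in> {0..T}" for t
  proof -
    have "integral {0..t} (\<lambda>s. w s - y s) = integral {0..t} w - integral {0..t} y"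
      by (intro Henstock_Kurzweil_Integration.integral_diff sub t borel_integrable_atLeastAtMost' c)
    then show ?thesis using v[OF t] x[OF t] by (simp add: algebra_simps)
  qed
  moreover have "w t - y t = (w 0 - y 0) + integral {0..t} (\<lambda>s. 0 - (\<rho> * q) *\<^sub>R (w s - y s) - q\<^sup>2 *\<^sub>R (v s - x s) - A (v s - x s))"
    if t: "t \<in> {0..T}" for t
  proof -
    have "(\<lambda>s. 0 - (\<rho> * q) *\<^sub>R (w s - y s) - q\<^sup>2 *\<^sub>R (v s - x s) - A (v s - x s)) =
      (\<lambda>s. (G s - (\<rho> * q) *\<^sub>R w s - q\<^sup>2 *\<^sub>R v s - A (v s)) - (G s - (\<rho> * q) *\<^sub>R y s - q\<^sup>2 *\<^sub>R x s - A (x s)))"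
      by (auto simp: bounded_linear.linear[OF A, THEN linear_diff] algebra_simps)
    moreover have "integral {0..t} (\<lambda>s. (G s - (\<rho> * q) *\<^sub>R w s - q\<^sup>2 *\<^sub>R v s - A (v s)) - (G s - (\<rho> * q) *\<^sub>R y s - q\<^sup>2 *\<^sub>R x s - A (x s)))
      = integral {0..t} (\<lambda>s. G s - (\<rho> * q) *\<^sub>R w s - q\<^sup>2 *\<^sub>R v s - A (v s)) - integral {0..t} (\<lambda>s. G s - (\<rho> * q) *\<^sub>R y s - q\<^sup>2 *\<^sub>R x s - A (x s))"
      by (intro Henstock_Kurzweil_Integration.integral_diff sub t damped_mode_rhs_integrable[OF A G] c)
    ultimately show ?thesis using w[OF t] y[OF t] by (simp add: algebra_simps)
  qed
  ultimately show ?thesis unfolding damped_mode_def by (intro conjI continuous_intros c ballI)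
qed

text \<open>The difference of two solutions is force-free with zero initial energy.\<close>

lemma solution_unique:
  assumes T: "0 < T" and \<rho>: "0 < \<rho>" "\<rho> < 2" and F: "set_integrable lborel {0..T} F"
    and Feq: "\<And>t. t \<in> {0<..<T} \<Longrightarrow> F t = B *v f'' t + (A ** B) *v f t"
    and v: "solution T \<rho> A B f f'' u0 u1 v v' v''" and w: "solution T \<rho> A B f f'' u0 u1 w w' w''"
    and t: "t \<in> {0..T}"
  shows "w t = v t"
proof
  fix m
  show "w t m = v t m"
  proof (cases "m = 0")
    case True
    then show ?thesis using v w t by (auto simp: solution_def C0X_def dest!: bspec[OF _ t] Xspace_0)
  next
    case False
    then have m: "1 \<le> m" by simp
    have A: "bounded_linear ((*v) A)" by simp
    have G: "set_integrable lborel {0..T} (\<lambda>t. - (hcoef m *\<^sub>R F t))"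
      using set_integrable_scaleR_right[of "- hcoef m", OF F] by simp
    let ?E = "\<lambda>t. mode_energy \<rho> ((real m)\<^sup>2) (w t m - v t m) (w' t m - v' t m)"
    let ?c = "onorm ((*v) A) / sqrt (1 - \<rho>\<^sup>2 / 4) - \<rho> * (real m)\<^sup>2"
    have "?E t \<le> exp (?c * t) * ?E 0"
    proof (rule damped_mode_energy_decay[OF \<rho> _ A _ _ _ t])
      show "damped_mode T \<rho> ((real m)\<^sup>2) ((*v) A) (\<lambda>_. 0) (\<lambda>t. w t m - v t m) (\<lambda>t. w' t m - v' t m)"
        by (rule damped_mode_diff[OF A G solution_damped_mode[OF T w m F Feq] solution_damped_mode[OF T v m F Feq]])
      show "0 \<le> onorm ((*v) A)" "\<And>x. norm (A *v x) \<le> onorm ((*v) A) * norm x"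
        using onorm_pos_le[OF A] onorm[OF A] by auto
    qed (use m in simp)
    also have "?E 0 = 0" using v w by (simp add: solution_def mode_energy_def)
    finally have "?E t \<le> 0" by simp
    moreover have "0 \<le> (2 + 3 / (1 - \<rho>\<^sup>2 / 4))"
      using power_strict_mono[of \<rho> 2 2] \<rho> by simp
    ultimately have "(norm (w' t m - v' t m))\<^sup>2 + ((real m)\<^sup>2)\<^sup>2 * (norm (w t m - v t m))\<^sup>2 \<le> 0"
      using mode_energy_ge[OF \<rho>, of "w' t m - v' t m" "(real m)\<^sup>2" "w t m - v t m"]
      by (meson mult_nonneg_nonpos order_trans)
    then have "((real m)\<^sup>2)\<^sup>2 * (norm (w t m - v t m))\<^sup>2 \<le> 0"
      by (smt (verit) zero_le_power2)
    then show ?thesis using m by (simp add: mult_le_0_iff)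
  qed
qed

section \<open>Existence and bounds for the forced problem\<close>

text \<open>The three factors are the constant of equivalence of the two energies, the growth caused by the
coupling, and the weights of initial energy and force.\<close>

definition energy_constant :: "real \<Rightarrow> real \<Rightarrow> real \<Rightarrow> real" where
  "energy_constant T \<rho> a = (2 + 3 / (1 - \<rho>\<^sup>2 / 4)) * exp (a / sqrt (1 - \<rho>\<^sup>2 / 4) * T) * (3 + 1 / \<rho>)"

lemma energy_constant_nonneg:
  assumes "0 < \<rho>" "\<rho> < 2" shows "0 \<le> energy_constant T \<rho> a"
  using power_strict_mono[of \<rho> 2 2] assms by (simp add: energy_constant_def)

text \<open>The energy bound multiplied by \<open>q\<close>, which turns \<open>\<parallel>w\<parallel>\<^sup>2 + q\<^sup>2 \<parallel>v\<parallel>\<^sup>2\<close> into the terms of the norms of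
\<open>X\<^sup>1\<close> and \<open>X\<^sup>3\<close> and cancels the factor \<open>1 / q\<close> of the force, so that \<open>h\<^sup>2\<close> is left. For \<open>h = x\<^sub>m\<close> this
is summable.\<close>

lemma damped_mode_weighted_bound:
  fixes A :: "'a::euclidean_space \<Rightarrow> 'a"
  assumes \<rho>: "0 < \<rho>" "\<rho> < 2" and q: "1 \<le> q" and A: "bounded_linear A"
    and F: "set_integrable lborel {0..T} F" and F2: "set_integrable lborel {0..T} (\<lambda>t. (norm (F t))\<^sup>2)"
    and m: "damped_mode T \<rho> q A (\<lambda>t. - (h *\<^sub>R F t)) v w" and t: "t \<in> {0..T}"
  shows "q ^ 3 * (norm (v t))\<^sup>2 + q * (norm (w t))\<^sup>2 \<le> energy_constant T \<rho> (onorm A) *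
    (q ^ 3 * (norm (v 0))\<^sup>2 + q * (norm (w 0))\<^sup>2 + h\<^sup>2 * integral {0..T} (\<lambda>t. (norm (F t))\<^sup>2))"
proof -
  let ?k = "2 + 3 / (1 - \<rho>\<^sup>2 / 4)" and ?e = "exp (onorm A / sqrt (1 - \<rho>\<^sup>2 / 4) * T)"
  let ?N = "integral {0..T} (\<lambda>t. (norm (F t))\<^sup>2)"
  let ?E0 = "(norm (w 0))\<^sup>2 + q\<^sup>2 * (norm (v 0))\<^sup>2"
  have alg1: "q * (c * (d * (3 * E + X / (\<rho> * q)))) = c * d * (3 * (q * E) + (1 / \<rho>) * X)" for c d E X :: real
    using q \<rho> by (simp add: field_simps)
  have alg2: "c * d * (r * x + r * y) = c * d * r * (x + y)" for c d r x y :: real by (simp add: algebra_simps)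
  have alg3: "q * (x + q\<^sup>2 * y) = q ^ 3 * y + q * x" for x y :: real
    by (simp add: algebra_simps power3_eq_cube power2_eq_square)
  have k: "0 \<le> ?k" using power_strict_mono[of \<rho> 2 2] \<rho> by simp
  have N: "0 \<le> ?N"
    using set_borel_integral_eq_integral(1)[OF F2] by (intro Henstock_Kurzweil_Integration.integral_nonneg) auto
  have G: "set_integrable lborel {0..T} (\<lambda>t. - (h *\<^sub>R F t))"
    using set_integrable_scaleR_right[of "- h", OF F] by simp
  have n2: "(norm (- (h *\<^sub>R F t)))\<^sup>2 = h\<^sup>2 * (norm (F t))\<^sup>2" for t by (simp add: power_mult_distrib)
  have G2: "set_integrable lborel {0..T} (\<lambda>t. (norm (- (h *\<^sub>R F t)))\<^sup>2)"
    unfolding n2 using set_integrable_mult_right[OF F2] by simp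
  have "(norm (w t))\<^sup>2 + q\<^sup>2 * (norm (v t))\<^sup>2 \<le> ?k * mode_energy \<rho> q (v t) (w t)"
    by (rule mode_energy_ge[OF \<rho>])
  also have "\<dots> \<le> ?k * (?e * (mode_energy \<rho> q (v 0) (w 0) + integral {0..T} (\<lambda>t. (norm (- (h *\<^sub>R F t)))\<^sup>2) / (\<rho> * q)))"
    by (intro mult_left_mono k damped_mode_energy_bound[OF \<rho> q A onorm_pos_le[OF A] _ G G2 m t])
      (use onorm[OF A] in auto)
  also have "\<dots> \<le> ?k * (?e * (3 * ?E0 + h\<^sup>2 * ?N / (\<rho> * q)))"
    unfolding n2 using k mode_energy_le[OF \<rho>, of q "v 0" "w 0"]
    by (intro mult_left_mono add_mono) auto
  finally have "q * ((norm (w t))\<^sup>2 + q\<^sup>2 * (norm (v t))\<^sup>2) \<le> q * (?k * (?e * (3 * ?E0 + h\<^sup>2 * ?N / (\<rho> * q))))"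
    using q by (intro mult_left_mono) auto
  also have "\<dots> = ?k * ?e * (3 * (q * ?E0) + (1 / \<rho>) * (h\<^sup>2 * ?N))"
    by (rule alg1)
  also have "\<dots> \<le> ?k * ?e * ((3 + 1 / \<rho>) * (q * ?E0) + (3 + 1 / \<rho>) * (h\<^sup>2 * ?N))"
    using k q \<rho> N by (intro mult_left_mono add_mono mult_right_mono) auto
  also have "\<dots> = energy_constant T \<rho> (onorm A) * (q * ?E0 + h\<^sup>2 * ?N)"
    unfolding energy_constant_def by (rule alg2)
  also have "q * ?E0 = q ^ 3 * (norm (v 0))\<^sup>2 + q * (norm (w 0))\<^sup>2" by (rule alg3)
  also have "q * ((norm (w t))\<^sup>2 + q\<^sup>2 * (norm (v t))\<^sup>2) = q ^ 3 * (norm (v t))\<^sup>2 + q * (norm (w t))\<^sup>2" by (rule alg3)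
  finally show ?thesis .
qed

lemma set_borel_measurable_continuous:
  fixes v :: "real \<Rightarrow> 'a::euclidean_space"
  assumes "continuous_on {0..T} v"
  shows "set_borel_measurable lborel {0<..<T} v"
  using set_integral_open_eq_integral(1)[OF borel_integrable_atLeastAtMost'[OF assms]]
  by (auto simp: set_borel_measurable_def set_integrable_def)

text \<open>The modes are solved separately. The bound for a mode is uniform in \<open>t\<close>, and its sum over \<open>m\<close> is \<open>S\<close>;
this majorant gives membership, continuity and differentiability in the spaces as well as the
estimates. The bound for \<open>v''\<close> is read off the equation, whose leading terms in \<open>v\<close> and \<open>v'\<close> lose
four and two derivatives, exactly those between \<open>X\<^sup>3\<close>, \<open>X\<^sup>1\<close> and \<open>X\<^sup>-\<^sup>1\<close>.\<close>

lemma forced_solution_exists: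
  fixes A :: "complex^'n^'n" and B :: "complex^'l^'n"
  assumes T: "0 < T" and \<rho>: "0 < \<rho>" "\<rho> < 2" and u0: "u0 \<in> Xspace 3" and u1: "u1 \<in> Xspace 1"
    and F: "set_integrable lborel {0..T} F" and F2: "set_integrable lborel {0..T} (\<lambda>t. (norm (F t))\<^sup>2)"
    and Feq: "\<And>t. t \<in> {0<..<T} \<Longrightarrow> F t = B *v f'' t + (A ** B) *v f t"
  defines "H \<equiv> infsum (\<lambda>m. (hcoef m)\<^sup>2) {1..}" and "N \<equiv> integral {0..T} (\<lambda>t. (norm (F t))\<^sup>2)"
  defines "S \<equiv> energy_constant T \<rho> (onorm ((*v) A)) * ((Xnorm 3 u0)\<^sup>2 + (Xnorm 1 u1)\<^sup>2 + H * N)"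
  obtains v v' v'' where "solution T \<rho> A B f f'' u0 u1 v v' v''"
    and "\<And>t. t \<in> {0..T} \<Longrightarrow> (Xnorm 3 (v t))\<^sup>2 \<le> S" and "\<And>t. t \<in> {0..T} \<Longrightarrow> (Xnorm 1 (v' t))\<^sup>2 \<le> S"
    and "(L2Xnorm T (-1) v'')\<^sup>2 \<le> 4 * H * N + 4 * (\<rho>\<^sup>2 + 1 + (onorm ((*v) A))\<^sup>2) * S * T"
proof -
  let ?A = "(*v) A" and ?q = "\<lambda>m::nat. (real m)\<^sup>2" and ?G = "\<lambda>m t. - (hcoef m *\<^sub>R F t)"
  let ?K = "energy_constant T \<rho> (onorm ?A)"
  have A: "bounded_linear ?A" by simp
  have G: "set_integrable lborel {0..T} (?G m)" for m
    using set_integrable_scaleR_right[of "- hcoef m", OF F] by simp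
  have "\<exists>V W. damped_mode T \<rho> (?q m) ?A (?G m) V W \<and> V 0 = u0 m \<and> W 0 = u1 m" for m
    by (rule damped_mode_exists[OF A less_imp_le[OF T] G]) blast
  then obtain V W where mode: "\<And>m. damped_mode T \<rho> (?q m) ?A (?G m) (V m) (W m)"
    and init: "\<And>m. V m 0 = u0 m" "\<And>m. W m 0 = u1 m" by metis
  define v where "v t m = (if m = 0 then 0 else V m t)" for t and m :: nat
  define v' where "v' t m = (if m = 0 then 0 else W m t)" for t and m :: nat
  define v'' where "v'' t m = (if m = 0 then 0 else
     ?G m t - (\<rho> * ?q m) *\<^sub>R W m t - (?q m)\<^sup>2 *\<^sub>R V m t - A *v V m t)" for t and m :: nat
  \<comment> \<open>A bound at all times for what the mode \<open>m\<close> adds to the squared norms of \<open>v\<close> in \<open>X\<^sup>3\<close> and of \<open>v'\<close> in \<open>X\<^sup>1\<close>.\<close>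
  define D where "D m = ?K * (real m powr (2 * 3) * (norm (u0 m))\<^sup>2 + real m powr (2 * 1) * (norm (u1 m))\<^sup>2 + (hcoef m)\<^sup>2 * N)" for m
  have zero: "v t 0 = 0" "v' t 0 = 0" "v'' t 0 = 0" for t by (simp_all add: v_def v'_def v''_def)
  have D: "D summable_on {1..}" and Dsum: "infsum D {1..} = S"
  proof -
    have s: "(\<lambda>m. real m powr (2 * 3) * (norm (u0 m))\<^sup>2 + real m powr (2 * 1) * (norm (u1 m))\<^sup>2) summable_on {1..}"
      "(\<lambda>m. (hcoef m)\<^sup>2 * N) summable_on {1..}"
      by (intro summable_on_add summable_on_cmult_left hcoef_sq_summable Xspace_summable(1) u0 u1)+
    show "D summable_on {1..}" unfolding D_def by (intro summable_on_cmult_right summable_on_add[OF s])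
    have "infsum D {1..} = ?K * infsum (\<lambda>m. real m powr (2 * 3) * (norm (u0 m))\<^sup>2 + real m powr (2 * 1) * (norm (u1 m))\<^sup>2 + (hcoef m)\<^sup>2 * N) {1..}"
      unfolding D_def by (rule infsum_cmult_right) (rule summable_on_add[OF s])
    also have "infsum (\<lambda>m. real m powr (2 * 3) * (norm (u0 m))\<^sup>2 + real m powr (2 * 1) * (norm (u1 m))\<^sup>2 + (hcoef m)\<^sup>2 * N) {1..}
      = (Xnorm 3 u0)\<^sup>2 + (Xnorm 1 u1)\<^sup>2 + H * N"
      unfolding infsum_add[OF s] infsum_add[OF Xspace_summable(1)[OF u0] Xspace_summable(1)[OF u1]]
        Xspace_summable(2)[OF u0] Xspace_summable(2)[OF u1] H_def infsum_cmult_left[OF hcoef_sq_summable] ..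
    finally show "infsum D {1..} = S" by (simp add: S_def)
  qed
  have bound: "?q m ^ 3 * (norm (V m t))\<^sup>2 + ?q m * (norm (W m t))\<^sup>2 \<le> D m" if "t \<in> {0..T}" "1 \<le> m" for t m
    using damped_mode_weighted_bound[OF \<rho> _ A F F2 mode[of m] that(1)] that(2)
    by (simp add: D_def sobolev_weight init N_def)
  have qpos: "0 < ?q m" "1 \<le> ?q m" if "1 \<le> m" for m using that by simp_all
  have bV: "?q m ^ 3 * (norm (V m t))\<^sup>2 \<le> D m" if "t \<in> {0..T}" "1 \<le> m" for t m
  proof -
    have "0 \<le> ?q m * (norm (W m t))\<^sup>2" by simp
    with bound[OF that] show ?thesis by linarith
  qed
  have bW: "?q m * (norm (W m t))\<^sup>2 \<le> D m" if "t \<in> {0..T}" "1 \<le> m" for t m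
  proof -
    have "0 \<le> ?q m ^ 3 * (norm (V m t))\<^sup>2" by simp
    with bound[OF that] show ?thesis by linarith
  qed
  have bv: "real m powr (2 * 3) * (norm (v t m))\<^sup>2 \<le> D m" if "t \<in> {0..T}" "1 \<le> m" for t m
    using bV[OF that] that(2) unfolding sobolev_weight(1)[OF that(2)] by (simp add: v_def)
  have bv1: "real m powr (2 * 1) * (norm (v' t m))\<^sup>2 \<le> D m" if "t \<in> {0..T}" "1 \<le> m" for t m
    using bW[OF that] that(2) unfolding sobolev_weight(2)[OF that(2)] by (simp add: v'_def)
  have cV: "continuous_on {0..T} (V m)" and cW: "continuous_on {0..T} (W m)" for m
    using mode unfolding damped_mode_def by blast+
  have cv: "continuous_on {0..T} (\<lambda>t. v t m)" and cv': "continuous_on {0..T} (\<lambda>t. v' t m)" for m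
    using cV cW by (cases "m = 0"; simp add: v_def v'_def)+
  \<comment> \<open>The weight of \<open>X\<^sup>-\<^sup>1\<close> is below the others, as \<open>q \<ge> 1\<close>.\<close>
  have low: "1 / ?q m * (norm z)\<^sup>2 \<le> ?q m ^ 3 * (norm z)\<^sup>2" "1 / ?q m * (norm z)\<^sup>2 \<le> ?q m * (norm z)\<^sup>2"
    if "1 \<le> m" for m and z :: "complex^'n"
  proof -
    have "1 / ?q m \<le> 1" using qpos[OF that] by simp
    then show "1 / ?q m * (norm z)\<^sup>2 \<le> ?q m ^ 3 * (norm z)\<^sup>2" "1 / ?q m * (norm z)\<^sup>2 \<le> ?q m * (norm z)\<^sup>2"
      using qpos(2)[OF that] one_le_power[of "?q m" 3] by (intro mult_right_mono; simp)+
  qed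
  have C3: "C0X T 3 v" by (rule C0X_dominated[OF _ bv D]) (rule cv | simp add: v_def)+
  have bv_low: "real m powr (2 * 1) * (norm (v t m))\<^sup>2 \<le> D m" if "t \<in> {0..T}" "1 \<le> m" for t m
  proof -
    have "?q m * (norm (V m t))\<^sup>2 \<le> ?q m ^ 3 * (norm (V m t))\<^sup>2"
      using power_increasing[of 1 3 "?q m"] qpos(2)[OF that(2)] by (intro mult_right_mono) auto
    then show ?thesis using bV[OF that] that(2) unfolding sobolev_weight(2)[OF that(2)] by (simp add: v_def)
  qed
  have C1: "C1X T 1 v v'"
  proof (rule C1X_dominated[OF _ _ bv1 D])
    show "C0X T 1 v" by (rule C0X_dominated[OF _ bv_low D]) (rule cv | simp add: v_def)+
    show "((\<lambda>t. v t m) has_vector_derivative v' t m) (at t within {0..T})" if "t \<in> {0..T}" "1 \<le> m" for t m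
      using damped_mode_derivative[OF mode[of m] that(1)] that(2) by (simp add: v_def v'_def)
  qed (rule cv' | simp add: v'_def)+
  have iS: "set_integrable lborel {0<..<T} (\<lambda>_. S)"
    by (rule set_integral_open_eq_integral(1)[OF borel_integrable_atLeastAtMost'[OF continuous_on_const]])
  have L2v: "L2X T (-1) v"
  proof (rule L2X_dominated(1)[where \<phi>="\<lambda>_. S"])
    fix t assume "t \<in> {0<..<T}"
    then have t: "t \<in> {0..T}" by simp
    have "real m powr (2 * (-1)) * (norm (v t m))\<^sup>2 \<le> D m" if m: "1 \<le> m" for m
      unfolding sobolev_weight(3)[OF m] using order_trans[OF low(1)[OF m] bV[OF t m]] m by (simp add: v_def)
    from Xspace_dominated[where y="v t", OF zero(1) this D] show "v t \<in> Xspace (-1)" "(Xnorm (-1) (v t))\<^sup>2 \<le> S"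
      unfolding Dsum by blast+
  qed (rule iS set_borel_measurable_continuous[OF cv])+
  have L2v': "L2X T (-1) v'"
  proof (rule L2X_dominated(1)[where \<phi>="\<lambda>_. S"])
    fix t assume "t \<in> {0<..<T}"
    then have t: "t \<in> {0..T}" by simp
    have "real m powr (2 * (-1)) * (norm (v' t m))\<^sup>2 \<le> D m" if m: "1 \<le> m" for m
      unfolding sobolev_weight(3)[OF m] using order_trans[OF low(2)[OF m] bW[OF t m]] m by (simp add: v'_def)
    from Xspace_dominated[where y="v' t", OF zero(2) this D] show "v' t \<in> Xspace (-1)" "(Xnorm (-1) (v' t))\<^sup>2 \<le> S"
      unfolding Dsum by blast+
  qed (rule iS set_borel_measurable_continuous[OF cv'])+
  have iR: "set_integrable lborel {0..T} (\<lambda>t. v'' t m)" if "1 \<le> m" for m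
    using damped_mode_rhs_integrable[OF A G[of m] cV[of m] cW[of m], of \<rho> "?q m"] that by (simp add: v''_def)
  let ?P = "\<rho>\<^sup>2 + 1 + (onorm ?A)\<^sup>2"
  have b2: "real m powr (2 * (-1)) * (norm (v'' t m))\<^sup>2 \<le> 4 * (norm (F t))\<^sup>2 * (hcoef m)\<^sup>2 + 4 * ?P * D m"
    if t: "t \<in> {0..T}" and m: "1 \<le> m" for t m
  proof -
    let ?a = "?G m t" and ?b = "(\<rho> * ?q m) *\<^sub>R W m t" and ?c = "(?q m)\<^sup>2 *\<^sub>R V m t" and ?d = "A *v V m t"
    have q: "0 < ?q m" "1 \<le> ?q m" by (rule qpos[OF m])+
    have alg: "1 / p * (4 * (X + r * p\<^sup>2 * Y + p ^ 4 * Z + d * Z)) = 4 * (1 / p * X + r * (p * Y) + p ^ 3 * Z + d * (1 / p * Z))"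
      if "0 < p" for p r d X Y Z :: real
      using that by (simp add: field_simps power2_eq_square power3_eq_cube power4_eq_xxxx)
    have "(norm (v'' t m))\<^sup>2 = (norm ((?a - ?b) - (?c + ?d)))\<^sup>2" using m by (simp add: v''_def algebra_simps)
    also have "\<dots> \<le> 2 * (norm (?a - ?b))\<^sup>2 + 2 * (norm (?c + ?d))\<^sup>2" by (rule norm_diff_sq_le)
    also have "\<dots> \<le> 2 * (2 * (norm ?a)\<^sup>2 + 2 * (norm ?b)\<^sup>2) + 2 * (2 * (norm ?c)\<^sup>2 + 2 * (norm ?d)\<^sup>2)"
      by (intro add_mono mult_left_mono norm_diff_sq_le norm_add_sq_le) auto
    also have "\<dots> \<le> 4 * ((hcoef m)\<^sup>2 * (norm (F t))\<^sup>2 + \<rho>\<^sup>2 * (?q m)\<^sup>2 * (norm (W m t))\<^sup>2 + ?q m ^ 4 * (norm (V m t))\<^sup>2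
        + (onorm ?A)\<^sup>2 * (norm (V m t))\<^sup>2)"
      using norm_sq_le_onorm[OF A, of "V m t"] by (simp add: power_mult_distrib flip: power_mult)
    finally have "1 / ?q m * (norm (v'' t m))\<^sup>2 \<le> 1 / ?q m * (4 * ((hcoef m)\<^sup>2 * (norm (F t))\<^sup>2 + \<rho>\<^sup>2 * (?q m)\<^sup>2 * (norm (W m t))\<^sup>2
        + ?q m ^ 4 * (norm (V m t))\<^sup>2 + (onorm ?A)\<^sup>2 * (norm (V m t))\<^sup>2))"
      using q by (intro mult_left_mono) auto
    also have "\<dots> = 4 * (1 / ?q m * ((hcoef m)\<^sup>2 * (norm (F t))\<^sup>2) + \<rho>\<^sup>2 * (?q m * (norm (W m t))\<^sup>2)
        + ?q m ^ 3 * (norm (V m t))\<^sup>2 + (onorm ?A)\<^sup>2 * (1 / ?q m * (norm (V m t))\<^sup>2))"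
      by (rule alg[OF q(1)])
    also have "\<dots> \<le> 4 * (1 * ((hcoef m)\<^sup>2 * (norm (F t))\<^sup>2) + \<rho>\<^sup>2 * D m + D m + (onorm ?A)\<^sup>2 * D m)"
      using q by (intro add_mono mult_left_mono mult_right_mono bW bV t m order_trans[OF low(1)[OF m]]) auto
    finally show ?thesis unfolding sobolev_weight(3)[OF m] by (simp add: algebra_simps)
  qed
  have b2sum: "(\<lambda>m. 4 * (norm (F t))\<^sup>2 * (hcoef m)\<^sup>2 + 4 * ?P * D m) summable_on {1..}"
    "infsum (\<lambda>m. 4 * (norm (F t))\<^sup>2 * (hcoef m)\<^sup>2 + 4 * ?P * D m) {1..} = 4 * H * (norm (F t))\<^sup>2 + 4 * ?P * S" for t
  proof -
    have s: "(\<lambda>m. 4 * (norm (F t))\<^sup>2 * (hcoef m)\<^sup>2) summable_on {1..}" "(\<lambda>m. 4 * ?P * D m) summable_on {1..}"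
      by (intro summable_on_cmult_right D hcoef_sq_summable)+
    show "(\<lambda>m. 4 * (norm (F t))\<^sup>2 * (hcoef m)\<^sup>2 + 4 * ?P * D m) summable_on {1..}" by (rule summable_on_add[OF s])
    show "infsum (\<lambda>m. 4 * (norm (F t))\<^sup>2 * (hcoef m)\<^sup>2 + 4 * ?P * D m) {1..} = 4 * H * (norm (F t))\<^sup>2 + 4 * ?P * S"
      unfolding infsum_add[OF s] infsum_cmult_right[OF D] infsum_cmult_right[OF hcoef_sq_summable] Dsum H_def by simp
  qed
  let ?\<phi> = "\<lambda>t. 4 * H * (norm (F t))\<^sup>2 + 4 * ?P * S"
  have i\<phi>: "set_integrable lborel {0..T} (\<lambda>t. 4 * H * (norm (F t))\<^sup>2)" "set_integrable lborel {0..T} (\<lambda>t. 4 * ?P * S)"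
    using set_integrable_mult_right[OF F2, of "4 * H"] by (auto simp: borel_integrable_atLeastAtMost')
  have \<phi>: "set_integrable lborel {0..T} ?\<phi>" by (rule set_integral_add(1)[OF i\<phi>])
  have L2v'': "L2X T (-1) v''" "(L2Xnorm T (-1) v'')\<^sup>2 \<le> (LINT t:{0<..<T}|lborel. ?\<phi> t)"
  proof -
    have x: "v'' t \<in> Xspace (-1)" "(Xnorm (-1) (v'' t))\<^sup>2 \<le> ?\<phi> t" if "t \<in> {0<..<T}" for t
    proof -
      from that have t: "t \<in> {0..T}" by simp
      show "v'' t \<in> Xspace (-1)" "(Xnorm (-1) (v'' t))\<^sup>2 \<le> ?\<phi> t"
        using Xspace_dominated[where y="v'' t" and s="-1", OF zero(3) b2[OF t] b2sum(1)[of t]] unfolding b2sum(2)[of t] by blast+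
    qed
    have m: "set_borel_measurable lborel {0<..<T} (\<lambda>t. v'' t m)" if "1 \<le> m" for m
      using set_integral_open_eq_integral(1)[OF iR[OF that]] by (auto simp: set_borel_measurable_def set_integrable_def)
    show "L2X T (-1) v''" "(L2Xnorm T (-1) v'')\<^sup>2 \<le> (LINT t:{0<..<T}|lborel. ?\<phi> t)"
      by (rule L2X_dominated[OF x(1) m x(2) set_integral_open_eq_integral(1)[OF \<phi>]]; assumption)+
  qed
  have "(LINT t:{0<..<T}|lborel. ?\<phi> t) = integral {0..T} (\<lambda>t. 4 * H * (norm (F t))\<^sup>2) + integral {0..T} (\<lambda>t. 4 * ?P * S)"
    unfolding set_integral_open_eq_integral(2)[OF \<phi>]
    by (rule Henstock_Kurzweil_Integration.integral_add[OF i\<phi>[THEN set_borel_integral_eq_integral(1)]])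
  also have "\<dots> = 4 * H * N + 4 * ?P * S * T" using T by (simp add: N_def)
  finally have final: "(L2Xnorm T (-1) v'')\<^sup>2 \<le> 4 * H * N + 4 * ?P * S * T" using L2v''(2) by simp
  have wd: "weak_derivX T v v'" "weak_derivX T v' v''"
  proof -
    have "weak_deriv T (\<lambda>t. v t m) (\<lambda>t. v' t m)" if "1 \<le> m" for m
    proof (rule weak_deriv_indefinite_integral[OF T])
      show "set_integrable lborel {0..T} (\<lambda>t. v' t m)" by (rule borel_integrable_atLeastAtMost'[OF cv'])
      show "v t m = V m 0 + integral {0..t} (\<lambda>t. v' t m)" if "t \<in> {0..T}" for t
      proof -
        have "v t m = V m t" "(\<lambda>t. v' t m) = W m" using \<open>1 \<le> m\<close> by (simp_all add: v_def v'_def)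
        moreover have "V m t = V m 0 + integral {0..t} (W m)"
          using mode[of m] that unfolding damped_mode_def by blast
        ultimately show ?thesis by simp
      qed
    qed
    moreover have "weak_deriv T (\<lambda>t. v' t m) (\<lambda>t. v'' t m)" if "1 \<le> m" for m
    proof (rule weak_deriv_indefinite_integral[OF T iR[OF that]])
      show "v' t m = W m 0 + integral {0..t} (\<lambda>t. v'' t m)" if "t \<in> {0..T}" for t
      proof -
        have "v' t m = W m t" "(\<lambda>t. v'' t m) = (\<lambda>t. ?G m t - (\<rho> * ?q m) *\<^sub>R W m t - (?q m)\<^sup>2 *\<^sub>R V m t - A *v V m t)"
          using \<open>1 \<le> m\<close> by (simp_all add: v'_def v''_def)
        moreover have "W m t = W m 0 + integral {0..t} (\<lambda>t. ?G m t - (\<rho> * ?q m) *\<^sub>R W m t - (?q m)\<^sup>2 *\<^sub>R V m t - A *v V m t)"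
          using mode[of m] that unfolding damped_mode_def by blast
        ultimately show ?thesis by (simp only:)
      qed
    qed
    ultimately show "weak_derivX T v v'" "weak_derivX T v' v''" by (auto simp: weak_derivX_def)
  qed
  show thesis
  proof (rule that)
    show "solution T \<rho> A B f f'' u0 u1 v v' v''"
      unfolding solution_def H2X_def
    proof (intro conjI C3 C1 L2v L2v' L2v''(1) wd)
      show "v 0 = u0" "v' 0 = u1" using Xspace_0[OF u0] Xspace_0[OF u1] by (auto simp: v_def v'_def init)
      show "AE t in lborel. t \<in> {0<..<T} \<longrightarrow>
        (\<forall>m\<ge>1. v'' t m + Lop (Lop (v t)) m + \<rho> *\<^sub>R Lop (v' t) m + A *v v t m
           = - (hcoef m *\<^sub>R (B *v f'' t + (A ** B) *v f t)))"
        by (intro AE_I2 impI allI) (simp add: v_def v'_def v''_def Lop_def Feq power2_eq_square)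
    qed
    show "(L2Xnorm T (-1) v'')\<^sup>2 \<le> 4 * H * N + 4 * ?P * S * T" by (rule final)
    fix t assume t: "t \<in> {0..T}"
    show "(Xnorm 3 (v t))\<^sup>2 \<le> S"
      using Xspace_dominated(2)[OF zero(1) bv[OF t] D] unfolding Dsum by blast
    show "(Xnorm 1 (v' t))\<^sup>2 \<le> S"
      using Xspace_dominated(2)[OF zero(2) bv1[OF t] D] unfolding Dsum by blast
  qed
qed

section \<open>Well-posedness and decay of the coefficients\<close>

lemma Xspace_3_summable_norm:
  assumes "y \<in> Xspace 3"
  shows "summable (\<lambda>m. norm (y m))"
proof (rule summable_comparison_test'[where N=0])
  show "summable (\<lambda>m. Xnorm 3 y * inverse ((real m)\<^sup>2))"
    using inverse_power_summable[of 2, where 'a=real] by (intro summable_mult) auto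
  fix m :: nat
  show "norm (norm (y m)) \<le> Xnorm 3 y * inverse ((real m)\<^sup>2)"
  proof (cases "m = 0")
    case True
    then show ?thesis using Xspace_0[OF assms] by simp
  next
    case False
    then have m: "1 \<le> m" by simp
    have "(real m)\<^sup>2 * norm (y m) \<le> real m powr 3 * norm (y m)"
      using m power_increasing[of 2 3 "real m"] by (intro mult_right_mono) auto
    also have "\<dots> \<le> Xnorm 3 y" by (rule norm_le_Xnorm[OF assms m])
    finally show ?thesis using m by (simp add: field_simps)
  qed
qed

lemma bcoef_eq_hprod:
  assumes "v t \<in> Xspace 3" "1 \<le> m"
  shows "bcoef v \<psi> m t = hprod (v t m) \<psi>"
  unfolding bcoef_def by (rule sine_coefficient_of_sum[OF Xspace_3_summable_norm[OF assms(1)] assms(2)])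

lemma H2norm_sq:
  fixes f :: "real \<Rightarrow> complex^'d"
  shows "(H2norm T f f' f'')\<^sup>2 = (LINT t:{0<..<T}|lborel. (norm (f t))\<^sup>2) + (LINT t:{0<..<T}|lborel. (norm (f' t))\<^sup>2)
         + (LINT t:{0<..<T}|lborel. (norm (f'' t))\<^sup>2)"
proof -
  have "0 \<le> (LINT t:{0<..<T}|lborel. (norm (g t))\<^sup>2)" for g :: "real \<Rightarrow> complex^'d"
    unfolding set_lebesgue_integral_def by (intro integral_nonneg_AE AE_I2) auto
  then show ?thesis unfolding H2norm_def by (simp add: add_nonneg_nonneg)
qed

text \<open>All squared norms of the solution are bounded by multiples of the squared sum of the norms of the
data, with factors \<open>K1\<close> and \<open>K2\<close> fixed before the data.\<close>

lemma forced_problem_well_posed: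
  fixes A :: "complex^'n^'n" and B :: "complex^'l^'n"
  assumes T: "0 < T" and \<rho>: "0 < \<rho>" "\<rho> < 2"
  shows "\<exists>C. \<forall>f f' f''. \<forall>u0\<in>Xspace 3. \<forall>u1\<in>Xspace 1. H2 T f f' f'' \<longrightarrow>
        (\<exists>v v' v''. solution T \<rho> A B f f'' u0 u1 v v' v'' \<and>
           (\<forall>w w' w''. solution T \<rho> A B f f'' u0 u1 w w' w'' \<longrightarrow> (\<forall>t\<in>{0..T}. w t = v t)) \<and>
           C0norm T 3 v + C0norm T 1 v' + L2Xnorm T (-1) v''
             \<le> C * (Xnorm 3 u0 + Xnorm 1 u1 + H2norm T f f' f''))"
proof -
  let ?K = "energy_constant T \<rho> (onorm ((*v) A))" and ?P = "\<rho>\<^sup>2 + 1 + (onorm ((*v) A))\<^sup>2"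
  define L where "L = 2 * ((onorm ((*v) B))\<^sup>2 + (onorm ((*v) (A ** B)))\<^sup>2)"
  define H where "H = infsum (\<lambda>m. (hcoef m)\<^sup>2) {1..}"
  define K1 where "K1 = ?K * (1 + H * L)"
  define K2 where "K2 = 4 * H * L + 4 * ?P * K1 * T"
  have pos: "0 \<le> ?K" "0 \<le> L" "0 \<le> H"
    using energy_constant_nonneg[OF \<rho>] by (auto simp: L_def H_def infsum_nonneg)
  show ?thesis
  proof (intro exI[of _ "2 * sqrt K1 + sqrt K2"] allI ballI impI)
    fix f f' f'' :: "real \<Rightarrow> complex^'l" and u0 u1 :: "nat \<Rightarrow> complex^'n"
    assume u0: "u0 \<in> Xspace 3" and u1: "u1 \<in> Xspace 1" and f: "H2 T f f' f''"
    define F where "F t = indicator {0<..<T} t *\<^sub>R (B *v f'' t + (A ** B) *v f t)" for t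
    have L2: "L2 T f" "L2 T f''" using f by (auto simp: H2_def)
    note force = boundary_force_L2[OF L2, of B A, folded F_def L_def]
    have Feq: "F t = B *v f'' t + (A ** B) *v f t" if "t \<in> {0<..<T}" for t using that by (simp add: F_def)
    let ?N = "integral {0..T} (\<lambda>t. (norm (F t))\<^sup>2)"
    let ?x = "Xnorm 3 u0" and ?y = "Xnorm 1 u1" and ?h = "H2norm T f f' f''"
    let ?S = "?K * (?x\<^sup>2 + ?y\<^sup>2 + H * ?N)" and ?s = "?x + ?y + ?h"
    obtain v v' v'' where sol: "solution T \<rho> A B f f'' u0 u1 v v' v''"
      and bv: "\<And>t. t \<in> {0..T} \<Longrightarrow> (Xnorm 3 (v t))\<^sup>2 \<le> ?S" and bv': "\<And>t. t \<in> {0..T} \<Longrightarrow> (Xnorm 1 (v' t))\<^sup>2 \<le> ?S"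
      and bv'': "(L2Xnorm T (-1) v'')\<^sup>2 \<le> 4 * H * ?N + 4 * ?P * ?S * T"
    proof (rule forced_solution_exists[OF T \<rho> u0 u1 force(1,2), folded H_def])
      show "F t = B *v f'' t + (A ** B) *v f t" if "t \<in> {0<..<T}" for t by (rule Feq[OF that])
    qed (rule that; blast)
    have nn: "0 \<le> ?x" "0 \<le> ?y" "0 \<le> ?h"
      using Xnorm_nonneg by (auto simp: H2norm_def set_lebesgue_integral_def intro!: add_nonneg_nonneg integral_nonneg_AE)
    have sq: "?x\<^sup>2 + ?y\<^sup>2 + ?h\<^sup>2 \<le> ?s\<^sup>2"
      using nn by (simp add: power2_eq_square algebra_simps add_nonneg_nonneg)
    then have h: "?h\<^sup>2 \<le> ?s\<^sup>2" by (smt (verit) zero_le_power2)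
    have N: "?N \<le> L * ?h\<^sup>2"
    proof -
      have "0 \<le> (LINT t:{0<..<T}|lborel. (norm (f' t))\<^sup>2)"
        unfolding set_lebesgue_integral_def by (intro integral_nonneg_AE AE_I2) auto
      then show ?thesis unfolding H2norm_sq using force(3) pos(2)
        by (elim order_trans) (intro mult_left_mono, auto)
    qed
    have HN: "H * ?N \<le> H * L * ?s\<^sup>2"
      using mult_left_mono[OF order_trans[OF N mult_left_mono[OF h pos(2)]] pos(3)] by (simp add: mult.assoc)
    have S: "?S \<le> K1 * ?s\<^sup>2"
    proof -
      have "?x\<^sup>2 + ?y\<^sup>2 + H * ?N \<le> (1 + H * L) * ?s\<^sup>2"
        using sq HN zero_le_power2[of ?h] unfolding distrib_right mult_1_left by linarith
      from mult_left_mono[OF this pos(1)] show ?thesis by (simp add: K1_def mult.assoc)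
    qed
    have "(L2Xnorm T (-1) v'')\<^sup>2 \<le> 4 * (H * L * ?s\<^sup>2) + 4 * ?P * (K1 * ?s\<^sup>2) * T"
      using T by (intro order_trans[OF bv''] add_mono mult_right_mono mult_left_mono S) (use HN in auto)
    also have "\<dots> = K2 * ?s\<^sup>2" by (simp add: K2_def algebra_simps)
    finally have 3: "L2Xnorm T (-1) v'' \<le> sqrt K2 * ?s"
      using nn real_le_rsqrt by (fastforce simp: real_sqrt_mult)
    have le: "z \<le> sqrt K1 * ?s" if "z\<^sup>2 \<le> ?S" for z
    proof -
      have "z \<le> sqrt (K1 * ?s\<^sup>2)" by (rule real_le_rsqrt) (rule order_trans[OF that S])
      then show ?thesis using nn by (simp add: real_sqrt_mult)
    qed
    have 1: "C0norm T 3 v \<le> sqrt K1 * ?s" "C0norm T 1 v' \<le> sqrt K1 * ?s"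
      unfolding C0norm_def by (rule cSUP_least; use T le[OF bv] le[OF bv'] in auto)+
    show "\<exists>v v' v''. solution T \<rho> A B f f'' u0 u1 v v' v'' \<and>
           (\<forall>w w' w''. solution T \<rho> A B f f'' u0 u1 w w' w'' \<longrightarrow> (\<forall>t\<in>{0..T}. w t = v t)) \<and>
           C0norm T 3 v + C0norm T 1 v' + L2Xnorm T (-1) v'' \<le> (2 * sqrt K1 + sqrt K2) * ?s"
    proof (intro exI conjI allI impI ballI)
      show "solution T \<rho> A B f f'' u0 u1 v v' v''" by (rule sol)
      show "w t = v t" if "solution T \<rho> A B f f'' u0 u1 w w' w''" "t \<in> {0..T}" for w w' w'' t
        by (rule solution_unique[OF T \<rho> force(1) Feq sol that])
      show "C0norm T 3 v + C0norm T 1 v' + L2Xnorm T (-1) v'' \<le> (2 * sqrt K1 + sqrt K2) * ?s"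
        using 1 3 by (simp add: distrib_right)
    qed
  qed
qed

text \<open>The two constants of equivalence of the energies (one at each end of the time interval) and the
growth caused by the coupling.\<close>

definition decay_constant :: "real \<Rightarrow> real \<Rightarrow> real \<Rightarrow> real" where
  "decay_constant T \<rho> a = 3 * (2 + 3 / (1 - \<rho>\<^sup>2 / 4)) * exp (a / sqrt (1 - \<rho>\<^sup>2 / 4) * T)"

text \<open>The energy decays like \<open>exp (- (\<rho> q - c) T)\<close> with \<open>c\<close> independent of \<open>q\<close>; the weight \<open>exp (\<eta> q T)\<close>
with \<open>\<eta> \<le> \<rho>\<close> leaves at most the factor \<open>exp (c T)\<close>.\<close>

lemma damped_mode_weighted_decay:
  fixes A :: "'a::euclidean_space \<Rightarrow> 'a"
  assumes T: "0 \<le> T" and \<rho>: "0 < \<rho>" "\<rho> < 2" and \<eta>: "\<eta> \<le> \<rho>" and q: "1 \<le> q" and A: "bounded_linear A"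
    and m: "damped_mode T \<rho> q A (\<lambda>_. 0) v w"
  shows "exp (\<eta> * q * T) * (q ^ 3 * (norm (v T))\<^sup>2 + q * (norm (w T))\<^sup>2)
    \<le> decay_constant T \<rho> (onorm A) * (q ^ 3 * (norm (v 0))\<^sup>2 + q * (norm (w 0))\<^sup>2)"
proof -
  let ?k = "2 + 3 / (1 - \<rho>\<^sup>2 / 4)" and ?c = "onorm A / sqrt (1 - \<rho>\<^sup>2 / 4)"
  let ?I = "(norm (w 0))\<^sup>2 + q\<^sup>2 * (norm (v 0))\<^sup>2" and ?M = "mode_energy \<rho> q (v 0) (w 0)"
  have alg: "q * (x + q\<^sup>2 * y) = q ^ 3 * y + q * x" for x y :: real
    by (simp add: algebra_simps power3_eq_cube power2_eq_square)
  have r: "\<rho>\<^sup>2 < 4" using power_strict_mono[of \<rho> 2 2] \<rho> by simp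
  then have k: "0 \<le> ?k" by simp
  have E: "0 \<le> ?M" using r by (simp add: mode_energy_def)
  have "(norm (w T))\<^sup>2 + q\<^sup>2 * (norm (v T))\<^sup>2 \<le> ?k * mode_energy \<rho> q (v T) (w T)"
    by (rule mode_energy_ge[OF \<rho>])
  also have "\<dots> \<le> ?k * (exp ((?c - \<rho> * q) * T) * ?M)"
    using T onorm[OF A] by (intro mult_left_mono k damped_mode_energy_decay[OF \<rho> q A onorm_pos_le[OF A] _ m]) auto
  finally have "exp (\<eta> * q * T) * ((norm (w T))\<^sup>2 + q\<^sup>2 * (norm (v T))\<^sup>2)
      \<le> exp (\<eta> * q * T) * (?k * (exp ((?c - \<rho> * q) * T) * ?M))"
    by (intro mult_left_mono) auto
  also have "\<dots> = ?k * (exp (\<eta> * q * T) * exp ((?c - \<rho> * q) * T)) * ?M" by (simp only: mult_ac)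
  also have "\<dots> \<le> ?k * exp (?c * T) * ?M"
  proof (intro mult_right_mono mult_left_mono k E)
    have "\<eta> * q * T \<le> \<rho> * q * T" using \<eta> q T by (intro mult_right_mono) auto
    then show "exp (\<eta> * q * T) * exp ((?c - \<rho> * q) * T) \<le> exp (?c * T)"
      by (simp add: algebra_simps flip: exp_add)
  qed
  also have "\<dots> \<le> ?k * exp (?c * T) * (3 * ?I)"
    by (rule mult_left_mono[OF mode_energy_le[OF \<rho>]]) (use k in simp)
  finally have "exp (\<eta> * q * T) * ((norm (w T))\<^sup>2 + q\<^sup>2 * (norm (v T))\<^sup>2) \<le> decay_constant T \<rho> (onorm A) * ?I"
    by (simp only: decay_constant_def mult_ac)
  then have "q * (exp (\<eta> * q * T) * ((norm (w T))\<^sup>2 + q\<^sup>2 * (norm (v T))\<^sup>2)) \<le> q * (decay_constant T \<rho> (onorm A) * ?I)"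
    using q by (intro mult_left_mono) auto
  then have "exp (\<eta> * q * T) * (q * ((norm (w T))\<^sup>2 + q\<^sup>2 * (norm (v T))\<^sup>2)) \<le> decay_constant T \<rho> (onorm A) * (q * ?I)"
    by (simp only: mult_ac)
  then show ?thesis unfolding alg .
qed

text \<open>Since \<open>b\<^sub>m = \<langle>v\<^sub>m, \<psi>\<rangle>\<close> and \<open>b\<^sub>m' = \<langle>v\<^sub>m', \<psi>\<rangle>\<close>, the decay of the vector modes passes to the scalar
coefficients by the Cauchy-Schwarz inequality.\<close>

lemma free_solution_coefficient_decay:
  fixes A :: "complex^'n^'n" and B :: "complex^'l^'n" and \<psi> :: "complex^'n"
  assumes T: "0 < T" and \<rho>: "0 < \<rho>" "\<rho> < 2" and \<eta>: "\<eta> \<le> \<rho>" and u0: "u0 \<in> Xspace 3" and u1: "u1 \<in> Xspace 1"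
    and sol: "solution T \<rho> A B (\<lambda>_. 0) (\<lambda>_. 0) u0 u1 v v' v''"
  defines "a \<equiv> \<lambda>m. exp (\<eta> * (real m)\<^sup>2 * T) * ((real m)^6 * (cmod (bcoef v \<psi> m T))\<^sup>2
      + (real m)\<^sup>2 * (cmod (vector_derivative (bcoef v \<psi> m) (at T within {0..T})))\<^sup>2)"
  shows "a summable_on {1..}"
    and "infsum a {1..} \<le> decay_constant T \<rho> (onorm ((*v) A)) * (norm \<psi>)\<^sup>2 * (Xnorm 3 u0 + Xnorm 1 u1)\<^sup>2"
proof -
  let ?D = "decay_constant T \<rho> (onorm ((*v) A)) * (norm \<psi>)\<^sup>2"
  let ?e = "\<lambda>m. real m powr (2 * 3) * (norm (u0 m))\<^sup>2 + real m powr (2 * 1) * (norm (u1 m))\<^sup>2"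
  have D: "0 \<le> ?D" using power_strict_mono[of \<rho> 2 2] \<rho> by (simp add: decay_constant_def)
  have X3: "v t \<in> Xspace 3" if "t \<in> {0..T}" for t using sol that by (auto simp: solution_def C0X_def)
  have C1: "C1X T 1 v v'" using sol by (simp add: solution_def)
  have hp: "(cmod (hprod x \<psi>))\<^sup>2 \<le> (norm \<psi>)\<^sup>2 * (norm x)\<^sup>2" for x
    using power_mono[OF norm_hprod_le[of x \<psi>], of 2] by (simp add: power_mult_distrib mult.commute)
  have bound: "a m \<le> ?D * ?e m" if m: "1 \<le> m" for m
  proof -
    let ?q = "(real m)\<^sup>2"
    have b: "bcoef v \<psi> m t = hprod (v t m) \<psi>" if "t \<in> {0..T}" for t
      by (rule bcoef_eq_hprod[of v t m, OF X3[OF that] m])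
    have "((\<lambda>t. hprod (v t m) \<psi>) has_vector_derivative hprod (v' T m) \<psi>) (at T within {0..T})"
      using T by (intro bounded_linear.has_vector_derivative[OF bounded_linear_hprod_left] C1X_derivative_mode[OF C1 m]) auto
    then have "(bcoef v \<psi> m has_vector_derivative hprod (v' T m) \<psi>) (at T within {0..T})"
      by (rule has_vector_derivative_transform[rotated 2]) (use T b in auto)
    then have db: "vector_derivative (bcoef v \<psi> m) (at T within {0..T}) = hprod (v' T m) \<psi>"
      using vector_derivative_within_cbox[of 0 T T] T by (simp add: cbox_interval)
    have mode: "damped_mode T \<rho> ?q ((*v) A) (\<lambda>_. 0) (\<lambda>t. v t m) (\<lambda>t. v' t m)"
      using solution_damped_mode[OF T sol m, of "\<lambda>_. 0"] by (simp add: set_integrable_def)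
    have "a m \<le> exp (\<eta> * ?q * T) * (?q ^ 3 * ((norm \<psi>)\<^sup>2 * (norm (v T m))\<^sup>2) + ?q * ((norm \<psi>)\<^sup>2 * (norm (v' T m))\<^sup>2))"
      unfolding a_def db b[of T, simplified, OF less_imp_le[OF T]] using T
      by (simp add: b flip: power_mult) (intro mult_left_mono add_mono hp, auto)
    also have "\<dots> = (norm \<psi>)\<^sup>2 * (exp (\<eta> * ?q * T) * (?q ^ 3 * (norm (v T m))\<^sup>2 + ?q * (norm (v' T m))\<^sup>2))"
      by (simp add: algebra_simps)
    also have "\<dots> \<le> (norm \<psi>)\<^sup>2 * (decay_constant T \<rho> (onorm ((*v) A)) * (?q ^ 3 * (norm (v 0 m))\<^sup>2 + ?q * (norm (v' 0 m))\<^sup>2))"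
      using m T by (intro mult_left_mono damped_mode_weighted_decay[OF _ \<rho> \<eta> _ _ mode]) auto
    also have "\<dots> = ?D * ?e m"
      unfolding sobolev_weight(1,2)[OF m] using sol by (simp add: solution_def mult_ac)
    finally show ?thesis .
  qed
  have e: "?e summable_on {1..}" by (intro summable_on_add Xspace_summable(1) u0 u1)
  have De: "(\<lambda>m. ?D * ?e m) summable_on {1..}" by (rule summable_on_cmult_right[OF e])
  show s: "a summable_on {1..}"
    by (rule summable_on_comparison_test[OF De]) (use bound in \<open>auto simp: a_def\<close>)
  have "infsum a {1..} \<le> infsum (\<lambda>m. ?D * ?e m) {1..}"
    by (rule infsum_mono[OF s De]) (use bound in auto)
  also have "\<dots> = ?D * ((Xnorm 3 u0)\<^sup>2 + (Xnorm 1 u1)\<^sup>2)"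
    unfolding infsum_cmult_right[OF e] infsum_add[OF Xspace_summable(1)[OF u0] Xspace_summable(1)[OF u1]]
      Xspace_summable(2)[OF u0] Xspace_summable(2)[OF u1] ..
  also have "\<dots> \<le> ?D * (Xnorm 3 u0 + Xnorm 1 u1)\<^sup>2"
    using Xnorm_nonneg[of 3 u0] Xnorm_nonneg[of 1 u1] by (intro mult_left_mono D) (simp add: power2_sum)
  finally show "infsum a {1..} \<le> ?D * (Xnorm 3 u0 + Xnorm 1 u1)\<^sup>2" .
qed

theorem proposition7:
  fixes T \<rho> :: real
    and A :: "complex^'n^'n" and B :: "complex^'l^'n"
  assumes "0 < T" and "0 < \<rho>" and "\<rho> < 2"
  shows
    "(\<exists>C. \<forall>f f' f''. \<forall>u0\<in>Xspace 3. \<forall>u1\<in>Xspace 1.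
        H2 T f f' f'' \<and> initial_value T f 0 \<and> initial_value T f' 0 \<longrightarrow>
        (\<exists>v v' v''. solution T \<rho> A B f f'' u0 u1 v v' v'' \<and>
           (\<forall>w w' w''. solution T \<rho> A B f f'' u0 u1 w w' w'' \<longrightarrow> (\<forall>t\<in>{0..T}. w t = v t)) \<and>
           C0norm T 3 v + C0norm T 1 v' + L2Xnorm T (-1) v''
             \<le> C * (Xnorm 3 u0 + Xnorm 1 u1 + H2norm T f f' f'')))
     \<and>
     (\<forall>p0 \<gamma> g r \<psi> \<eta>.
        jordan_data A p0 \<gamma> g r \<and>
        jordan_chain_basis (adjoint_mat A) p0 (\<lambda>j. cnj (\<gamma> j)) g r \<psi> \<and>
        0 < \<eta> \<and> \<eta> < \<rho> \<longrightarrow>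
        (\<exists>C. \<forall>j\<in>{1..p0}. \<forall>k\<in>{1..g j}. \<forall>s\<in>{1..r j k}. \<forall>u0\<in>Xspace 3. \<forall>u1\<in>Xspace 1. \<forall>v v' v''.
           solution T \<rho> A B (\<lambda>_. 0) (\<lambda>_. 0) u0 u1 v v' v'' \<longrightarrow>
           (let b = bcoef v (\<psi> j k s);
                db = (\<lambda>m. vector_derivative (b m) (at T within {0..T}));
                a = (\<lambda>m. exp (\<eta> * (real m)\<^sup>2 * T) *
                       ((real m)^6 * (cmod (b m T))\<^sup>2 + (real m)\<^sup>2 * (cmod (db m))\<^sup>2))
            in a summable_on {1..} \<and>
               (\<Sum>\<^sub>\<infinity>m\<in>{1..}. a m) \<le> C * (Xnorm 3 u0 + Xnorm 1 u1)\<^sup>2)))"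
proof (intro conjI allI impI)
  show "\<exists>C. \<forall>f f' f''. \<forall>u0\<in>Xspace 3. \<forall>u1\<in>Xspace 1.
        H2 T f f' f'' \<and> initial_value T f 0 \<and> initial_value T f' 0 \<longrightarrow>
        (\<exists>v v' v''. solution T \<rho> A B f f'' u0 u1 v v' v'' \<and>
           (\<forall>w w' w''. solution T \<rho> A B f f'' u0 u1 w w' w'' \<longrightarrow> (\<forall>t\<in>{0..T}. w t = v t)) \<and>
           C0norm T 3 v + C0norm T 1 v' + L2Xnorm T (-1) v''
             \<le> C * (Xnorm 3 u0 + Xnorm 1 u1 + H2norm T f f' f''))"
    using forced_problem_well_posed[OF assms, of A B] by (elim ex_forward) blast
next
  fix p0 :: nat and \<gamma> :: "nat \<Rightarrow> complex" and g r and \<psi> :: "nat \<Rightarrow> nat \<Rightarrow> nat \<Rightarrow> complex^'n" and \<eta>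
  assume "jordan_data A p0 \<gamma> g r \<and> jordan_chain_basis (adjoint_mat A) p0 (\<lambda>j. cnj (\<gamma> j)) g r \<psi> \<and> 0 < \<eta> \<and> \<eta> < \<rho>"
  then have \<eta>: "\<eta> \<le> \<rho>" by simp
  let ?D = "decay_constant T \<rho> (onorm ((*v) A))"
  \<comment> \<open>One constant for all indices: there are finitely many chain vectors.\<close>
  define M where "M = (\<Sum>j\<in>{1..p0}. \<Sum>k\<in>{1..g j}. \<Sum>s\<in>{1..r j k}. (norm (\<psi> j k s))\<^sup>2)"
  have D: "0 \<le> ?D" using power_strict_mono[of \<rho> 2 2] assms by (simp add: decay_constant_def)
  have M: "(norm (\<psi> j k s))\<^sup>2 \<le> M" if "j \<in> {1..p0}" "k \<in> {1..g j}" "s \<in> {1..r j k}" for j k s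
  proof -
    have "(norm (\<psi> j k s))\<^sup>2 \<le> (\<Sum>s\<in>{1..r j k}. (norm (\<psi> j k s))\<^sup>2)"
      using that(3) by (intro member_le_sum) auto
    also have "\<dots> \<le> (\<Sum>k\<in>{1..g j}. \<Sum>s\<in>{1..r j k}. (norm (\<psi> j k s))\<^sup>2)"
      using that(2) by (intro member_le_sum) (auto intro!: sum_nonneg)
    also have "\<dots> \<le> M" unfolding M_def
      using that(1) by (intro member_le_sum) (auto intro!: sum_nonneg)
    finally show ?thesis .
  qed
  show "\<exists>C. \<forall>j\<in>{1..p0}. \<forall>k\<in>{1..g j}. \<forall>s\<in>{1..r j k}. \<forall>u0\<in>Xspace 3. \<forall>u1\<in>Xspace 1. \<forall>v v' v''.
           solution T \<rho> A B (\<lambda>_. 0) (\<lambda>_. 0) u0 u1 v v' v'' \<longrightarrow>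
           (let b = bcoef v (\<psi> j k s);
                db = (\<lambda>m. vector_derivative (b m) (at T within {0..T}));
                a = (\<lambda>m. exp (\<eta> * (real m)\<^sup>2 * T) *
                       ((real m)^6 * (cmod (b m T))\<^sup>2 + (real m)\<^sup>2 * (cmod (db m))\<^sup>2))
            in a summable_on {1..} \<and>
               (\<Sum>\<^sub>\<infinity>m\<in>{1..}. a m) \<le> C * (Xnorm 3 u0 + Xnorm 1 u1)\<^sup>2)"
    unfolding Let_def
  proof (intro exI[of _ "?D * M"] ballI allI impI conjI)
    fix j k s u0 u1 v v' v''
    assume idx: "j \<in> {1..p0}" "k \<in> {1..g j}" "s \<in> {1..r j k}" and u: "u0 \<in> Xspace 3" "u1 \<in> Xspace 1"
      and sol: "solution T \<rho> A B (\<lambda>_. 0) (\<lambda>_. 0) u0 u1 v v' v''"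
    note decay = free_solution_coefficient_decay[OF assms \<eta> u sol, of "\<psi> j k s"]
    show "(\<lambda>m. exp (\<eta> * (real m)\<^sup>2 * T) * ((real m)^6 * (cmod (bcoef v (\<psi> j k s) m T))\<^sup>2
        + (real m)\<^sup>2 * (cmod (vector_derivative (bcoef v (\<psi> j k s) m) (at T within {0..T})))\<^sup>2)) summable_on {1..}"
      by (rule decay(1))
    have "?D * (norm (\<psi> j k s))\<^sup>2 * (Xnorm 3 u0 + Xnorm 1 u1)\<^sup>2 \<le> ?D * M * (Xnorm 3 u0 + Xnorm 1 u1)\<^sup>2"
      using D M[OF idx] by (intro mult_right_mono mult_left_mono) auto
    with decay(2) show "(\<Sum>\<^sub>\<infinity>m\<in>{1..}. exp (\<eta> * (real m)\<^sup>2 * T) * ((real m)^6 * (cmod (bcoef v (\<psi> j k s) m T))\<^sup>2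
        + (real m)\<^sup>2 * (cmod (vector_derivative (bcoef v (\<psi> j k s) m) (at T within {0..T})))\<^sup>2))
        \<le> ?D * M * (Xnorm 3 u0 + Xnorm 1 u1)\<^sup>2"
      by (rule order_trans)
  qed
qed

end
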